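(* Let $G$ be a finite simple graph on the vertex set $\{x_1,\ldots,x_h\}$, let $\mathcal{H}=\{H_i : x_i\in V(G)\}$, where $H_i=K_{m_i}$ is the complete graph on the vertex set $\{y_{i,1},\ldots,y_{i,m_i}\}$ with $m_i\ge1$, so that $G\circ\mathcal{H}$ is a clique corona graph, and let $S=\Bbbk[V(G\circ\mathcal{H})]$. Then the Hilbert series of $H^h_{\mathfrak{m}}(S/I(G\circ\mathcal{H}))$ is $$F(H^h_{\mathfrak{m}}(S/I(G\circ\mathcal{H})),t)=\sum_\ell\dim_\Bbbk[H^h_{\mathfrak{m}}(S/I(G\circ\mathcal{H}))]_\ell\,t^\ell=\sum_i\ \sum_{C\in\mathrm{Min}(G\circ\mathcal{H})}\binom{|V(G\circ\mathcal{H})\setminus(C\cup\{y_{1,m_1},\ldots,y_{h,m_h}\})|}{i}\left(\frac{t^{-1}}{1-t^{-1}}\right)^{h-i}.$$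
   Context: For a graph $G$ on $\{x_1,\ldots,x_h\}$ and a family $\mathcal{H}=\{H_i\}$ of non-empty graphs indexed by the vertices $x_i$, the corona graph $G\circ\mathcal{H}$ is the disjoint union of $G$ and the $H_i$ with additional edges joining each $x_i$ to all vertices of $H_i$; it is a clique corona graph if every $H_i$ is complete. $\Bbbk$ is an arbitrary field. The edge ideal $I(\Gamma)\subseteq\Bbbk[V(\Gamma)]$ of a graph $\Gamma$ is generated by the products $uv$ with $\{u,v\}\in E(\Gamma)$. $\mathrm{Min}(\Gamma)$ is the set of inclusion-minimal vertex covers of $\Gamma$. $\mathfrak{m}$ is the homogeneous maximal ideal of $S$ (standard grading); the right-hand side is read as a power series in $t^{-1}$. *)

theory Defs
  imports
    "HOL-Library.Poly_Mapping"
    "HOL-Algebra.QuotRing"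
    "HOL-Computational_Algebra.Formal_Laurent_Series"
    "Jordan_Normal_Form.VS_Connect"
begin

hide_const (open) Multiset.mult Polynomial.smult Modules.module

section \<open>Finite simple graphs, vertex covers, coronas\<close>

type_synonym 'v ugraph = "'v set \<times> 'v set set"

abbreviation (input) uverts :: "'v ugraph \<Rightarrow> 'v set" where "uverts \<equiv> fst"
abbreviation (input) uedges :: "'v ugraph \<Rightarrow> 'v set set" where "uedges \<equiv> snd"

definition finite_simple_graph :: "'v ugraph \<Rightarrow> bool" where
  "finite_simple_graph G \<longleftrightarrow> finite (uverts G) \<and>
     (\<forall>e\<in>uedges G. \<exists>u\<in>uverts G. \<exists>v\<in>uverts G. u \<noteq> v \<and> e = {u, v})"

definition complete_graph :: "'v set \<Rightarrow> 'v ugraph" where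
  "complete_graph W = (W, {{u, v} | u v. u \<in> W \<and> v \<in> W \<and> u \<noteq> v})"

text \<open>\<open>Xv i\<close> is the copy of the vertex \<open>i\<close> of the base graph; \<open>Yv i w\<close> is the copy of
  the vertex \<open>w\<close> of the graph attached at \<open>i\<close>.\<close>

datatype ('a, 'b) corona_vertex = Xv 'a | Yv 'a 'b

definition corona :: "'a ugraph \<Rightarrow> ('a \<Rightarrow> 'b ugraph) \<Rightarrow> ('a, 'b) corona_vertex ugraph" where
  "corona G H =
     (Xv ` uverts G \<union> {Yv i w | i w. i \<in> uverts G \<and> w \<in> uverts (H i)},
      {{Xv i, Xv j} | i j. {i, j} \<in> uedges G}
      \<union> {{Yv i u, Yv i v} | i u v. i \<in> uverts G \<and> {u, v} \<in> uedges (H i)}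
      \<union> {{Xv i, Yv i w} | i w. i \<in> uverts G \<and> w \<in> uverts (H i)})"

definition vertex_cover :: "'v ugraph \<Rightarrow> 'v set \<Rightarrow> bool" where
  "vertex_cover G C \<longleftrightarrow> C \<subseteq> uverts G \<and> (\<forall>e\<in>uedges G. e \<inter> C \<noteq> {})"

definition min_vertex_covers :: "'v ugraph \<Rightarrow> 'v set set" where
  "min_vertex_covers G = {C. vertex_cover G C \<and> (\<forall>D. D \<subset> C \<longrightarrow> \<not> vertex_cover G D)}"


section \<open>Polynomial rings and edge ideals\<close>

type_synonym ('v, 'k) mpoly = "('v \<Rightarrow>\<^sub>0 nat) \<Rightarrow>\<^sub>0 'k"

definition pconst :: "'k::field \<Rightarrow> ('v, 'k) mpoly" where
  "pconst c = Poly_Mapping.single 0 c"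

definition pvar :: "'v \<Rightarrow> ('v, 'k::field) mpoly" where
  "pvar v = Poly_Mapping.single (Poly_Mapping.single v 1) 1"

text \<open>The polynomial ring with variables indexed by the set \<open>V\<close>.\<close>

definition poly_ring_over :: "'v set \<Rightarrow> ('v, 'k::field) mpoly ring" where
  "poly_ring_over V =
     \<lparr>carrier = {p. \<forall>a\<in>Poly_Mapping.keys p. Poly_Mapping.keys a \<subseteq> V},
      mult = (*), one = 1, zero = 0, add = (+)\<rparr>"

definition mon_degree :: "('v \<Rightarrow>\<^sub>0 nat) \<Rightarrow> nat" where
  "mon_degree a = (\<Sum>v\<in>Poly_Mapping.keys a. Poly_Mapping.lookup a v)"

text \<open>The standard grading, indexed by the integers; the components of negative degree are \<open>{0}\<close>.\<close>

definition poly_comp :: "'v set \<Rightarrow> int \<Rightarrow> ('v, 'k::field) mpoly set" where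
  "poly_comp V d =
     {p \<in> carrier (poly_ring_over V). \<forall>a\<in>Poly_Mapping.keys p. int (mon_degree a) = d}"

definition edge_ideal :: "'v ugraph \<Rightarrow> ('v, 'k::field) mpoly set" where
  "edge_ideal G =
     genideal (poly_ring_over (uverts G)) {pvar u * pvar v | u v. {u, v} \<in> uedges G}"


section \<open>Modules\<close>

text \<open>As in HOL-Algebra, modules are records that carry along irrelevant \<open>mult\<close> and \<open>one\<close> fields.
  For an ideal \<open>I\<close> of \<open>R\<close>, \<open>quotient_module (self_module R) I\<close> is \<open>R Quot I\<close> as an \<open>R\<close>-module.\<close>

definition self_module :: "'r ring \<Rightarrow> ('r, 'r) module" where
  "self_module R = ring.extend R (module.fields (mult R))"

definition quotient_module :: "('r, 'm) module \<Rightarrow> 'm set \<Rightarrow> ('r, 'm set) module" where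
  "quotient_module M N =
     ring.extend (M Quot N)
       (module.fields (\<lambda>r X. \<Union>x\<in>X. N +>\<^bsub>M\<^esub> (r \<odot>\<^bsub>M\<^esub> x)))"

definition product_module :: "'i set \<Rightarrow> ('i \<Rightarrow> ('r, 'm) module) \<Rightarrow> ('r, 'i \<Rightarrow> 'm) module" where
  "product_module I N =
     \<lparr>carrier = (\<Pi>\<^sub>E i\<in>I. carrier (N i)), mult = undefined, one = undefined,
      zero = (\<lambda>i\<in>I. \<zero>\<^bsub>N i\<^esub>),
      add = (\<lambda>c d. \<lambda>i\<in>I. c i \<oplus>\<^bsub>N i\<^esub> d i),
      smult = (\<lambda>r c. \<lambda>i\<in>I. r \<odot>\<^bsub>N i\<^esub> c i)\<rparr>"

text \<open>\<open>loc_class R M f x n\<close> is the fraction \<open>x / f\<^sup>n\<close> in the localization \<open>M\<^sub>f\<close>: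
  the class of \<open>(x, n)\<close> under \<open>(x, n) \<sim> (y, k)\<close> iff
  \<open>f\<^sup>j (f\<^sup>k x) = f\<^sup>j (f\<^sup>n y)\<close> for some \<open>j\<close>.\<close>

definition loc_class :: "'r ring \<Rightarrow> ('r, 'm) module \<Rightarrow> 'r \<Rightarrow> 'm \<Rightarrow> nat \<Rightarrow> ('m \<times> nat) set" where
  "loc_class R M f x n =
     {(y, k). y \<in> carrier M \<and>
        (\<exists>j. (f [^]\<^bsub>R\<^esub> (j + k)) \<odot>\<^bsub>M\<^esub> x = (f [^]\<^bsub>R\<^esub> (j + n)) \<odot>\<^bsub>M\<^esub> y)}"

definition localization :: "'r ring \<Rightarrow> ('r, 'm) module \<Rightarrow> 'r \<Rightarrow> ('r, ('m \<times> nat) set) module" where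
  "localization R M f =
     \<lparr>carrier = {loc_class R M f x n | x n. x \<in> carrier M}, mult = undefined, one = undefined,
      zero = loc_class R M f \<zero>\<^bsub>M\<^esub> 0,
      add = (\<lambda>A B. \<Union>(x, n)\<in>A. \<Union>(y, k)\<in>B.
        loc_class R M f ((f [^]\<^bsub>R\<^esub> k) \<odot>\<^bsub>M\<^esub> x \<oplus>\<^bsub>M\<^esub> (f [^]\<^bsub>R\<^esub> n) \<odot>\<^bsub>M\<^esub> y) (n + k)),
      smult = (\<lambda>r A. \<Union>(x, n)\<in>A. loc_class R M f (r \<odot>\<^bsub>M\<^esub> x) n)\<rparr>"

text \<open>The canonical map \<open>M\<^sub>f \<rightarrow> M\<^sub>f\<^sub>g\<close>, that is \<open>x / f\<^sup>n \<mapsto> g\<^sup>n x / (f g)\<^sup>n\<close>.\<close>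

definition loc_map ::
  "'r ring \<Rightarrow> ('r, 'm) module \<Rightarrow> 'r \<Rightarrow> 'r \<Rightarrow> ('m \<times> nat) set \<Rightarrow> ('m \<times> nat) set" where
  "loc_map R M f g A =
     (\<Union>(x, n)\<in>A. loc_class R M (f \<otimes>\<^bsub>R\<^esub> g) ((g [^]\<^bsub>R\<^esub> n) \<odot>\<^bsub>M\<^esub> x) n)"


section \<open>Local cohomology\<close>

text \<open>Local cohomology of a module \<open>M\<close> over a Noetherian commutative ring \<open>R\<close> with support
  in the ideal generated by \<open>f\<^sub>0, \<dots>, f\<^sub>n\<^sub>-\<^sub>1\<close> is taken to be the cohomology of the
  Cech complex
  \<open>0 \<rightarrow> M \<rightarrow> \<Oplus>\<^sub>i M\<^bsub>f\<^sub>i\<^esub> \<rightarrow> \<Oplus>\<^sub>i\<^sub><\<^sub>j M\<^bsub>f\<^sub>i f\<^sub>j\<^esub> \<rightarrow> \<dots> \<rightarrow> M\<^bsub>f\<^sub>0 \<cdots> f\<^sub>n\<^sub>-\<^sub>1\<^esub> \<rightarrow> 0\<close>,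
  with \<open>M\<close> in cohomological degree \<open>0\<close>.\<close>

definition cech_faces :: "'r list \<Rightarrow> nat \<Rightarrow> nat set set" where
  "cech_faces fs p = {F. F \<subseteq> {..<length fs} \<and> card F = p}"

definition cech_elem :: "'r ring \<Rightarrow> 'r list \<Rightarrow> nat set \<Rightarrow> 'r" where
  "cech_elem R fs F = finprod R (\<lambda>j. fs ! j) F"

definition cech ::
  "'r ring \<Rightarrow> ('r, 'm) module \<Rightarrow> 'r list \<Rightarrow> nat \<Rightarrow> ('r, nat set \<Rightarrow> ('m \<times> nat) set) module" where
  "cech R M fs p =
     product_module (cech_faces fs p) (\<lambda>F. localization R M (cech_elem R fs F))"

definition cech_diff ::
  "'r ring \<Rightarrow> ('r, 'm) module \<Rightarrow> 'r list \<Rightarrow> nat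
     \<Rightarrow> (nat set \<Rightarrow> ('m \<times> nat) set) \<Rightarrow> nat set \<Rightarrow> ('m \<times> nat) set" where
  "cech_diff R M fs p c =
     (\<lambda>F\<in>cech_faces fs (Suc p).
        let L = localization R M (cech_elem R fs F) in
        finsum L (\<lambda>j.
          let y = loc_map R M (cech_elem R fs (F - {j})) (fs ! j) (c (F - {j})) in
          if even (card {i \<in> F. i < j}) then y else \<ominus>\<^bsub>L\<^esub> y) F)"

definition cech_cocycles ::
  "'r ring \<Rightarrow> ('r, 'm) module \<Rightarrow> 'r list \<Rightarrow> nat \<Rightarrow> (nat set \<Rightarrow> ('m \<times> nat) set) set" where
  "cech_cocycles R M fs p =
     {c \<in> carrier (cech R M fs p). cech_diff R M fs p c = \<zero>\<^bsub>cech R M fs (Suc p)\<^esub>}"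

definition cech_coboundaries ::
  "'r ring \<Rightarrow> ('r, 'm) module \<Rightarrow> 'r list \<Rightarrow> nat \<Rightarrow> (nat set \<Rightarrow> ('m \<times> nat) set) set" where
  "cech_coboundaries R M fs p =
     (case p of 0 \<Rightarrow> {\<zero>\<^bsub>cech R M fs 0\<^esub>}
      | Suc q \<Rightarrow> cech_diff R M fs q ` carrier (cech R M fs q))"

definition local_cohomology ::
  "'r ring \<Rightarrow> ('r, 'm) module \<Rightarrow> 'r list \<Rightarrow> nat
     \<Rightarrow> ('r, (nat set \<Rightarrow> ('m \<times> nat) set) set) module" where
  "local_cohomology R M fs p =
     quotient_module ((cech R M fs p)\<lparr>carrier := cech_cocycles R M fs p\<rparr>)
       (cech_coboundaries R M fs p)"

text \<open>The grading induced by a grading \<open>Md\<close> of \<open>M\<close>, for homogeneous \<open>fs\<close> of degree \<open>1\<close>: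
  \<open>x / f\<^sup>n\<close> has degree \<open>deg x - n deg f\<close>, and the product of the \<open>fs ! j\<close> for
  \<open>j \<in> F\<close> has degree \<open>card F\<close>.\<close>

definition loc_comp ::
  "'r ring \<Rightarrow> ('r, 'm) module \<Rightarrow> (int \<Rightarrow> 'm set) \<Rightarrow> 'r \<Rightarrow> nat \<Rightarrow> int \<Rightarrow> ('m \<times> nat) set set" where
  "loc_comp R M Md f e d = {loc_class R M f x n | x n. x \<in> Md (d + int n * int e)}"

definition cech_comp ::
  "'r ring \<Rightarrow> ('r, 'm) module \<Rightarrow> (int \<Rightarrow> 'm set) \<Rightarrow> 'r list \<Rightarrow> nat \<Rightarrow> int
     \<Rightarrow> (nat set \<Rightarrow> ('m \<times> nat) set) set" where
  "cech_comp R M Md fs p d =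
     {c \<in> carrier (cech R M fs p).
        \<forall>F\<in>cech_faces fs p. c F \<in> loc_comp R M Md (cech_elem R fs F) (card F) d}"

definition local_cohomology_comp ::
  "'r ring \<Rightarrow> ('r, 'm) module \<Rightarrow> (int \<Rightarrow> 'm set) \<Rightarrow> 'r list \<Rightarrow> nat \<Rightarrow> int
     \<Rightarrow> (nat set \<Rightarrow> ('m \<times> nat) set) set set" where
  "local_cohomology_comp R M Md fs p d =
     {cech_coboundaries R M fs p +>\<^bsub>cech R M fs p\<^esub> z | z.
        z \<in> cech_cocycles R M fs p \<inter> cech_comp R M Md fs p d}"


section \<open>Hilbert series\<close>

text \<open>The subset \<open>W\<close> of a module over a polynomial ring, as a vector space over the
  field of coefficients.\<close>

definition coeff_space :: "(('v, 'k::field) mpoly, 'm) module \<Rightarrow> 'm set \<Rightarrow> ('k, 'm) module" where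
  "coeff_space M W =
     \<lparr>carrier = W, mult = mult M, one = one M, zero = zero M, add = add M,
      smult = (\<lambda>c x. pconst c \<odot>\<^bsub>M\<^esub> x)\<rparr>"

text \<open>\<open>F\<close> is the Hilbert series \<open>\<Sum>\<^sub>l dim W\<^sub>l t\<^sup>l\<close> of a graded vector space, written as a
  formal Laurent series in the variable \<open>t\<^sup>-\<^sup>1\<close>: the coefficient of \<open>t\<^sup>l\<close> is
  \<open>fls_nth F (-l)\<close>. The dimension of \<open>vectorspace.dim\<close> is a natural number and
  therefore only meaningful along with finite dimensionality.\<close>

definition is_hilbert_series_tinv :: "(int \<Rightarrow> ('k::field, 'm) module) \<Rightarrow> rat fls \<Rightarrow> bool" where
  "is_hilbert_series_tinv W F \<longleftrightarrow>
     (\<forall>l. vectorspace class_ring (W l) \<and> vectorspace.fin_dim class_ring (W l) \<and>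
          fls_nth F (- l) = of_nat (vectorspace.dim class_ring (W l)))"

text \<open>\<open>[H\<^sup>p\<^sub>\<mm>(S/I(\<Gamma>))]\<^sub>l\<close>, where \<open>S\<close> is the polynomial ring on the vertices of
  \<open>\<Gamma>\<close>, \<open>\<mm>\<close> is generated by the variables, and \<open>vs\<close> lists the vertices of \<open>\<Gamma>\<close>.\<close>

definition edge_ring_local_cohomology ::
  "'k::field itself \<Rightarrow> 'v ugraph \<Rightarrow> 'v list \<Rightarrow> nat \<Rightarrow> int
     \<Rightarrow> ('k, (nat set \<Rightarrow> (('v, 'k) mpoly set \<times> nat) set) set) module" where
  "edge_ring_local_cohomology k \<Gamma> vs p l =
     (let S = poly_ring_over (uverts \<Gamma>);
          I = edge_ideal \<Gamma>;
          A = quotient_module (self_module S) I;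
          Ad = (\<lambda>d. {I +>\<^bsub>S\<^esub> q | q. q \<in> poly_comp (uverts \<Gamma>) d});
          fs = map pvar vs
      in coeff_space (local_cohomology S A fs p) (local_cohomology_comp S A Ad fs p l))"

end

theory Submission
  imports Defs
begin

text \<open>
  The vertices of the clique corona graph are partitioned into the \<open>h\<close> cliques
  \<open>{x\<^sub>i, y\<^sub>i\<^sub>1, y\<^sub>i\<^sub>2, \<dots>}\<close>. An independent set meets each of them at most once, and an independent
  set that misses the \<open>i\<close>-th clique can be enlarged by its last vertex, the apex, since all neighbors
  of the apex lie in the clique. The locale \<open>transversal_complex\<close> records just these two properties
  of the independence complex; the local cohomology is computed from them alone. In particular, the
  facets have exactly \<open>h\<close> elements, one from each class, and they are the complements of the
  minimal vertex covers.

  Since the monomials with independent support form a basis of \<open>S/I\<close>, the Cech complex vanishes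
  above degree \<open>h\<close>, and its part in degree \<open>h\<close> is the direct sum over the facets \<open>F\<close> of the Laurent
  polynomial rings in the variables of \<open>F\<close>. Hence the top local cohomology is the quotient of this
  sum by the image of the differential. Its part of degree \<open>l\<close> has a basis consisting of the classes
  of the monomials \<open>x\<^sup>-\<^sup>b\<close> placed at a facet \<open>B\<close>, where \<open>b\<close> has total degree \<open>-l\<close> and a support
  that is contained in \<open>B\<close> and contains all apexes in \<open>B\<close> (\<open>basis_index\<close>).

  \<^item> These classes span (\<open>monomial_spanned\<close>). Suppose that the Laurent monomial \<open>x\<^sup>a\<close> sits at the facet
    \<open>F\<close> and that \<open>a\<^sub>j \<ge> 0\<close> for some \<open>j\<close> in \<open>F\<close>. Then \<open>x\<^sup>a\<close> lives already at \<open>E = F - {j}\<close>, and its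
    coboundary expresses \<open>x\<^sup>a\<close> at \<open>F\<close> through \<open>x\<^sup>a\<close> at the other facets \<open>E \<union> {w}\<close>. If \<open>a\<^sub>j > 0\<close>, then these
    other terms are zero. If \<open>a\<^sub>j = 0\<close> and \<open>j\<close> is an apex, then \<open>w\<close> is a vertex of the same class
    that is not an apex, so that the number of apexes with exponent zero drops.
  \<^item> They are linearly independent, because the functionals \<open>dual\<close> vanish on coboundaries
    (\<open>dual_coboundary\<close>) and are dual to them (\<open>dual_basis_cochain\<close>). The functional at \<open>(B, b)\<close> is the
    signed sum of the coefficients of \<open>x\<^sup>-\<^sup>b\<close> at all facets that arise from \<open>B\<close> by replacing
    vertices by the apexes of their classes; these facets form the join of a simplex
    with the boundary of a cross-polytope.

  It remains to count: for given \<open>B\<close>, the possible supports of \<open>b\<close> are the sets \<open>B - Z\<close>, where \<open>Z\<close> is a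
  set of vertices of \<open>B\<close> other than apexes, and the monomials with a given support of size \<open>h - i\<close> have the
  generating function \<open>(t\<^sup>-\<^sup>1 / (1 - t\<^sup>-\<^sup>1))\<^sup>h\<^sup>-\<^sup>i\<close>.
\<close>

section \<open>Quotients and products of modules\<close>

lemma (in abelian_group) coset_eq_iff:
  assumes N: "additive_subgroup N G" and x: "x \<in> carrier G" and y: "y \<in> carrier G"
  shows "N +> x = N +> y \<longleftrightarrow> x \<ominus> y \<in> N"
proof -
  interpret N: abelian_subgroup N G
    by (rule abelian_subgroupI3[OF N abelian_group_axioms])
  have "N +> x = N +> y \<longleftrightarrow> x \<in> N +> y"
    using x y N.a_subgroup N.a_rcos_self a_repr_independence by metis
  also have "\<dots> \<longleftrightarrow> x \<ominus> y \<in> N"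
    using N.a_rcos_module[of y x] x y by (simp add: a_minus_def abelian_group_axioms)
  finally show ?thesis .
qed

lemma UN_constant_on:
  assumes "a \<in> A" and "\<And>x. x \<in> A \<Longrightarrow> f x = B"
  shows "(\<Union>x\<in>A. f x) = B"
  using assms by blast

lemma (in module) coset_smult:
  assumes N: "additive_subgroup N M" and st: "\<And>n. n \<in> N \<Longrightarrow> r \<odot>\<^bsub>M\<^esub> n \<in> N"
    and r: "r \<in> carrier R" and x: "x \<in> carrier M"
  shows "(\<Union>z\<in>N +>\<^bsub>M\<^esub> x. N +>\<^bsub>M\<^esub> (r \<odot>\<^bsub>M\<^esub> z)) = N +>\<^bsub>M\<^esub> (r \<odot>\<^bsub>M\<^esub> x)"
proof -
  interpret N: abelian_subgroup N M
    by (rule abelian_subgroupI3[OF N M.abelian_group_axioms])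
  show ?thesis
  proof (rule UN_constant_on)
    show "x \<in> N +>\<^bsub>M\<^esub> x" by (rule N.a_rcos_self[OF x])
    fix z assume "z \<in> N +>\<^bsub>M\<^esub> x"
    then obtain n where n: "n \<in> N" "z = n \<oplus>\<^bsub>M\<^esub> x"
      by (auto simp: a_r_coset_def')
    have nM: "n \<in> carrier M" using n N.a_subset by blast
    have "r \<odot>\<^bsub>M\<^esub> z = r \<odot>\<^bsub>M\<^esub> n \<oplus>\<^bsub>M\<^esub> r \<odot>\<^bsub>M\<^esub> x"
      using n nM r x by (simp add: smult_r_distr)
    then have "r \<odot>\<^bsub>M\<^esub> z \<in> N +>\<^bsub>M\<^esub> (r \<odot>\<^bsub>M\<^esub> x)"
      using st[OF n(1)] by (auto simp: a_r_coset_def')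
    then show "N +>\<^bsub>M\<^esub> (r \<odot>\<^bsub>M\<^esub> z) = N +>\<^bsub>M\<^esub> (r \<odot>\<^bsub>M\<^esub> x)"
      using M.a_repr_independence N.a_subgroup r x by (metis smult_closed)
  qed
qed

lemma quotient_module_simps:
  "carrier (quotient_module M N) = (\<lambda>x. N +>\<^bsub>M\<^esub> x) ` carrier M"
  "\<zero>\<^bsub>quotient_module M N\<^esub> = N"
  "add (quotient_module M N) = (<+>\<^bsub>M\<^esub>)"
  "r \<odot>\<^bsub>quotient_module M N\<^esub> X = (\<Union>x\<in>X. N +>\<^bsub>M\<^esub> (r \<odot>\<^bsub>M\<^esub> x))"
  by (auto simp: quotient_module_def FactRing_def ring.defs module.defs A_RCOSETS_def')

lemma module_quotient_module:
  fixes R (structure) and M :: "('r, 'm) module"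
  assumes M: "module R M" and N: "additive_subgroup N M"
    and st: "\<And>r n. r \<in> carrier R \<Longrightarrow> n \<in> N \<Longrightarrow> r \<odot>\<^bsub>M\<^esub> n \<in> N"
  shows "module R (quotient_module M N)"
proof -
  interpret M: module R M by (rule M)
  interpret N: abelian_subgroup N M
    by (rule abelian_subgroupI3[OF N M.abelian_group_axioms])
  have sm: "r \<odot>\<^bsub>quotient_module M N\<^esub> (N +>\<^bsub>M\<^esub> x) = N +>\<^bsub>M\<^esub> (r \<odot>\<^bsub>M\<^esub> x)"
    if "r \<in> carrier R" "x \<in> carrier M" for r x
    using M.coset_smult[OF N st] that by (simp add: quotient_module_simps)
  have N0: "N +>\<^bsub>M\<^esub> \<zero>\<^bsub>M\<^esub> = N"
    by (simp add: M.M.a_coset_add_zero N.a_subset)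
  have sumN: "N <+>\<^bsub>M\<^esub> (N +>\<^bsub>M\<^esub> x) = N +>\<^bsub>M\<^esub> x" if "x \<in> carrier M" for x
    using N.a_rcos_sum[of "\<zero>\<^bsub>M\<^esub>" x] that by (simp add: N0)
  show ?thesis
  proof (rule moduleI)
    show "cring R" by (rule M.is_cring)
    show "abelian_group (quotient_module M N)"
    proof (rule abelian_groupI)
      fix x assume "x \<in> carrier (quotient_module M N)"
      then obtain a where a: "a \<in> carrier M" "x = N +>\<^bsub>M\<^esub> a"
        by (auto simp: quotient_module_simps)
      then show "\<exists>y\<in>carrier (quotient_module M N).
          y \<oplus>\<^bsub>quotient_module M N\<^esub> x = \<zero>\<^bsub>quotient_module M N\<^esub>"
        by (auto simp: quotient_module_simps N.a_rcos_sum N0 M.M.l_neg intro!: bexI[of _ "\<ominus>\<^bsub>M\<^esub> a"])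
    next
      show "\<zero>\<^bsub>quotient_module M N\<^esub> \<in> carrier (quotient_module M N)"
        using N0 by (force simp: quotient_module_simps)
    qed (auto simp: quotient_module_simps N.a_rcos_sum M.M.a_ac sumN)
  qed (auto simp: quotient_module_simps(1-3) sm N.a_rcos_sum M.smult_l_distr M.smult_r_distr M.smult_assoc1)
qed

lemma product_module_simps:
  "carrier (product_module I N) = (\<Pi>\<^sub>E i\<in>I. carrier (N i))"
  "\<zero>\<^bsub>product_module I N\<^esub> = (\<lambda>i\<in>I. \<zero>\<^bsub>N i\<^esub>)"
  "c \<oplus>\<^bsub>product_module I N\<^esub> d = (\<lambda>i\<in>I. c i \<oplus>\<^bsub>N i\<^esub> d i)"
  "r \<odot>\<^bsub>product_module I N\<^esub> c = (\<lambda>i\<in>I. r \<odot>\<^bsub>N i\<^esub> c i)"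
  by (auto simp: product_module_def)

lemma module_product_module:
  assumes R: "cring R" and N: "\<And>i. i \<in> I \<Longrightarrow> module R (N i)"
  shows "module R (product_module I N)"
proof (rule moduleI)
  have ab: "abelian_group (N i)" if "i \<in> I" for i
    using N[OF that] by (rule module.axioms(2))
  then have ab': "abelian_monoid (N i)" if "i \<in> I" for i
    using that by (simp add: abelian_group.axioms(1))
  show "abelian_group (product_module I N)"
  proof (rule abelian_groupI)
    fix x assume "x \<in> carrier (product_module I N)"
    then show "\<exists>y\<in>carrier (product_module I N).
          y \<oplus>\<^bsub>product_module I N\<^esub> x = \<zero>\<^bsub>product_module I N\<^esub>"
      using ab
      by (auto simp: product_module_simps PiE_iff abelian_group.l_neg
          intro!: bexI[of _ "\<lambda>i\<in>I. \<ominus>\<^bsub>N i\<^esub> x i"] restrict_ext abelian_group.a_inv_closed)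
  qed (auto simp: product_module_simps PiE_iff extensional_def fun_eq_iff
        intro: abelian_monoid.a_closed[OF ab'] abelian_monoid.zero_closed[OF ab']
          abelian_monoid.a_assoc[OF ab'] abelian_monoid.a_comm[OF ab']
          abelian_monoid.l_zero[OF ab'])
qed (auto simp: product_module_simps PiE_iff extensional_def fun_eq_iff R
       intro: module.smult_closed[OF N] module.smult_l_distr[OF N] module.smult_r_distr[OF N]
         module.smult_assoc1[OF N] module.smult_one[OF N])

section \<open>Localizations as modules\<close>

text \<open>A module with an element to be inverted. \<open>P a x\<close> is \<open>f\<^sup>a x\<close>, \<open>cl x n\<close> is the fraction \<open>x / f\<^sup>n\<close>,
  and \<open>L\<close> is the localization.\<close>

locale localized_module = module R M for R :: "'r ring" (structure) and M :: "('r, 'm) module" +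
  fixes f :: 'r
  assumes f_closed [simp]: "f \<in> carrier R"
begin

abbreviation P :: "nat \<Rightarrow> 'm \<Rightarrow> 'm" where "P a x \<equiv> (f [^] a) \<odot>\<^bsub>M\<^esub> x"
abbreviation cl :: "'m \<Rightarrow> nat \<Rightarrow> ('m \<times> nat) set" where "cl \<equiv> loc_class R M f"
abbreviation L :: "('r, ('m \<times> nat) set) module" where "L \<equiv> localization R M f"

lemma P_add [simp]: "x \<in> carrier M \<Longrightarrow> P a (P b x) = P (a + b) x"
  by (simp add: smult_assoc1[symmetric] nat_pow_mult)

lemma P_smult: "r \<in> carrier R \<Longrightarrow> x \<in> carrier M \<Longrightarrow> P a (r \<odot>\<^bsub>M\<^esub> x) = r \<odot>\<^bsub>M\<^esub> P a x"
  by (metis f_closed m_comm nat_pow_closed smult_assoc1)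

lemma loc_class_eq_iff:
  assumes x: "x \<in> carrier M" and y: "y \<in> carrier M"
  shows "cl x n = cl y k \<longleftrightarrow> (\<exists>j. P (j + k) x = P (j + n) y)"
proof
  assume "cl x n = cl y k"
  moreover have "(y, k) \<in> cl y k" using y by (auto simp: loc_class_def)
  ultimately have "(y, k) \<in> cl x n" by simp
  then show "\<exists>j. P (j + k) x = P (j + n) y" by (simp add: loc_class_def)
next
  \<comment> \<open>The two relations can be chained after multiplication by powers of \<open>f\<close>;
    the exponent \<open>i + j + k\<close> works.\<close>
  have trans: "\<exists>t. P (t + m) x = P (t + n) z"
    if "x \<in> carrier M" "y \<in> carrier M" "z \<in> carrier M"
      "P (j + k) x = P (j + n) y" "P (i + m) y = P (i + k) z" for x y z n k m i j
  proof -
    have "P ((i + j + k) + m) x = P (i + m) (P (j + k) x)"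
      using that(1) by (simp add: algebra_simps)
    also have "\<dots> = P (i + m) (P (j + n) y)" by (simp only: that(4))
    also have "\<dots> = P (j + n) (P (i + m) y)"
      using that(2) by (simp add: algebra_simps)
    also have "\<dots> = P (j + n) (P (i + k) z)" by (simp only: that(5))
    also have "\<dots> = P ((i + j + k) + n) z"
      using that(3) by (simp add: algebra_simps)
    finally show ?thesis by blast
  qed
  assume "\<exists>j. P (j + k) x = P (j + n) y"
  then obtain j where j: "P (j + k) x = P (j + n) y" by blast
  have "(\<exists>t. P (t + m) x = P (t + n) z) \<longleftrightarrow> (\<exists>t. P (t + m) y = P (t + k) z)"
    if "z \<in> carrier M" for z m
    using trans[OF y x that j[symmetric]] trans[OF x y that j] by metis
  then show "cl x n = cl y k"
    unfolding loc_class_def by blast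
qed

lemma loc_class_self: "x \<in> carrier M \<Longrightarrow> (x, n) \<in> cl x n"
  by (auto simp: loc_class_def)

lemma mem_loc_class_iff: "x \<in> carrier M \<Longrightarrow> (y, k) \<in> cl x n \<longleftrightarrow> y \<in> carrier M \<and> cl y k = cl x n"
  using loc_class_eq_iff[of x y n k] by (auto simp: loc_class_def)

lemma loc_class_expand: "x \<in> carrier M \<Longrightarrow> cl (P k x) (k + n) = cl x n"
  by (subst loc_class_eq_iff) (auto intro!: exI[of _ 0] simp: algebra_simps)

lemma carrier_localization: "carrier L = {cl x n | x n. x \<in> carrier M}"
  by (simp add: localization_def)

lemma loc_class_closed [simp]: "x \<in> carrier M \<Longrightarrow> cl x n \<in> carrier L"
  by (auto simp: carrier_localization)

lemma zero_localization: "\<zero>\<^bsub>L\<^esub> = cl \<zero>\<^bsub>M\<^esub> n"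
proof -
  have "\<zero>\<^bsub>L\<^esub> = cl \<zero>\<^bsub>M\<^esub> 0" by (simp add: localization_def)
  also have "\<dots> = cl \<zero>\<^bsub>M\<^esub> n" by (subst loc_class_eq_iff) auto
  finally show ?thesis .
qed

text \<open>Operations on fractions are unions over all representatives. They may be computed from a single one
  as soon as the summand depends on the fraction only.\<close>

lemma UN_loc_class:
  assumes "x \<in> carrier M"
    and "\<And>y k. y \<in> carrier M \<Longrightarrow> cl y k = cl x n \<Longrightarrow> g y k = B"
  shows "(\<Union>(y, k)\<in>cl x n. g y k) = B"
  by (rule UN_constant_on[OF loc_class_self[OF assms(1)]])
    (use assms in \<open>auto simp: mem_loc_class_iff\<close>)

lemma add_localization:
  assumes x: "x \<in> carrier M" and y: "y \<in> carrier M"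
  shows "cl x n \<oplus>\<^bsub>L\<^esub> cl y k = cl (P k x \<oplus>\<^bsub>M\<^esub> P n y) (n + k)"
proof -
  have "cl (P k' x' \<oplus>\<^bsub>M\<^esub> P n' y') (n' + k') = cl (P k x \<oplus>\<^bsub>M\<^esub> P n y) (n + k)"
    if x': "x' \<in> carrier M" and y': "y' \<in> carrier M"
      and ex: "cl x' n' = cl x n" and ey: "cl y' k' = cl y k" for x' y' n' k'
  proof -
    obtain j where j: "P (j + n) x' = P (j + n') x"
      using ex loc_class_eq_iff[OF x' x] by blast
    obtain i where i: "P (i + k) y' = P (i + k') y"
      using ey loc_class_eq_iff[OF y' y] by blast
    have jj: "P (t + (j + n)) x' = P (t + (j + n')) x" for t
      using arg_cong[OF j, of "P t"] x x' by simp
    have ii: "P (t + (i + k)) y' = P (t + (i + k')) y" for t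
      using arg_cong[OF i, of "P t"] y y' by simp
    have "P ((i + j) + (n + k)) (P k' x' \<oplus>\<^bsub>M\<^esub> P n' y')
        = P ((i + k + k') + (j + n)) x' \<oplus>\<^bsub>M\<^esub> P ((j + n + n') + (i + k)) y'"
      using x' y' by (simp add: smult_r_distr algebra_simps)
    also have "\<dots> = P ((i + j) + (n' + k')) (P k x \<oplus>\<^bsub>M\<^esub> P n y)"
      unfolding ii jj using x y by (simp add: smult_r_distr algebra_simps)
    finally show ?thesis
      using x y x' y' by (subst loc_class_eq_iff) auto
  qed
  note * = this
  have "cl x n \<oplus>\<^bsub>L\<^esub> cl y k =
      (\<Union>(x, n)\<in>cl x n. \<Union>(y, k)\<in>cl y k. cl (P k x \<oplus>\<^bsub>M\<^esub> P n y) (n + k))"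
    by (simp add: localization_def)
  also have "\<dots> = cl (P k x \<oplus>\<^bsub>M\<^esub> P n y) (n + k)"
    by (intro UN_loc_class x y *)
  finally show ?thesis .
qed

lemma add_localization_same:
  assumes x: "x \<in> carrier M" and y: "y \<in> carrier M"
  shows "cl x n \<oplus>\<^bsub>L\<^esub> cl y n = cl (x \<oplus>\<^bsub>M\<^esub> y) n"
  using loc_class_expand[of "x \<oplus>\<^bsub>M\<^esub> y" n n] x y by (simp add: add_localization smult_r_distr)

lemma smult_localization:
  assumes r: "r \<in> carrier R" and x: "x \<in> carrier M"
  shows "r \<odot>\<^bsub>L\<^esub> cl x n = cl (r \<odot>\<^bsub>M\<^esub> x) n"
proof -
  have "cl (r \<odot>\<^bsub>M\<^esub> y) k = cl (r \<odot>\<^bsub>M\<^esub> x) n" if y: "y \<in> carrier M" and e: "cl y k = cl x n" for y k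
  proof -
    obtain j where "P (j + n) y = P (j + k) x"
      using e loc_class_eq_iff[OF y x] by blast
    then show ?thesis
      using x y r by (subst loc_class_eq_iff) (auto simp: P_smult intro!: exI[of _ j])
  qed
  note * = this
  have "r \<odot>\<^bsub>L\<^esub> cl x n = (\<Union>(x, n)\<in>cl x n. cl (r \<odot>\<^bsub>M\<^esub> x) n)"
    by (simp add: localization_def)
  also have "\<dots> = cl (r \<odot>\<^bsub>M\<^esub> x) n"
    by (intro UN_loc_class x *)
  finally show ?thesis .
qed

lemma common_denominator2:
  assumes "A \<in> carrier L" "B \<in> carrier L"
  obtains x y n where "x \<in> carrier M" "y \<in> carrier M" "A = cl x n" "B = cl y n"
proof -
  obtain x n y k where *: "x \<in> carrier M" "y \<in> carrier M" "A = cl x n" "B = cl y k"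
    using assms by (auto simp: carrier_localization)
  have "A = cl (P k x) (k + n)" "B = cl (P n y) (k + n)"
    using * loc_class_expand[of x k n] loc_class_expand[of y n k] by (simp_all add: add.commute)
  then show thesis using that[of "P k x" "P n y" "k + n"] * by simp
qed

lemma common_denominator3:
  assumes "A \<in> carrier L" "B \<in> carrier L" "C \<in> carrier L"
  obtains x y z n where "x \<in> carrier M" "y \<in> carrier M" "z \<in> carrier M"
    "A = cl x n" "B = cl y n" "C = cl z n"
proof -
  obtain x y n where *: "x \<in> carrier M" "y \<in> carrier M" "A = cl x n" "B = cl y n"
    by (rule common_denominator2[OF assms(1,2)])
  obtain z k where **: "z \<in> carrier M" "C = cl z k"
    using assms by (auto simp: carrier_localization)
  have "A = cl (P k x) (k + n)" "B = cl (P k y) (k + n)" "C = cl (P n z) (k + n)"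
    using * ** loc_class_expand[of x k n] loc_class_expand[of y k n] loc_class_expand[of z n k]
    by (simp_all add: add.commute)
  then show thesis using that[of "P k x" "P k y" "P n z" "k + n"] * ** by simp
qed

lemma module_localization: "module R L"
proof (rule moduleI)
  show "cring R" by (rule R.is_cring)
  show "abelian_group L"
  proof (rule abelian_groupI)
    fix A B assume AB: "A \<in> carrier L" "B \<in> carrier L"
    obtain x y n where xy: "x \<in> carrier M" "y \<in> carrier M" "A = cl x n" "B = cl y n"
      by (rule common_denominator2[OF AB])
    then show "A \<oplus>\<^bsub>L\<^esub> B \<in> carrier L" "A \<oplus>\<^bsub>L\<^esub> B = B \<oplus>\<^bsub>L\<^esub> A"
      by (simp_all add: add_localization_same M.a_comm)
    fix C assume C: "C \<in> carrier L"
    obtain x y z n where "x \<in> carrier M" "y \<in> carrier M" "z \<in> carrier M"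
        "A = cl x n" "B = cl y n" "C = cl z n"
      by (rule common_denominator3[OF AB C])
    then show "A \<oplus>\<^bsub>L\<^esub> B \<oplus>\<^bsub>L\<^esub> C = A \<oplus>\<^bsub>L\<^esub> (B \<oplus>\<^bsub>L\<^esub> C)"
      by (simp add: add_localization_same M.a_assoc)
  next
    show "\<zero>\<^bsub>L\<^esub> \<in> carrier L" by (simp add: zero_localization[of 0])
  next
    fix A assume "A \<in> carrier L"
    then obtain x n where x: "x \<in> carrier M" "A = cl x n"
      by (auto simp: carrier_localization)
    then show "\<zero>\<^bsub>L\<^esub> \<oplus>\<^bsub>L\<^esub> A = A"
      by (simp add: zero_localization[of n] add_localization_same)
    show "\<exists>B\<in>carrier L. B \<oplus>\<^bsub>L\<^esub> A = \<zero>\<^bsub>L\<^esub>"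
      using x by (auto intro!: bexI[of _ "cl (\<ominus>\<^bsub>M\<^esub> x) n"]
          simp: zero_localization[of n] add_localization_same M.l_neg)
  qed
next
  fix a A assume a: "a \<in> carrier R" and A: "A \<in> carrier L"
  obtain x n where x: "x \<in> carrier M" "A = cl x n"
    using A by (auto simp: carrier_localization)
  show "a \<odot>\<^bsub>L\<^esub> A \<in> carrier L" using a x by (simp add: smult_localization)
  fix b assume b: "b \<in> carrier R"
  show "(a \<oplus> b) \<odot>\<^bsub>L\<^esub> A = a \<odot>\<^bsub>L\<^esub> A \<oplus>\<^bsub>L\<^esub> b \<odot>\<^bsub>L\<^esub> A"
    using a b x by (simp add: smult_localization add_localization_same smult_l_distr)
  show "a \<otimes> b \<odot>\<^bsub>L\<^esub> A = a \<odot>\<^bsub>L\<^esub> (b \<odot>\<^bsub>L\<^esub> A)"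
    using a b x by (simp add: smult_localization smult_assoc1)
next
  fix a A B assume a: "a \<in> carrier R" and AB: "A \<in> carrier L" "B \<in> carrier L"
  obtain x y n where xy: "x \<in> carrier M" "y \<in> carrier M" "A = cl x n" "B = cl y n"
    by (rule common_denominator2[OF AB])
  with a show "a \<odot>\<^bsub>L\<^esub> (A \<oplus>\<^bsub>L\<^esub> B) = a \<odot>\<^bsub>L\<^esub> A \<oplus>\<^bsub>L\<^esub> a \<odot>\<^bsub>L\<^esub> B"
    by (simp add: smult_localization add_localization_same smult_r_distr)
next
  fix A assume "A \<in> carrier L"
  then show "\<one> \<odot>\<^bsub>L\<^esub> A = A"
    by (auto simp: carrier_localization smult_localization)
qed

text \<open>The canonical map to a further localization is well defined and given by any representative.\<close>

lemma loc_map_loc_class: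
  assumes g: "g \<in> carrier R" and x: "x \<in> carrier M"
  shows "loc_map R M f g (cl x n) = loc_class R M (f \<otimes> g) ((g [^] n) \<odot>\<^bsub>M\<^esub> x) n"
proof -
  interpret fg: localized_module R M "f \<otimes> g"
    by unfold_locales (use g in simp)
  have "fg.cl ((g [^] k) \<odot>\<^bsub>M\<^esub> y) k = fg.cl ((g [^] n) \<odot>\<^bsub>M\<^esub> x) n"
    if y: "y \<in> carrier M" and e: "cl y k = cl x n" for y k
  proof -
    obtain j where j: "P (j + n) y = P (j + k) x"
      using e loc_class_eq_iff[OF y x] by blast
    have fp: "((f \<otimes> g) [^] (j + a)) \<odot>\<^bsub>M\<^esub> ((g [^] b) \<odot>\<^bsub>M\<^esub> z) = (g [^] (j + a + b)) \<odot>\<^bsub>M\<^esub> P (j + a) z"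
      if "z \<in> carrier M" for a b z
    proof -
      have "((f \<otimes> g) [^] (j + a)) \<odot>\<^bsub>M\<^esub> ((g [^] b) \<odot>\<^bsub>M\<^esub> z) =
        (((f \<otimes> g) [^] (j + a)) \<otimes> (g [^] b)) \<odot>\<^bsub>M\<^esub> z"
        using g that by (simp add: smult_assoc1)
      also have "((f \<otimes> g) [^] (j + a)) \<otimes> (g [^] b) = (g [^] (j + a + b)) \<otimes> (f [^] (j + a))"
        using g by (simp add: nat_pow_distrib nat_pow_mult[symmetric] m_ac)
      finally show ?thesis using g that by (simp add: smult_assoc1)
    qed
    have "((f \<otimes> g) [^] (j + n)) \<odot>\<^bsub>M\<^esub> ((g [^] k) \<odot>\<^bsub>M\<^esub> y) =
        ((f \<otimes> g) [^] (j + k)) \<odot>\<^bsub>M\<^esub> ((g [^] n) \<odot>\<^bsub>M\<^esub> x)"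
      unfolding fp[OF y] fp[OF x] j by (simp only: ac_simps)
    then show ?thesis
      using g x y by (intro fg.loc_class_eq_iff[THEN iffD2]) (auto simp del: P_add fg.P_add)
  qed
  note * = this
  show ?thesis
    unfolding loc_map_def by (intro UN_loc_class x *)
qed

lemma loc_map_closed:
  assumes g: "g \<in> carrier R" and A: "A \<in> carrier L"
  shows "loc_map R M f g A \<in> carrier (localization R M (f \<otimes> g))"
proof -
  interpret fg: localized_module R M "f \<otimes> g"
    by unfold_locales (use g in simp)
  show ?thesis using A g by (auto simp: carrier_localization loc_map_loc_class)
qed

lemma loc_map_add:
  assumes g: "g \<in> carrier R" and A: "A \<in> carrier L" and B: "B \<in> carrier L"
  shows "loc_map R M f g (A \<oplus>\<^bsub>L\<^esub> B) =
    loc_map R M f g A \<oplus>\<^bsub>localization R M (f \<otimes> g)\<^esub> loc_map R M f g B"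
proof -
  interpret fg: localized_module R M "f \<otimes> g"
    by unfold_locales (use g in simp)
  obtain x y n where "x \<in> carrier M" "y \<in> carrier M" "A = cl x n" "B = cl y n"
    by (rule common_denominator2[OF A B])
  then show ?thesis
    using g by (simp add: loc_map_loc_class add_localization_same fg.add_localization_same smult_r_distr)
qed

lemma loc_map_smult:
  assumes g: "g \<in> carrier R" and r: "r \<in> carrier R" and A: "A \<in> carrier L"
  shows "loc_map R M f g (r \<odot>\<^bsub>L\<^esub> A) = r \<odot>\<^bsub>localization R M (f \<otimes> g)\<^esub> loc_map R M f g A"
proof -
  interpret fg: localized_module R M "f \<otimes> g"
    by unfold_locales (use g in simp)
  obtain x n where x: "x \<in> carrier M" "A = cl x n"
    using A by (auto simp: carrier_localization)
  then show ?thesis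
    using g r localized_module.P_smult[of R M g r x n]
    by (simp add: loc_map_loc_class smult_localization fg.smult_localization
        localized_module_def localized_module_axioms_def module_axioms)
qed

lemma loc_map_zero:
  assumes g: "g \<in> carrier R"
  shows "loc_map R M f g \<zero>\<^bsub>L\<^esub> = \<zero>\<^bsub>localization R M (f \<otimes> g)\<^esub>"
proof -
  interpret fg: localized_module R M "f \<otimes> g"
    by unfold_locales (use g in simp)
  show ?thesis using g
    by (simp add: zero_localization[of 0] fg.zero_localization[of 0] loc_map_loc_class)
qed

end

section \<open>The Cech complex\<close>

lemma (in module) additive_subgroupI_smult:
  assumes "N \<subseteq> carrier M" and "N \<noteq> {}"
    and add: "\<And>x y. x \<in> N \<Longrightarrow> y \<in> N \<Longrightarrow> x \<oplus>\<^bsub>M\<^esub> y \<in> N"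
    and smult: "\<And>r x. r \<in> carrier R \<Longrightarrow> x \<in> N \<Longrightarrow> r \<odot>\<^bsub>M\<^esub> x \<in> N"
  shows "additive_subgroup N M"
proof (rule additive_subgroupI, rule group.subgroupI[OF M.a_group])
  fix x assume x: "x \<in> N"
  then have xM: "x \<in> carrier M" using assms(1) by blast
  have "(\<ominus> \<one>) \<odot>\<^bsub>M\<^esub> x = \<ominus>\<^bsub>M\<^esub> x"
    using smult_l_minus[OF R.one_closed xM] xM by simp
  then show "inv\<^bsub>add_monoid M\<^esub> x \<in> N"
    using smult[OF R.a_inv_closed[OF R.one_closed] x] by (simp add: a_inv_def)
qed (use assms in auto)

text \<open>The Cech complex of a module with respect to a list of ring elements: \<open>el F\<close> is the product of the
  elements indexed by \<open>F\<close>, \<open>LF F\<close> the localization at it, \<open>CC p\<close> the module of cochains of degree \<open>p\<close>,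
  and \<open>dd\<close> the differential.\<close>

locale cech_complex = module R M for R :: "'r ring" (structure) and M :: "('r, 'm) module" +
  fixes fs :: "'r list"
  assumes fs_closed: "set fs \<subseteq> carrier R"
begin

abbreviation el :: "nat set \<Rightarrow> 'r" where "el \<equiv> cech_elem R fs"
abbreviation LF :: "nat set \<Rightarrow> ('r, ('m \<times> nat) set) module"
  where "LF F \<equiv> localization R M (el F)"
abbreviation CC :: "nat \<Rightarrow> ('r, nat set \<Rightarrow> ('m \<times> nat) set) module"
  where "CC p \<equiv> cech R M fs p"
abbreviation dd where "dd \<equiv> cech_diff R M fs"

lemma nth_closed: "j < length fs \<Longrightarrow> fs ! j \<in> carrier R"
  using fs_closed by auto

lemma el_closed [simp]: "F \<subseteq> {..<length fs} \<Longrightarrow> el F \<in> carrier R"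
  unfolding cech_elem_def by (rule finprod_closed) (auto intro!: nth_closed)

lemma el_remove:
  assumes "F \<subseteq> {..<length fs}" "j \<in> F"
  shows "el (F - {j}) \<otimes> fs ! j = el F"
proof -
  have "el F = el (insert j (F - {j}))" using assms by (simp add: insert_absorb)
  also have "\<dots> = fs ! j \<otimes> el (F - {j})"
    unfolding cech_elem_def using assms
    by (intro finprod_insert) (auto intro!: nth_closed finite_subset[of F "{..<length fs}"])
  finally show ?thesis using assms by (simp add: m_comm nth_closed subset_eq)
qed

lemma localized: "F \<subseteq> {..<length fs} \<Longrightarrow> localized_module R M (el F)"
  by unfold_locales simp

lemma module_LF: "F \<subseteq> {..<length fs} \<Longrightarrow> module R (LF F)"
  by (rule localized_module.module_localization[OF localized])

lemma faces_subset: "F \<in> cech_faces fs p \<Longrightarrow> F \<subseteq> {..<length fs}"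
  by (simp add: cech_faces_def)

lemma faces_remove: "F \<in> cech_faces fs (Suc p) \<Longrightarrow> j \<in> F \<Longrightarrow> F - {j} \<in> cech_faces fs p"
  by (auto simp: cech_faces_def dest: finite_subset)

lemma faces_finite: "F \<in> cech_faces fs p \<Longrightarrow> finite F"
  using faces_subset finite_subset by blast

lemma module_CC: "module R (CC p)"
  unfolding cech_def
  by (rule module_product_module[OF R.is_cring]) (auto intro: module_LF dest: faces_subset)

lemma CC_simps:
  "carrier (CC p) = (\<Pi>\<^sub>E F\<in>cech_faces fs p. carrier (LF F))"
  "\<zero>\<^bsub>CC p\<^esub> = (\<lambda>F\<in>cech_faces fs p. \<zero>\<^bsub>LF F\<^esub>)"
  "c \<oplus>\<^bsub>CC p\<^esub> d = (\<lambda>F\<in>cech_faces fs p. c F \<oplus>\<^bsub>LF F\<^esub> d F)"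
  "r \<odot>\<^bsub>CC p\<^esub> c = (\<lambda>F\<in>cech_faces fs p. r \<odot>\<^bsub>LF F\<^esub> c F)"
  by (simp_all add: cech_def product_module_simps)

lemma CC_D: "c \<in> carrier (CC p) \<Longrightarrow> F \<in> cech_faces fs p \<Longrightarrow> c F \<in> carrier (LF F)"
  by (auto simp: CC_simps)

text \<open>The canonical map from the localization at \<open>F - {j}\<close> to the localization at \<open>F\<close>.\<close>

definition cech_map :: "nat set \<Rightarrow> nat \<Rightarrow> ('m \<times> nat) set \<Rightarrow> ('m \<times> nat) set" where
  "cech_map F j A = loc_map R M (el (F - {j})) (fs ! j) A"

lemma cech_map:
  assumes "F \<subseteq> {..<length fs}" "j \<in> F"
  shows cech_map_closed: "\<And>A. A \<in> carrier (LF (F - {j})) \<Longrightarrow> cech_map F j A \<in> carrier (LF F)"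
    and cech_map_add: "\<And>A B. A \<in> carrier (LF (F - {j})) \<Longrightarrow> B \<in> carrier (LF (F - {j})) \<Longrightarrow>
      cech_map F j (A \<oplus>\<^bsub>LF (F - {j})\<^esub> B) = cech_map F j A \<oplus>\<^bsub>LF F\<^esub> cech_map F j B"
    and cech_map_smult: "\<And>A r. r \<in> carrier R \<Longrightarrow> A \<in> carrier (LF (F - {j})) \<Longrightarrow>
      cech_map F j (r \<odot>\<^bsub>LF (F - {j})\<^esub> A) = r \<odot>\<^bsub>LF F\<^esub> cech_map F j A"
    and cech_map_zero: "cech_map F j \<zero>\<^bsub>LF (F - {j})\<^esub> = \<zero>\<^bsub>LF F\<^esub>"
    and cech_map_loc_class: "\<And>x n. x \<in> carrier M \<Longrightarrow>
      cech_map F j (loc_class R M (el (F - {j})) x n) = loc_class R M (el F) ((fs ! j [^] n) \<odot>\<^bsub>M\<^esub> x) n"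
proof -
  interpret loc: localized_module R M "el (F - {j})"
    by (rule localized) (use assms in auto)
  have g: "fs ! j \<in> carrier R" using assms by (auto intro: nth_closed)
  note er = el_remove[OF assms]
  show "\<And>A. A \<in> carrier (LF (F - {j})) \<Longrightarrow> cech_map F j A \<in> carrier (LF F)"
    using loc.loc_map_closed[OF g] by (simp add: cech_map_def er)
  show "\<And>A B. A \<in> carrier (LF (F - {j})) \<Longrightarrow> B \<in> carrier (LF (F - {j})) \<Longrightarrow>
      cech_map F j (A \<oplus>\<^bsub>LF (F - {j})\<^esub> B) = cech_map F j A \<oplus>\<^bsub>LF F\<^esub> cech_map F j B"
    using loc.loc_map_add[OF g] by (simp add: cech_map_def er)
  show "\<And>A r. r \<in> carrier R \<Longrightarrow> A \<in> carrier (LF (F - {j})) \<Longrightarrow>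
      cech_map F j (r \<odot>\<^bsub>LF (F - {j})\<^esub> A) = r \<odot>\<^bsub>LF F\<^esub> cech_map F j A"
    using loc.loc_map_smult[OF g] by (simp add: cech_map_def er)
  show "cech_map F j \<zero>\<^bsub>LF (F - {j})\<^esub> = \<zero>\<^bsub>LF F\<^esub>"
    using loc.loc_map_zero[OF g] by (simp add: cech_map_def er)
  show "\<And>x n. x \<in> carrier M \<Longrightarrow>
      cech_map F j (loc_class R M (el (F - {j})) x n) = loc_class R M (el F) ((fs ! j [^] n) \<odot>\<^bsub>M\<^esub> x) n"
    using loc.loc_map_loc_class[OF g] by (simp add: cech_map_def er)
qed

text \<open>The sign with which the component at \<open>F - {j}\<close> enters the differential at \<open>F\<close>, as a ring element, so
  that the differential becomes a sum of scalar multiples.\<close>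

definition cech_sign :: "nat set \<Rightarrow> nat \<Rightarrow> 'r" where
  "cech_sign F j = (if even (card {i \<in> F. i < j}) then \<one> else \<ominus> \<one>)"

lemma cech_sign_closed [simp]: "cech_sign F j \<in> carrier R"
  by (simp add: cech_sign_def)

lemma cech_diff_eq:
  assumes c: "c \<in> carrier (CC p)" and F: "F \<in> cech_faces fs (Suc p)"
  shows "dd p c F = finsum (LF F) (\<lambda>j. cech_sign F j \<odot>\<^bsub>LF F\<^esub> cech_map F j (c (F - {j}))) F"
proof -
  interpret L: module R "LF F" by (rule module_LF[OF faces_subset[OF F]])
  have "cech_map F j (c (F - {j})) \<in> carrier (LF F)" if "j \<in> F" for j
    by (rule cech_map_closed[OF faces_subset[OF F] that CC_D[OF c faces_remove[OF F that]]])
  moreover have "(\<ominus> \<one>) \<odot>\<^bsub>LF F\<^esub> x = \<ominus>\<^bsub>LF F\<^esub> x" if "x \<in> carrier (LF F)" for x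
    using L.smult_l_minus[OF R.one_closed that] that by simp
  moreover have "dd p c F = finsum (LF F) (\<lambda>j. if even (card {i \<in> F. i < j})
      then cech_map F j (c (F - {j})) else \<ominus>\<^bsub>LF F\<^esub> cech_map F j (c (F - {j}))) F"
    unfolding cech_diff_def Let_def cech_map_def using F by simp
  ultimately show ?thesis
    by (simp only:, intro L.M.finsum_cong') (auto simp: cech_sign_def)
qed

lemma diff_term_closed:
  assumes c: "c \<in> carrier (CC p)" and F: "F \<in> cech_faces fs (Suc p)"
  shows "(\<lambda>j. cech_sign F j \<odot>\<^bsub>LF F\<^esub> cech_map F j (c (F - {j}))) \<in> F \<rightarrow> carrier (LF F)"
proof
  fix j assume j: "j \<in> F"
  interpret L: module R "LF F" by (rule module_LF[OF faces_subset[OF F]])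
  show "cech_sign F j \<odot>\<^bsub>LF F\<^esub> cech_map F j (c (F - {j})) \<in> carrier (LF F)"
    by (intro L.smult_closed cech_sign_closed cech_map_closed[OF faces_subset[OF F] j CC_D[OF c faces_remove[OF F j]]])
qed

lemma cech_diff_closed:
  assumes c: "c \<in> carrier (CC p)"
  shows "dd p c \<in> carrier (CC (Suc p))"
proof -
  have "dd p c F \<in> carrier (LF F)" if F: "F \<in> cech_faces fs (Suc p)" for F
  proof -
    interpret L: module R "LF F" by (rule module_LF[OF faces_subset[OF F]])
    show ?thesis
      unfolding cech_diff_eq[OF c F] by (rule L.M.finsum_closed[OF diff_term_closed[OF c F]])
  qed
  then show ?thesis
    by (auto simp: CC_simps PiE_iff cech_diff_def)
qed

lemma CC_eqI:
  assumes "c \<in> carrier (CC p)" "d \<in> carrier (CC p)"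
    and "\<And>F. F \<in> cech_faces fs p \<Longrightarrow> c F = d F"
  shows "c = d"
  by (rule PiE_ext[OF assms(1,2)[unfolded CC_simps(1)] assms(3)])

lemma cech_diff_add:
  assumes c: "c \<in> carrier (CC p)" and d: "d \<in> carrier (CC p)"
  shows "dd p (c \<oplus>\<^bsub>CC p\<^esub> d) = dd p c \<oplus>\<^bsub>CC (Suc p)\<^esub> dd p d"
proof -
  interpret C: module R "CC p" by (rule module_CC)
  interpret C': module R "CC (Suc p)" by (rule module_CC)
  have cd: "c \<oplus>\<^bsub>CC p\<^esub> d \<in> carrier (CC p)" using c d by simp
  show ?thesis
  proof (rule CC_eqI)
    fix F assume F: "F \<in> cech_faces fs (Suc p)"
    note Fs = faces_subset[OF F]
    interpret L: module R "LF F" by (rule module_LF[OF Fs])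
    have "dd p (c \<oplus>\<^bsub>CC p\<^esub> d) F = finsum (LF F) (\<lambda>j. (cech_sign F j \<odot>\<^bsub>LF F\<^esub> cech_map F j (c (F - {j})))
        \<oplus>\<^bsub>LF F\<^esub> (cech_sign F j \<odot>\<^bsub>LF F\<^esub> cech_map F j (d (F - {j})))) F"
      unfolding cech_diff_eq[OF cd F]
    proof (rule L.M.finsum_cong'[OF refl])
      show "(\<lambda>j. (cech_sign F j \<odot>\<^bsub>LF F\<^esub> cech_map F j (c (F - {j})))
        \<oplus>\<^bsub>LF F\<^esub> (cech_sign F j \<odot>\<^bsub>LF F\<^esub> cech_map F j (d (F - {j})))) \<in> F \<rightarrow> carrier (LF F)"
        using diff_term_closed[OF c F] diff_term_closed[OF d F] by auto
      fix j assume j: "j \<in> F"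
      note Fj = faces_remove[OF F j]
      show "cech_sign F j \<odot>\<^bsub>LF F\<^esub> cech_map F j ((c \<oplus>\<^bsub>CC p\<^esub> d) (F - {j})) =
          cech_sign F j \<odot>\<^bsub>LF F\<^esub> cech_map F j (c (F - {j})) \<oplus>\<^bsub>LF F\<^esub> cech_sign F j \<odot>\<^bsub>LF F\<^esub> cech_map F j (d (F - {j}))"
        using Fj CC_D[OF c Fj] CC_D[OF d Fj]
        by (simp add: CC_simps cech_map_add[OF Fs j] cech_map_closed[OF Fs j] L.smult_r_distr)
    qed
    also have "\<dots> = dd p c F \<oplus>\<^bsub>LF F\<^esub> dd p d F"
      unfolding cech_diff_eq[OF c F] cech_diff_eq[OF d F]
      by (rule L.M.finsum_addf[OF diff_term_closed[OF c F] diff_term_closed[OF d F]])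
    finally show "dd p (c \<oplus>\<^bsub>CC p\<^esub> d) F = (dd p c \<oplus>\<^bsub>CC (Suc p)\<^esub> dd p d) F"
      using F by (simp add: CC_simps)
  qed (use c d cd cech_diff_closed in auto)
qed

lemma cech_diff_smult:
  assumes r: "r \<in> carrier R" and c: "c \<in> carrier (CC p)"
  shows "dd p (r \<odot>\<^bsub>CC p\<^esub> c) = r \<odot>\<^bsub>CC (Suc p)\<^esub> dd p c"
proof -
  interpret C: module R "CC p" by (rule module_CC)
  interpret C': module R "CC (Suc p)" by (rule module_CC)
  have rc: "r \<odot>\<^bsub>CC p\<^esub> c \<in> carrier (CC p)" using c r by simp
  show ?thesis
  proof (rule CC_eqI)
    fix F assume F: "F \<in> cech_faces fs (Suc p)"
    note Fs = faces_subset[OF F]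
    interpret L: module R "LF F" by (rule module_LF[OF Fs])
    have "dd p (r \<odot>\<^bsub>CC p\<^esub> c) F =
        finsum (LF F) (\<lambda>j. r \<odot>\<^bsub>LF F\<^esub> (cech_sign F j \<odot>\<^bsub>LF F\<^esub> cech_map F j (c (F - {j})))) F"
      unfolding cech_diff_eq[OF rc F]
    proof (rule L.M.finsum_cong'[OF refl])
      show "(\<lambda>j. r \<odot>\<^bsub>LF F\<^esub> (cech_sign F j \<odot>\<^bsub>LF F\<^esub> cech_map F j (c (F - {j})))) \<in> F \<rightarrow> carrier (LF F)"
        using diff_term_closed[OF c F] r by auto
      fix j assume j: "j \<in> F"
      note Fj = faces_remove[OF F j]
      have cl: "cech_map F j (c (F - {j})) \<in> carrier (LF F)" by (rule cech_map_closed[OF Fs j CC_D[OF c Fj]])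
      have "cech_sign F j \<odot>\<^bsub>LF F\<^esub> cech_map F j ((r \<odot>\<^bsub>CC p\<^esub> c) (F - {j})) =
          cech_sign F j \<odot>\<^bsub>LF F\<^esub> (r \<odot>\<^bsub>LF F\<^esub> cech_map F j (c (F - {j})))"
        using Fj CC_D[OF c Fj] r by (simp add: CC_simps cech_map_smult[OF Fs j])
      also have "\<dots> = (r \<otimes> cech_sign F j) \<odot>\<^bsub>LF F\<^esub> cech_map F j (c (F - {j}))"
        using r cl by (simp add: L.smult_assoc1[symmetric] m_comm)
      also have "\<dots> = r \<odot>\<^bsub>LF F\<^esub> (cech_sign F j \<odot>\<^bsub>LF F\<^esub> cech_map F j (c (F - {j})))"
        using r cl by (simp add: L.smult_assoc1)
      finally show "cech_sign F j \<odot>\<^bsub>LF F\<^esub> cech_map F j ((r \<odot>\<^bsub>CC p\<^esub> c) (F - {j})) =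
          r \<odot>\<^bsub>LF F\<^esub> (cech_sign F j \<odot>\<^bsub>LF F\<^esub> cech_map F j (c (F - {j})))" .
    qed
    also have "\<dots> = r \<odot>\<^bsub>LF F\<^esub> dd p c F"
      unfolding cech_diff_eq[OF c F]
      by (rule L.finsum_smult_ldistr[symmetric, OF faces_finite[OF F] r diff_term_closed[OF c F]])
    finally show "dd p (r \<odot>\<^bsub>CC p\<^esub> c) F = (r \<odot>\<^bsub>CC (Suc p)\<^esub> dd p c) F"
      using F by (simp add: CC_simps)
  qed (use c r rc cech_diff_closed in auto)
qed

lemma coboundaries:
  shows coboundaries_subgroup: "additive_subgroup (cech_coboundaries R M fs p) (CC p)"
    and coboundaries_smult: "\<And>r n. r \<in> carrier R \<Longrightarrow> n \<in> cech_coboundaries R M fs p \<Longrightarrow>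
      r \<odot>\<^bsub>CC p\<^esub> n \<in> cech_coboundaries R M fs p"
proof -
  interpret C: module R "CC p" by (rule module_CC)
  show sm: "r \<odot>\<^bsub>CC p\<^esub> n \<in> cech_coboundaries R M fs p"
    if rn: "r \<in> carrier R" "n \<in> cech_coboundaries R M fs p" for r n
  proof (cases p)
    case 0
    then show ?thesis using rn C.smult_r_null by (simp add: cech_coboundaries_def)
  next
    case (Suc q)
    interpret C': module R "CC q" by (rule module_CC)
    obtain c where "c \<in> carrier (CC q)" "n = dd q c"
      using rn Suc by (auto simp: cech_coboundaries_def)
    then have "r \<odot>\<^bsub>CC p\<^esub> n = dd q (r \<odot>\<^bsub>CC q\<^esub> c)" "r \<odot>\<^bsub>CC q\<^esub> c \<in> carrier (CC q)"
      using rn Suc by (simp_all add: cech_diff_smult)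
    then show ?thesis using Suc by (auto simp: cech_coboundaries_def)
  qed
  show "additive_subgroup (cech_coboundaries R M fs p) (CC p)"
  proof (rule C.additive_subgroupI_smult[OF _ _ _ sm])
    show "cech_coboundaries R M fs p \<subseteq> carrier (CC p)"
      using C.M.zero_closed by (cases p) (auto simp: cech_coboundaries_def cech_diff_closed)
    show "cech_coboundaries R M fs p \<noteq> {}"
    proof (cases p)
      case (Suc q)
      interpret C': module R "CC q" by (rule module_CC)
      show ?thesis using Suc C'.M.zero_closed by (auto simp: cech_coboundaries_def)
    qed (simp add: cech_coboundaries_def)
    show "x \<oplus>\<^bsub>CC p\<^esub> y \<in> cech_coboundaries R M fs p"
      if xy: "x \<in> cech_coboundaries R M fs p" "y \<in> cech_coboundaries R M fs p" for x y
    proof (cases p)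
      case 0
      then show ?thesis using xy C.M.l_zero[OF C.M.zero_closed] by (simp add: cech_coboundaries_def)
    next
      case (Suc q)
      interpret C': module R "CC q" by (rule module_CC)
      obtain c d where "c \<in> carrier (CC q)" "x = dd q c" "d \<in> carrier (CC q)" "y = dd q d"
        using xy Suc by (auto simp: cech_coboundaries_def)
      then have "x \<oplus>\<^bsub>CC p\<^esub> y = dd q (c \<oplus>\<^bsub>CC q\<^esub> d)" "c \<oplus>\<^bsub>CC q\<^esub> d \<in> carrier (CC q)"
        using Suc by (simp_all add: cech_diff_add)
      then show ?thesis using Suc by (auto simp: cech_coboundaries_def)
    qed
  qed
qed

text \<open>The cochain that is \<open>A\<close> at \<open>F\<close> and zero elsewhere.\<close>

definition unit_cochain :: "nat \<Rightarrow> nat set \<Rightarrow> ('m \<times> nat) set \<Rightarrow> nat set \<Rightarrow> ('m \<times> nat) set" where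
  "unit_cochain p F A = (\<lambda>F'\<in>cech_faces fs p. if F' = F then A else \<zero>\<^bsub>LF F'\<^esub>)"

lemma LF_zero_closed: "F \<in> cech_faces fs p \<Longrightarrow> \<zero>\<^bsub>LF F\<^esub> \<in> carrier (LF F)"
proof -
  assume "F \<in> cech_faces fs p"
  then interpret L: module R "LF F" by (intro module_LF faces_subset)
  show ?thesis by simp
qed

lemma unit_cochain_closed:
  "F \<in> cech_faces fs p \<Longrightarrow> A \<in> carrier (LF F) \<Longrightarrow> unit_cochain p F A \<in> carrier (CC p)"
  by (auto simp: unit_cochain_def CC_simps LF_zero_closed)

text \<open>The coboundary of a cochain concentrated at \<open>E\<close> lives on the faces \<open>E \<union> {v}\<close>.\<close>

lemma diff_unit_cochain:
  assumes E: "E \<in> cech_faces fs p" and A: "A \<in> carrier (LF E)" and F: "F \<in> cech_faces fs (Suc p)"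
  shows "v \<in> F \<Longrightarrow> F - {v} = E \<Longrightarrow>
      dd p (unit_cochain p E A) F = cech_sign F v \<odot>\<^bsub>LF F\<^esub> cech_map F v A"
    and "(\<And>v. v \<in> F \<Longrightarrow> F - {v} \<noteq> E) \<Longrightarrow> dd p (unit_cochain p E A) F = \<zero>\<^bsub>LF F\<^esub>"
proof -
  let ?u = "unit_cochain p E A"
  let ?t = "\<lambda>j. cech_sign F j \<odot>\<^bsub>LF F\<^esub> cech_map F j (?u (F - {j}))"
  have u: "?u \<in> carrier (CC p)" by (rule unit_cochain_closed[OF E A])
  note Fs = faces_subset[OF F]
  interpret L: module R "LF F" by (rule module_LF[OF Fs])
  have t0: "?t j = \<zero>\<^bsub>LF F\<^esub>" if "j \<in> F" "F - {j} \<noteq> E" for j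
    using that faces_remove[OF F that(1)] by (simp add: unit_cochain_def cech_map_zero[OF Fs that(1)] L.smult_r_null)
  show "dd p ?u F = \<zero>\<^bsub>LF F\<^esub>" if "\<And>v. v \<in> F \<Longrightarrow> F - {v} \<noteq> E"
  proof -
    have "finsum (LF F) ?t F = finsum (LF F) (\<lambda>j. \<zero>\<^bsub>LF F\<^esub>) F"
      by (rule L.M.finsum_cong'[OF refl]) (use t0 that in auto)
    then show ?thesis by (simp add: cech_diff_eq[OF u F])
  qed
  show "dd p ?u F = cech_sign F v \<odot>\<^bsub>LF F\<^esub> cech_map F v A" if v: "v \<in> F" "F - {v} = E"
  proof -
    have ne: "F - {j} \<noteq> E" if "j \<in> F" "j \<noteq> v" for j using v that by auto
    have "finsum (LF F) ?t F = finsum (LF F) (\<lambda>j. if v = j then cech_sign F v \<odot>\<^bsub>LF F\<^esub> cech_map F v A else \<zero>\<^bsub>LF F\<^esub>) F"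
    proof (rule L.M.finsum_cong'[OF refl])
      show "(\<lambda>j. if v = j then cech_sign F v \<odot>\<^bsub>LF F\<^esub> cech_map F v A else \<zero>\<^bsub>LF F\<^esub>) \<in> F \<rightarrow> carrier (LF F)"
        using cech_map_closed[OF Fs v(1)] A v(2) by auto
      show "?t j = (if v = j then cech_sign F v \<odot>\<^bsub>LF F\<^esub> cech_map F v A else \<zero>\<^bsub>LF F\<^esub>)" if j: "j \<in> F" for j
      proof (cases "j = v")
        case True
        then show ?thesis using v E by (simp add: unit_cochain_def)
      next
        case False
        then show ?thesis using t0[OF j ne[OF j False]] by simp
      qed
    qed
    also have "\<dots> = cech_sign F v \<odot>\<^bsub>LF F\<^esub> cech_map F v A"
      by (rule L.M.add.finprod_singleton[OF v(1) faces_finite[OF F]])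
        (use cech_map_closed[OF Fs v(1)] A v(2) in auto)
    finally show ?thesis by (simp add: cech_diff_eq[OF u F])
  qed
qed

end

lemma local_cohomology_simps:
  "\<zero>\<^bsub>local_cohomology R M fs p\<^esub> = cech_coboundaries R M fs p"
  "X \<oplus>\<^bsub>local_cohomology R M fs p\<^esub> Y = X <+>\<^bsub>cech R M fs p\<^esub> Y"
  "r \<odot>\<^bsub>local_cohomology R M fs p\<^esub> X =
    (\<Union>x\<in>X. cech_coboundaries R M fs p +>\<^bsub>cech R M fs p\<^esub> (r \<odot>\<^bsub>cech R M fs p\<^esub> x))"
  by (simp_all add: local_cohomology_def quotient_module_simps set_add_def set_mult_def
      a_r_coset_def r_coset_def)

section \<open>Polynomial rings and face ideals\<close>

text \<open>Unqualified names for the operations on finitely supported functions.\<close>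

abbreviation lookup :: "('a \<Rightarrow>\<^sub>0 'b::zero) \<Rightarrow> 'a \<Rightarrow> 'b" where "lookup \<equiv> Poly_Mapping.lookup"
abbreviation single :: "'a \<Rightarrow> 'b \<Rightarrow> 'a \<Rightarrow>\<^sub>0 'b::zero" where "single \<equiv> Poly_Mapping.single"
abbreviation keys :: "('a \<Rightarrow>\<^sub>0 'b::zero) \<Rightarrow> 'a set" where "keys \<equiv> Poly_Mapping.keys"

lemma poly_mapping_sum_single: "p = (\<Sum>u\<in>keys p. single u (lookup p u))"
  by (rule poly_mapping_eqI)
    (simp add: lookup_sum lookup_single when_def in_keys_iff)

lemma lookup_mult_single:
  fixes p :: "'a::cancel_comm_monoid_add \<Rightarrow>\<^sub>0 'b::comm_semiring_0"
  shows "lookup (p * single b c) (u + b) = lookup p u * c"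
proof -
  have "p * single b c = (\<Sum>w\<in>keys p. single (w + b) (lookup p w * c))"
    by (subst (1) poly_mapping_sum_single[of p]) (simp add: sum_distrib_right mult_single)
  then have "lookup (p * single b c) (u + b) =
      (\<Sum>w\<in>keys p. if w = u then lookup p w * c else 0)"
    by (simp add: lookup_sum lookup_single when_def)
  also have "\<dots> = lookup p u * c"
    by (auto simp: in_keys_iff)
  finally show ?thesis .
qed

lemma keys_mult_single:
  fixes p :: "'a::cancel_comm_monoid_add \<Rightarrow>\<^sub>0 'b::comm_semiring_0"
  assumes "w \<in> keys (p * single b c)"
  obtains u where "u \<in> keys p" "w = u + b"
  using assms keys_mult[of p "single b c"] by (auto split: if_splits)

lemma keys_add_nat: "keys (a + b) = keys a \<union> keys (b :: 'v \<Rightarrow>\<^sub>0 nat)"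
  by (auto simp: in_keys_iff lookup_add)

lemma mon_degree_eq_sum:
  assumes "finite A" "keys u \<subseteq> A"
  shows "mon_degree u = (\<Sum>v\<in>A. lookup u v)"
  unfolding mon_degree_def by (rule sum.mono_neutral_left) (use assms in \<open>auto simp: in_keys_iff\<close>)

lemma mon_degree_add: "mon_degree (u + w) = mon_degree u + mon_degree w"
  by (subst (1 2 3) mon_degree_eq_sum[of "keys u \<union> keys w"])
    (auto simp: keys_add_nat lookup_add sum.distrib)

lemma mon_degree_single: "mon_degree (single v n) = n"
  by (simp add: mon_degree_def)

lemma lookup_le_mon_degree: "lookup u v \<le> mon_degree u"
  by (cases "v \<in> keys u") (auto simp: mon_degree_def in_keys_iff intro: member_le_sum)

lemma poly_ring_simps:
  "carrier (poly_ring_over V) = {p. \<forall>a\<in>keys p. keys a \<subseteq> V}"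
  "mult (poly_ring_over V) = (*)" "\<one>\<^bsub>poly_ring_over V\<^esub> = 1"
  "\<zero>\<^bsub>poly_ring_over V\<^esub> = 0" "add (poly_ring_over V) = (+)"
  by (simp_all add: poly_ring_over_def)

lemma poly_ring_closed:
  assumes "p \<in> carrier (poly_ring_over V)" "q \<in> carrier (poly_ring_over V)"
  shows "p + q \<in> carrier (poly_ring_over V)" "p * q \<in> carrier (poly_ring_over V)"
    "- p \<in> carrier (poly_ring_over V)" "p - q \<in> carrier (poly_ring_over V)"
proof -
  show "p + q \<in> carrier (poly_ring_over V)"
    using assms keys_add[of p q] by (auto simp: poly_ring_simps)
  show "p * q \<in> carrier (poly_ring_over V)"
    using assms keys_mult[of p q] by (fastforce simp: poly_ring_simps keys_add_nat)
  show "- p \<in> carrier (poly_ring_over V)"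
    using assms by (auto simp: poly_ring_simps in_keys_iff)
  have "keys (p - q) \<subseteq> keys p \<union> keys q"
    by (auto simp: in_keys_iff lookup_minus)
  then show "p - q \<in> carrier (poly_ring_over V)"
    using assms unfolding poly_ring_simps(1) by blast
qed

lemma poly_ring_closed_single: "keys u \<subseteq> V \<Longrightarrow> single u c \<in> carrier (poly_ring_over V)"
  by (auto simp: poly_ring_simps)

lemma poly_ring_closed_sum:
  "(\<And>i. i \<in> A \<Longrightarrow> p i \<in> carrier (poly_ring_over V)) \<Longrightarrow> sum p A \<in> carrier (poly_ring_over V)"
proof (induct A rule: infinite_finite_induct)
  case (insert x A)
  then show ?case by (simp add: poly_ring_closed(1))
qed (simp_all add: poly_ring_simps)

lemma cring_poly_ring: "cring (poly_ring_over V :: ('v, 'k::field) mpoly ring)"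
proof (rule cringI)
  show "abelian_group (poly_ring_over V :: ('v, 'k) mpoly ring)"
  proof (rule abelian_groupI)
    fix x :: "('v, 'k) mpoly" assume "x \<in> carrier (poly_ring_over V)"
    then show "\<exists>y\<in>carrier (poly_ring_over V). y \<oplus>\<^bsub>poly_ring_over V\<^esub> x = \<zero>\<^bsub>poly_ring_over V\<^esub>"
      by (intro bexI[of _ "- x"]) (auto simp: poly_ring_simps in_keys_iff)
  qed (auto simp: poly_ring_simps(2-) algebra_simps intro: poly_ring_closed, simp add: poly_ring_simps)
  show "Group.comm_monoid (poly_ring_over V :: ('v, 'k) mpoly ring)"
    by (rule comm_monoidI)
      (auto simp: poly_ring_simps(2-) algebra_simps intro: poly_ring_closed, simp add: poly_ring_simps)
qed (simp add: poly_ring_simps algebra_simps)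

lemma poly_ring_uminus: "p \<in> carrier (poly_ring_over V) \<Longrightarrow> \<ominus>\<^bsub>poly_ring_over V\<^esub> p = - p"
proof -
  assume p: "p \<in> carrier (poly_ring_over V)"
  interpret cring "poly_ring_over V :: ('a, 'b) mpoly ring" by (rule cring_poly_ring)
  show ?thesis
    by (rule minus_equality) (use p poly_ring_closed[OF p p] in \<open>auto simp: poly_ring_simps\<close>)
qed

lemma poly_ring_pow: "p [^]\<^bsub>poly_ring_over V\<^esub> (n::nat) = p ^ n"
proof -
  interpret cring "poly_ring_over V :: ('a, 'b) mpoly ring" by (rule cring_poly_ring)
  show ?thesis by (induct n) (simp_all add: poly_ring_simps mult.commute)
qed

lemma self_module_simps:
  "carrier (self_module S) = carrier S" "add (self_module S) = add S"
  "zero (self_module S) = zero S" "smult (self_module S) = mult S"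
  "mult (self_module S) = mult S" "one (self_module S) = one S"
  by (simp_all add: self_module_def ring.defs module.defs)

lemma module_self_module: "cring S \<Longrightarrow> module S (self_module S)"
proof -
  assume "cring S"
  then interpret S: cring S .
  have "abelian_group (self_module S)"
    by (rule abelian_groupI)
      (auto simp: self_module_simps S.a_ac intro!: bexI[of _ "\<ominus>\<^bsub>S\<^esub> _"] S.l_neg)
  then show ?thesis
    by (intro moduleI) (auto simp: self_module_simps S.is_cring S.l_distr S.r_distr S.m_assoc)
qed

text \<open>A simplicial complex, whose vertices are the variables \<open>vs\<close>, with its face ideal \<open>I\<close>, which is spanned
  by the monomials whose support is not a face. Faces are sets of positions in the list \<open>vs\<close>, as in the
  Cech complex. It is not required that the empty set is a face.

  The abbreviations are the polynomial ring \<open>S\<close>, the face ring \<open>A\<close> as a module over \<open>S\<close>, the list \<open>fs\<close>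
  of the variables as polynomials, and the residue class \<open>cls p\<close> of a polynomial.\<close>

locale face_complex =
  fixes vs :: "'v list" and face :: "nat set \<Rightarrow> bool" and I :: "('v, 'k::field) mpoly set"
  assumes distinct_vs: "distinct vs"
    and face_subset: "face F \<Longrightarrow> F \<subseteq> {..<length vs}"
    and face_mono: "face F \<Longrightarrow> F' \<subseteq> F \<Longrightarrow> face F'"
    and I_eq: "I = {p \<in> carrier (poly_ring_over (set vs)).
      \<forall>u\<in>keys p. \<not> face {j. j < length vs \<and> lookup u (vs ! j) \<noteq> 0}}"
begin

abbreviation S :: "('v, 'k) mpoly ring" where "S \<equiv> poly_ring_over (set vs)"
abbreviation A :: "(('v, 'k) mpoly, ('v, 'k) mpoly set) module"
  where "A \<equiv> quotient_module (self_module S) I"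
abbreviation fs :: "('v, 'k) mpoly list" where "fs \<equiv> map pvar vs"
abbreviation cls :: "('v, 'k) mpoly \<Rightarrow> ('v, 'k) mpoly set" where "cls p \<equiv> I +>\<^bsub>S\<^esub> p"

text \<open>The support of a monomial as a set of positions.\<close>

definition supp :: "('v \<Rightarrow>\<^sub>0 nat) \<Rightarrow> nat set" where
  "supp u = {j. j < length vs \<and> lookup u (vs ! j) \<noteq> 0}"

text \<open>The exponent of \<open>x\<^sub>F\<^sup>n\<close>, where \<open>x\<^sub>F\<close> is the product of the variables at the positions \<open>F\<close>.\<close>

definition powexp :: "nat set \<Rightarrow> nat \<Rightarrow> 'v \<Rightarrow>\<^sub>0 nat" where
  "powexp F n = (\<Sum>j\<in>F. single (vs ! j) n)"

lemma I_iff: "p \<in> I \<longleftrightarrow> p \<in> carrier S \<and> (\<forall>u\<in>keys p. \<not> face (supp u))"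
  by (simp add: I_eq supp_def)

lemma supp_add: "supp (u + w) = supp u \<union> supp w"
  by (auto simp: supp_def lookup_add)

lemma lookup_powexp_nth:
  assumes F: "F \<subseteq> {..<length vs}" and k: "k < length vs"
  shows "lookup (powexp F n) (vs ! k) = (if k \<in> F then n else 0)"
proof -
  have "finite F" using F finite_subset by blast
  have "lookup (powexp F n) (vs ! k) = (\<Sum>j\<in>F. if k = j then n else 0)"
    unfolding powexp_def lookup_sum
    by (rule sum.cong) (use F k distinct_vs in \<open>auto simp: lookup_single when_def nth_eq_iff_index_eq\<close>)
  then show ?thesis using \<open>finite F\<close> by simp
qed

lemma lookup_powexp_other: "F \<subseteq> {..<length vs} \<Longrightarrow> v \<notin> set vs \<Longrightarrow> lookup (powexp F n) v = 0"
  unfolding powexp_def lookup_sum by (rule sum.neutral) (auto simp: lookup_single when_def)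

lemma keys_powexp: "F \<subseteq> {..<length vs} \<Longrightarrow> keys (powexp F n) \<subseteq> set vs"
  by (rule subsetI, rule ccontr) (simp add: in_keys_iff lookup_powexp_other)

lemma supp_powexp: "F \<subseteq> {..<length vs} \<Longrightarrow> supp (powexp F n) = (if n = 0 then {} else F)"
  by (auto simp: supp_def lookup_powexp_nth subset_iff split: if_splits)

lemma powexp_add: "powexp F (n + m) = powexp F n + powexp F m"
  by (simp add: powexp_def single_add sum.distrib)

lemma powexp_zero: "powexp F 0 = 0"
  by (simp add: powexp_def)

lemma powexp_insert: "F \<subseteq> {..<length vs} \<Longrightarrow> j \<in> F \<Longrightarrow> powexp F n = single (vs ! j) n + powexp (F - {j}) n"
  unfolding powexp_def by (rule sum.remove) (auto intro: finite_subset)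

lemma mon_degree_powexp: "F \<subseteq> {..<length vs} \<Longrightarrow> mon_degree (powexp F n) = n * card F"
proof -
  assume "F \<subseteq> {..<length vs}"
  then have "finite F" by (rule finite_subset) simp
  then show ?thesis unfolding powexp_def
    by (induct F) (auto simp: mon_degree_add mon_degree_single mon_degree_def[of 0])
qed

lemma ideal_I: "additive_subgroup I (self_module S)"
  and I_mult: "r \<in> carrier S \<Longrightarrow> p \<in> I \<Longrightarrow> r * p \<in> I"
proof -
  interpret M: module S "self_module S" by (rule module_self_module[OF cring_poly_ring])
  show mult: "r * p \<in> I" if r: "r \<in> carrier S" and p: "p \<in> I" for r p
  proof -
    have "\<not> face (supp u)" if "u \<in> keys (r * p)" for u
    proof -
      obtain a b where "u = a + b" "b \<in> keys p" using \<open>u \<in> keys (r * p)\<close> keys_mult[of r p] by blast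
      then show ?thesis using p face_mono[of "supp u" "supp b"] by (auto simp: I_iff supp_add)
    qed
    then show ?thesis using p r by (auto simp: I_iff intro: poly_ring_closed)
  qed
  show "additive_subgroup I (self_module S)"
  proof (rule M.additive_subgroupI_smult)
    have "0 \<in> I" by (simp add: I_iff poly_ring_simps)
    then show "I \<noteq> {}" by blast
    show "I \<subseteq> carrier (self_module S)" by (auto simp: I_iff self_module_simps)
    show "x \<oplus>\<^bsub>self_module S\<^esub> y \<in> I" if "x \<in> I" "y \<in> I" for x y
      using that keys_add[of x y]
      by (auto simp: I_iff self_module_simps poly_ring_simps(2-) intro: poly_ring_closed)
    show "r \<odot>\<^bsub>self_module S\<^esub> x \<in> I" if "r \<in> carrier S" "x \<in> I" for r x
      using mult[OF that] by (simp add: self_module_simps poly_ring_simps)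
  qed
qed

lemma module_A: "module S A"
  by (rule module_quotient_module[OF module_self_module[OF cring_poly_ring] ideal_I])
    (simp add: self_module_simps poly_ring_simps(2-) I_mult)

lemma cls_self_module: "I +>\<^bsub>self_module S\<^esub> p = cls p"
  by (simp add: a_r_coset_def r_coset_def self_module_simps)

lemma carrier_A: "carrier A = cls ` carrier S"
  by (simp add: quotient_module_simps self_module_simps cls_self_module)

lemma cls_closed [simp]: "p \<in> carrier S \<Longrightarrow> cls p \<in> carrier A"
  by (simp add: carrier_A)

lemma cls_eq_iff:
  assumes "p \<in> carrier S" "q \<in> carrier S"
  shows "cls p = cls q \<longleftrightarrow> p - q \<in> I"
proof -
  interpret M: module S "self_module S" by (rule module_self_module[OF cring_poly_ring])
  have "\<ominus>\<^bsub>self_module S\<^esub> q = - q"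
    by (rule M.M.minus_equality)
      (use assms poly_ring_closed[OF assms(2) assms(2)] in \<open>simp_all add: self_module_simps poly_ring_simps(2-)\<close>)
  then show ?thesis
    using M.M.coset_eq_iff[OF ideal_I, of p q] assms
    by (simp add: self_module_simps cls_self_module a_minus_def poly_ring_simps(2-))
qed

lemma cls_add: "p \<in> carrier S \<Longrightarrow> q \<in> carrier S \<Longrightarrow> cls p \<oplus>\<^bsub>A\<^esub> cls q = cls (p + q)"
proof -
  interpret M: module S "self_module S" by (rule module_self_module[OF cring_poly_ring])
  interpret N: abelian_subgroup I "self_module S"
    by (rule abelian_subgroupI3[OF ideal_I M.M.abelian_group_axioms])
  assume "p \<in> carrier S" "q \<in> carrier S"
  then show ?thesis
    using N.a_rcos_sum[of p q] by (simp add: quotient_module_simps self_module_simps cls_self_module poly_ring_simps(2-))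
qed

lemma cls_smult: "r \<in> carrier S \<Longrightarrow> p \<in> carrier S \<Longrightarrow> r \<odot>\<^bsub>A\<^esub> cls p = cls (r * p)"
proof -
  interpret M: module S "self_module S" by (rule module_self_module[OF cring_poly_ring])
  assume "r \<in> carrier S" "p \<in> carrier S"
  then show ?thesis
    using M.coset_smult[OF ideal_I, of r p] I_mult
    by (simp add: quotient_module_simps self_module_simps cls_self_module poly_ring_simps(2-))
qed

lemma cls_zero: "\<zero>\<^bsub>A\<^esub> = cls 0"
  by (simp add: quotient_module_simps a_r_coset_def' poly_ring_simps)

lemma pvar_closed: "set fs \<subseteq> carrier S"
proof
  fix p assume "p \<in> set fs"
  then obtain v where "v \<in> set vs" "p = pvar v" by auto
  then show "p \<in> carrier S" by (simp add: pvar_def poly_ring_simps(1))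
qed

sublocale cech_complex S A fs
  by (intro cech_complex.intro module_A cech_complex_axioms.intro pvar_closed)

lemma el_eq:
  assumes F: "F \<subseteq> {..<length vs}"
  shows "el F = single (powexp F 1) 1"
proof -
  have "finite F" using F finite_subset by blast
  then show ?thesis using F
  proof (induct F)
    case empty
    then show ?case by (simp add: cech_elem_def powexp_def poly_ring_simps)
  next
    case (insert j F)
    have "el (insert j F) = el F * pvar (vs ! j)"
      using el_remove[of "insert j F" j] insert by (simp add: poly_ring_simps)
    also have "el F = single (powexp F 1) 1" using insert by simp
    also have "single (powexp F 1) 1 * pvar (vs ! j) = single (powexp (insert j F) 1) (1 :: 'k)"
      using insert.hyps by (simp add: pvar_def mult_single powexp_def add.commute)
    finally show ?case .
  qed
qed

lemma el_pow: "F \<subseteq> {..<length vs} \<Longrightarrow> el F [^]\<^bsub>S\<^esub> n = single (powexp F n) 1"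
proof (induct n)
  case 0
  then show ?case by (simp add: poly_ring_pow powexp_zero poly_ring_simps)
next
  case (Suc n)
  then have "el F [^]\<^bsub>S\<^esub> Suc n = single (powexp F 1) 1 * single (powexp F n) 1"
    by (simp add: poly_ring_pow el_eq poly_ring_simps mult.commute)
  also have "\<dots> = single (powexp F (Suc n)) 1"
    using powexp_add[of F 1 n] by (simp add: mult_single)
  finally show ?case .
qed

lemma pvar_pow: "pvar v [^]\<^bsub>S\<^esub> n = single (single v n) 1"
  unfolding poly_ring_pow pvar_def
  by (induct n) (simp_all add: mult_single single_add[symmetric])

end

section \<open>Coefficients of fractions over a face ring\<close>

context face_complex
begin

text \<open>The fraction \<open>p / x\<^sub>F\<^sup>n\<close> over the face ring.\<close>

definition lfrac :: "nat set \<Rightarrow> ('v, 'k) mpoly \<Rightarrow> nat \<Rightarrow> (('v, 'k) mpoly set \<times> nat) set" where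
  "lfrac F p n = loc_class S A (el F) (cls p) n"

lemma localized_el: "F \<subseteq> {..<length vs} \<Longrightarrow> localized_module S A (el F)"
  using localized by simp

lemma single_powexp_closed: "F \<subseteq> {..<length vs} \<Longrightarrow> single (powexp F n) c \<in> carrier S"
  by (rule poly_ring_closed_single[OF keys_powexp])

lemma module_LF_vs: "F \<subseteq> {..<length vs} \<Longrightarrow> module S (LF F)"
  using module_LF by simp

lemma lfrac_closed: "F \<subseteq> {..<length vs} \<Longrightarrow> p \<in> carrier S \<Longrightarrow> lfrac F p n \<in> carrier (LF F)"
  unfolding lfrac_def by (rule localized_module.loc_class_closed[OF localized_el]) auto

lemma lfrac_cases:
  assumes "F \<subseteq> {..<length vs}" "X \<in> carrier (LF F)"
  obtains p n where "p \<in> carrier S" "X = lfrac F p n"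
  using assms(2) unfolding localized_module.carrier_localization[OF localized_el[OF assms(1)]]
  by (auto simp: carrier_A lfrac_def)

lemma lfrac_add:
  assumes "F \<subseteq> {..<length vs}" "p \<in> carrier S" "q \<in> carrier S"
  shows "lfrac F p n \<oplus>\<^bsub>LF F\<^esub> lfrac F q n = lfrac F (p + q) n"
  using assms(2,3) localized_module.add_localization_same[OF localized_el[OF assms(1)], of "cls p" "cls q" n]
  by (simp add: lfrac_def cls_add)

lemma lfrac_smult:
  assumes "F \<subseteq> {..<length vs}" "r \<in> carrier S" "p \<in> carrier S"
  shows "r \<odot>\<^bsub>LF F\<^esub> lfrac F p n = lfrac F (r * p) n"
  using assms(2,3) localized_module.smult_localization[OF localized_el[OF assms(1)], of r "cls p" n]
  by (simp add: lfrac_def cls_smult)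

lemma lfrac_zero:
  assumes "F \<subseteq> {..<length vs}"
  shows "\<zero>\<^bsub>LF F\<^esub> = lfrac F 0 n"
  unfolding lfrac_def cls_zero[symmetric] by (rule localized_module.zero_localization[OF localized_el[OF assms]])

lemma lfrac_eq_iff:
  assumes F: "F \<subseteq> {..<length vs}" and p: "p \<in> carrier S" and q: "q \<in> carrier S"
  shows "lfrac F p n = lfrac F q k \<longleftrightarrow>
    (\<exists>j. single (powexp F (j + k)) 1 * p - single (powexp F (j + n)) 1 * q \<in> I)"
proof -
  have "el F [^]\<^bsub>S\<^esub> m \<odot>\<^bsub>A\<^esub> cls r = cls (single (powexp F m) 1 * r)" if "r \<in> carrier S" for m r
    using that by (simp add: el_pow[OF F] cls_smult single_powexp_closed[OF F])
  then show ?thesis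
    unfolding lfrac_def localized_module.loc_class_eq_iff[OF localized_el[OF F] cls_closed[OF p] cls_closed[OF q]]
    using p q by (simp add: cls_eq_iff poly_ring_closed single_powexp_closed[OF F])
qed

lemma lfrac_expand:
  assumes F: "F \<subseteq> {..<length vs}" and p: "p \<in> carrier S"
  shows "lfrac F (single (powexp F k) 1 * p) (k + n) = lfrac F p n"
proof -
  have "single (powexp F n) 1 * (single (powexp F k) 1 * p) - single (powexp F (k + n)) 1 * p = 0"
    by (simp add: mult.assoc[symmetric] mult_single powexp_add[symmetric] add.commute)
  moreover have "0 \<in> I" by (simp add: I_iff poly_ring_simps)
  ultimately show ?thesis
    using p by (subst lfrac_eq_iff[OF F]) (auto intro!: exI[of _ 0] poly_ring_closed single_powexp_closed[OF F])
qed

text \<open>When the fraction is expanded by \<open>x\<^sub>F\<close>, all monomials of the numerator lie in the face ideal.\<close>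

lemma lfrac_eq_zero:
  assumes F: "F \<subseteq> {..<length vs}" and p: "p \<in> carrier S"
    and nonface: "\<And>u. u \<in> keys p \<Longrightarrow> \<not> face (supp u \<union> F)"
  shows "lfrac F p n = \<zero>\<^bsub>LF F\<^esub>"
proof -
  have "single (powexp F 1) 1 * p \<in> I"
    unfolding I_iff
  proof safe
    show "single (powexp F 1) 1 * p \<in> carrier S" by (intro poly_ring_closed single_powexp_closed F p)
    fix u assume "u \<in> keys (single (powexp F 1) 1 * p)" "face (supp u)"
    then obtain w where w: "w \<in> keys p" "u = w + powexp F 1"
      by (metis keys_mult_single mult.commute)
    then have "face (supp w \<union> F)"
      using \<open>face (supp u)\<close> supp_powexp[OF F, of 1] by (simp add: supp_add)
    then show False using nonface w by blast
  qed
  then show ?thesis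
    unfolding lfrac_zero[OF F, of 0]
    by (subst lfrac_eq_iff[OF F p]) (auto intro!: exI[of _ 1] simp: poly_ring_simps)
qed

lemma cech_map_lfrac:
  assumes F: "F \<subseteq> {..<length vs}" and j: "j \<in> F" and p: "p \<in> carrier S"
  shows "cech_map F j (lfrac (F - {j}) p n) = lfrac F (single (single (vs ! j) n) 1 * p) n"
proof -
  have j': "j < length vs" using F j by auto
  have "single (single (vs ! j) n) 1 \<in> carrier S"
    using j' by (intro poly_ring_closed_single) auto
  moreover have "fs ! j [^]\<^bsub>S\<^esub> n = single (single (vs ! j) n) 1"
    using j' by (simp only: nth_map pvar_pow)
  ultimately show ?thesis
    using F j p by (simp add: lfrac_def cech_map_loc_class cls_smult)
qed

text \<open>\<open>coef F b X\<close> is the coefficient of \<open>x\<^sup>-\<^sup>b\<close> in the fraction \<open>X = p / x\<^sub>F\<^sup>n\<close>: the coefficient of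
  \<open>x\<^sub>F\<^sup>n\<close> in \<open>p x\<^sup>b\<close>. In this form no subtraction of exponents is needed, and the coefficient is
  automatically zero if \<open>x\<^sub>F\<^sup>n\<close> is not divisible by \<open>x\<^sup>b\<close>. It is well defined if \<open>F\<close> is a face.\<close>

definition coef :: "nat set \<Rightarrow> ('v \<Rightarrow>\<^sub>0 nat) \<Rightarrow> (('v, 'k) mpoly set \<times> nat) set \<Rightarrow> 'k" where
  "coef F b X = (SOME c. \<exists>p n. p \<in> carrier S \<and> X = lfrac F p n \<and>
     c = lookup (p * single b 1) (powexp F n))"

text \<open>If \<open>F\<close> is a face, then a divisor of a power of \<open>x\<^sub>F\<close> is not a monomial of the face ideal.
  Hence the coefficient depends on the fraction only.\<close>

lemma lookup_powexp_unique:
  assumes F: "face F" and p: "p \<in> carrier S" and q: "q \<in> carrier S"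
    and eq: "lfrac F p n = lfrac F q k"
  shows "lookup (p * single b 1) (powexp F n) = lookup (q * single b 1) (powexp F k)"
proof -
  note Fs = face_subset[OF F]
  obtain j where j: "single (powexp F (j + k)) 1 * p - single (powexp F (j + n)) 1 * q \<in> I" (is "?d \<in> I")
    using eq lfrac_eq_iff[OF Fs p q] by blast
  let ?w = "powexp F (j + k + n)"
  have "?w \<notin> keys (?d * single b 1)"
  proof
    assume "?w \<in> keys (?d * single b 1)"
    then obtain u where u: "u \<in> keys ?d" "?w = u + b" by (rule keys_mult_single)
    have "supp u \<subseteq> supp ?w" by (simp add: u(2) supp_add)
    also have "\<dots> \<subseteq> F" by (simp add: supp_powexp[OF Fs])
    finally have "face (supp u)" using F face_mono by blast
    then show False using j u by (auto simp: I_iff)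
  qed
  then have "lookup (?d * single b 1) ?w = 0" by (simp add: in_keys_iff)
  moreover have "?d * single b 1 = (p * single b 1) * single (powexp F (j + k)) 1
      - (q * single b 1) * single (powexp F (j + n)) 1"
    by (simp add: algebra_simps)
  ultimately have e0: "lookup ((p * single b 1) * single (powexp F (j + k)) 1) ?w =
      lookup ((q * single b 1) * single (powexp F (j + n)) 1) ?w"
    by (simp add: lookup_minus)
  have w: "?w = powexp F n + powexp F (j + k)" "?w = powexp F k + powexp F (j + n)"
    by (simp_all add: powexp_add[symmetric] ac_simps)
  have e1: "lookup ((p * single b 1) * single (powexp F (j + k)) 1) ?w = lookup (p * single b 1) (powexp F n)"
    unfolding w(1) by (simp only: lookup_mult_single mult_1_right)
  have e2: "lookup ((q * single b 1) * single (powexp F (j + n)) 1) ?w = lookup (q * single b 1) (powexp F k)"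
    unfolding w(2) by (simp only: lookup_mult_single mult_1_right)
  show ?thesis using e0 unfolding e1 e2 .
qed

lemma coef_lfrac:
  assumes F: "face F" and p: "p \<in> carrier S"
  shows "coef F b (lfrac F p n) = lookup (p * single b 1) (powexp F n)"
  unfolding coef_def
proof (rule some_equality)
  show "\<exists>q k. q \<in> carrier S \<and> lfrac F p n = lfrac F q k \<and>
      lookup (p * single b 1) (powexp F n) = lookup (q * single b 1) (powexp F k)"
    using p by blast
next
  fix c assume "\<exists>q k. q \<in> carrier S \<and> lfrac F p n = lfrac F q k \<and> c = lookup (q * single b 1) (powexp F k)"
  then obtain q k where q: "q \<in> carrier S" "lfrac F p n = lfrac F q k"
    and c: "c = lookup (q * single b 1) (powexp F k)" by blast
  show "c = lookup (p * single b 1) (powexp F n)"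
    unfolding c by (rule lookup_powexp_unique[OF F p q, symmetric])
qed

lemma coef_add:
  assumes F: "face F" and X: "X \<in> carrier (LF F)" and Y: "Y \<in> carrier (LF F)"
  shows "coef F b (X \<oplus>\<^bsub>LF F\<^esub> Y) = coef F b X + coef F b Y"
proof -
  note Fs = face_subset[OF F]
  obtain p n where p: "p \<in> carrier S" "X = lfrac F p n" by (rule lfrac_cases[OF Fs X])
  obtain q k where q: "q \<in> carrier S" "Y = lfrac F q k" by (rule lfrac_cases[OF Fs Y])
  let ?p = "single (powexp F k) 1 * p" and ?q = "single (powexp F n) 1 * q"
  have cl: "?p \<in> carrier S" "?q \<in> carrier S"
    using p q by (auto intro: poly_ring_closed single_powexp_closed[OF Fs])
  have "X = lfrac F ?p (k + n)" "Y = lfrac F ?q (k + n)"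
    using p q lfrac_expand[OF Fs p(1), of k n] lfrac_expand[OF Fs q(1), of n k] by (simp_all add: add.commute)
  then show ?thesis
    using cl by (simp add: lfrac_add[OF Fs] coef_lfrac[OF F] poly_ring_closed distrib_right lookup_add)
qed

lemma coef_zero: "face F \<Longrightarrow> coef F b \<zero>\<^bsub>LF F\<^esub> = 0"
  using lfrac_zero[OF face_subset, of F 0] coef_lfrac[of F 0 b 0] by (simp add: poly_ring_simps)

lemma pconst_closed: "pconst c \<in> carrier S"
  by (auto simp: pconst_def intro!: poly_ring_closed_single)

lemma pconst_mult_single: "pconst c * single u d = single u (c * d)"
  by (simp add: pconst_def mult_single)

lemma coef_smult:
  assumes F: "face F" and X: "X \<in> carrier (LF F)"
  shows "coef F b (pconst c \<odot>\<^bsub>LF F\<^esub> X) = c * coef F b X"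
proof -
  note Fs = face_subset[OF F]
  obtain p n where p: "p \<in> carrier S" "X = lfrac F p n" by (rule lfrac_cases[OF Fs X])
  have "lookup (pconst c * p * single b 1) (powexp F n) = lookup ((p * single b 1) * single 0 c) (powexp F n + 0)"
    by (simp add: pconst_def algebra_simps)
  also have "\<dots> = c * lookup (p * single b 1) (powexp F n)"
    by (subst lookup_mult_single) (simp add: mult.commute)
  finally show ?thesis
    using p by (simp add: lfrac_smult[OF Fs] pconst_closed coef_lfrac[OF F] poly_ring_closed)
qed

lemma coef_finsum:
  assumes F: "face F" and "finite J" and "f \<in> J \<rightarrow> carrier (LF F)"
  shows "coef F b (finsum (LF F) f J) = (\<Sum>j\<in>J. coef F b (f j))"
proof -
  interpret L: module S "LF F" by (rule module_LF_vs[OF face_subset[OF F]])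
  show ?thesis
    using assms(2,3)
  proof (induct J)
    case (insert j J)
    then have "f \<in> J \<rightarrow> carrier (LF F)" "f j \<in> carrier (LF F)" by auto
    then show ?case
      using insert by (simp add: coef_add[OF F] L.M.finsum_closed)
  qed (simp add: coef_zero[OF F])
qed

text \<open>Localizing further preserves the coefficients. If the support of \<open>b\<close> contains \<open>j\<close>, then both sides
  are zero.\<close>

lemma coef_cech_map:
  assumes F: "face F" and j: "j \<in> F" and X: "X \<in> carrier (LF (F - {j}))"
  shows "coef F b (cech_map F j X) = coef (F - {j}) b X"
proof -
  note Fs = face_subset[OF F]
  have E: "face (F - {j})" using F face_mono by blast
  obtain p n where p: "p \<in> carrier S" "X = lfrac (F - {j}) p n"
    by (rule lfrac_cases[OF face_subset[OF E] X])
  let ?s = "single (single (vs ! j) n) (1 :: 'k)"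
  have s: "?s \<in> carrier S"
    using Fs j by (intro poly_ring_closed_single) auto
  have e1: "?s * p * single b 1 = (p * single b 1) * ?s" by (simp add: algebra_simps)
  have e2: "powexp F n = powexp (F - {j}) n + single (vs ! j) n"
    by (simp add: powexp_insert[OF Fs j] add.commute)
  have "coef F b (cech_map F j X) = lookup (?s * p * single b 1) (powexp F n)"
    using p s by (simp add: cech_map_lfrac[OF Fs j] coef_lfrac[OF F] poly_ring_closed)
  also have "\<dots> = lookup (p * single b 1) (powexp (F - {j}) n)"
    unfolding e1 e2 by (simp only: lookup_mult_single mult_1_right)
  also have "\<dots> = coef (F - {j}) b X"
    using p by (simp add: coef_lfrac[OF E])
  finally show ?thesis .
qed

lemma coef_eq_zero:
  assumes F: "face F" and X: "X \<in> carrier (LF F)" and b: "\<not> supp b \<subseteq> F"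
  shows "coef F b X = 0"
proof -
  note Fs = face_subset[OF F]
  obtain p n where p: "p \<in> carrier S" "X = lfrac F p n" by (rule lfrac_cases[OF Fs X])
  have "powexp F n \<notin> keys (p * single b 1)"
  proof
    assume "powexp F n \<in> keys (p * single b 1)"
    then obtain u where "powexp F n = u + b" by (rule keys_mult_single)
    then have "supp b \<subseteq> supp (powexp F n)" by (simp add: supp_add)
    also have "\<dots> \<subseteq> F" by (simp add: supp_powexp[OF Fs])
    finally show False using b by blast
  qed
  then show ?thesis using p by (simp add: coef_lfrac[OF F] in_keys_iff)
qed

text \<open>The signs of the Cech differential as elements of the field.\<close>

definition cech_sign_const :: "nat set \<Rightarrow> nat \<Rightarrow> 'k" where "cech_sign_const F j = (-1) ^ card {i \<in> F. i < j}"

lemma cech_sign_eq: "cech_sign F j = pconst (cech_sign_const F j)"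
proof -
  have "\<ominus>\<^bsub>S\<^esub> \<one>\<^bsub>S\<^esub> = - 1"
    using poly_ring_uminus[of 1 "set vs"] by (simp add: poly_ring_simps)
  then show ?thesis
    by (simp add: cech_sign_def cech_sign_const_def pconst_def poly_ring_simps single_uminus)
qed

lemma cech_sign_const_square: "cech_sign_const F j * (cech_sign_const F j * c) = c"
  by (simp add: cech_sign_const_def mult.assoc[symmetric] power_add[symmetric])

end

section \<open>Complexes of partial transversals\<close>

lemma finite_monomials:
  fixes V :: "'v set"
  assumes "finite V"
  shows "finite {b :: 'v \<Rightarrow>\<^sub>0 nat. keys b \<subseteq> V \<and> mon_degree b = d}"
proof (rule inj_on_finite)
  show "inj_on (\<lambda>b. restrict (lookup b) V) {b :: 'v \<Rightarrow>\<^sub>0 nat. keys b \<subseteq> V \<and> mon_degree b = d}"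
  proof (rule inj_onI, rule poly_mapping_eqI)
    fix a b :: "'v \<Rightarrow>\<^sub>0 nat" and v
    assume a: "a \<in> {b. keys b \<subseteq> V \<and> mon_degree b = d}" and b: "b \<in> {b. keys b \<subseteq> V \<and> mon_degree b = d}"
      and eq: "restrict (lookup a) V = restrict (lookup b) V"
    show "lookup a v = lookup b v"
    proof (cases "v \<in> V")
      case True
      then show ?thesis using fun_cong[OF eq, of v] by simp
    next
      case False
      then have "v \<notin> keys a" "v \<notin> keys b" using a b by auto
      then show ?thesis by (simp add: in_keys_iff)
    qed
  qed
  show "(\<lambda>b. restrict (lookup b) V) ` {b :: 'v \<Rightarrow>\<^sub>0 nat. keys b \<subseteq> V \<and> mon_degree b = d} \<subseteq> V \<rightarrow>\<^sub>E {..d}"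
    using lookup_le_mon_degree by (fastforce simp: PiE_iff)
  show "finite (V \<rightarrow>\<^sub>E {..d})" using assms by (intro finite_PiE) auto
qed

lemma sum_Pow_insert_pair:
  assumes "finite R" "i \<in> R"
  shows "(\<Sum>D\<in>Pow R. f D) = (\<Sum>D\<in>Pow (R - {i}). f D + f (insert i D))"
proof -
  have "Pow R = Pow (R - {i}) \<union> insert i ` Pow (R - {i})"
    using Pow_insert[of i "R - {i}"] assms(2) by (simp add: insert_absorb)
  moreover have "Pow (R - {i}) \<inter> insert i ` Pow (R - {i}) = {}" by auto
  moreover have "inj_on (insert i) (Pow (R - {i}))" by (auto simp: inj_on_def)
  ultimately show ?thesis
    using assms(1) by (simp add: sum.union_disjoint sum.reindex sum.distrib)
qed

text \<open>The number of pairs of \<open>F\<close> that are ordered differently by position and by class. For a facet it is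
  the length of the permutation that sorts the vertices by class.\<close>

definition inversions :: "(nat \<Rightarrow> nat) \<Rightarrow> nat set \<Rightarrow> nat" where
  "inversions color F = card {(u, v). u \<in> F \<and> v \<in> F \<and> u < v \<and> color v < color u}"

lemma inversions_insert:
  assumes "finite E" "j \<notin> E"
  shows "inversions color (insert j E) =
    inversions color E + card {u \<in> E. u < j \<and> color j < color u} + card {u \<in> E. j < u \<and> color u < color j}"
proof -
  let ?A = "{(u, v). u \<in> E \<and> v \<in> E \<and> u < v \<and> color v < color u}"
  let ?B = "(\<lambda>u. (u, j)) ` {u \<in> E. u < j \<and> color j < color u}"
  let ?C = "(\<lambda>u. (j, u)) ` {u \<in> E. j < u \<and> color u < color j}"
  have eq: "{(u, v). u \<in> insert j E \<and> v \<in> insert j E \<and> u < v \<and> color v < color u} = ?A \<union> ?B \<union> ?C"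
    by auto
  have fin: "finite ?A" by (rule finite_subset[of _ "E \<times> E"]) (use assms in auto)
  have "card (?A \<union> ?B \<union> ?C) = card ?A + card ?B + card ?C"
    using fin assms by (subst card_Un_disjoint; (auto)?)+
  then show ?thesis
    unfolding inversions_def eq by (simp add: card_image inj_on_def)
qed

text \<open>Inserting \<open>j\<close> into \<open>E\<close>, the sign of the Cech differential and the change of the number of inversions
  combine to a sign that depends on \<open>E\<close> and on the class of \<open>j\<close> only.\<close>

lemma sign_insert:
  assumes "finite E" "j \<notin> E" "color j \<notin> color ` E"
  shows "(-1 :: 'a::ring_1) ^ (inversions color (insert j E) + card {i \<in> insert j E. i < j}) =
    (-1) ^ (inversions color E + card {u \<in> E. color u < color j})"
proof -
  let ?a = "card {u \<in> E. u < j \<and> color j < color u}"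
  let ?b = "card {u \<in> E. j < u \<and> color u < color j}"
  let ?c = "card {u \<in> E. u < j \<and> color u < color j}"
  have "{i \<in> insert j E. i < j} = {u \<in> E. u < j \<and> color j < color u} \<union> {u \<in> E. u < j \<and> color u < color j}"
  proof -
    have "color u < color j \<or> color j < color u" if "u \<in> E" for u
      using that assms(3) by (metis imageI linorder_neqE_nat)
    then show ?thesis by auto
  qed
  then have 1: "card {i \<in> insert j E. i < j} = ?a + ?c"
    using assms(1) by (simp add: card_Un_disjoint disjoint_iff)
  have "{u \<in> E. color u < color j} = {u \<in> E. j < u \<and> color u < color j} \<union> {u \<in> E. u < j \<and> color u < color j}"
  proof -
    have "u < j \<or> j < u" if "u \<in> E" for u
      using that assms(2) by (metis linorder_neqE_nat)
    then show ?thesis by auto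
  qed
  then have 2: "card {u \<in> E. color u < color j} = ?b + ?c"
    using assms(1) by (simp add: card_Un_disjoint disjoint_iff)
  have "inversions color E + ?a + ?b + (?a + ?c) = inversions color E + (?b + ?c) + 2 * ?a" by simp
  then show ?thesis
    unfolding inversions_insert[OF assms(1,2)] 1 2
    by (simp only: power_add[of _ _ "2 * _"] power_minus1_even mult_1_right)
qed

text \<open>A face complex whose vertices are partitioned into \<open>h\<close> classes by \<open>color\<close>, such that every face has at
  most one vertex in each class. Each class has a distinguished vertex, its apex, by which every face
  that misses the class can be enlarged.\<close>

locale transversal_complex = face_complex vs face I
  for vs :: "'v list" and face :: "nat set \<Rightarrow> bool" and I :: "('v, 'k::field) mpoly set" +
  fixes h :: nat and color :: "nat \<Rightarrow> nat" and apex :: "nat \<Rightarrow> nat"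
  assumes color_range: "j < length vs \<Longrightarrow> color j \<in> {1..h}"
    and apex_less: "i \<in> {1..h} \<Longrightarrow> apex i < length vs"
    and color_apex: "i \<in> {1..h} \<Longrightarrow> color (apex i) = i"
    and inj_color: "face F \<Longrightarrow> inj_on color F"
    and face_insert_apex: "face F \<Longrightarrow> i \<in> {1..h} \<Longrightarrow> i \<notin> color ` F \<Longrightarrow> face (insert (apex i) F)"
begin

text \<open>The facets, by their cardinality: since a face that misses a class can be enlarged, the maximal faces
  are those of cardinality \<open>h\<close>.\<close>

definition facet :: "nat set \<Rightarrow> bool" where "facet F \<longleftrightarrow> face F \<and> card F = h"

lemma face_finite: "face F \<Longrightarrow> finite F"
  using face_subset finite_subset by blast

lemma color_image: "face F \<Longrightarrow> color ` F \<subseteq> {1..h}"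
  using color_range face_subset by blast

lemma face_card_le: "face F \<Longrightarrow> card F \<le> h"
  using card_mono[OF _ color_image] by (fastforce simp: card_image inj_color)

lemma facet_color: "facet F \<Longrightarrow> color ` F = {1..h}"
  unfolding facet_def using card_subset_eq[OF _ color_image, of F] by (simp add: card_image inj_color)

lemma facetI: "face F \<Longrightarrow> {1..h} \<subseteq> color ` F \<Longrightarrow> facet F"
proof -
  assume F: "face F" and "{1..h} \<subseteq> color ` F"
  then have "color ` F = {1..h}" using color_image by blast
  then have "card F = card {1..h}" using card_image[OF inj_color[OF F]] by metis
  then show "facet F" by (simp add: facet_def F)
qed

lemma facet_cech_face: "facet F \<Longrightarrow> F \<in> cech_faces fs h"
  using face_subset by (auto simp: facet_def cech_faces_def)

lemma facet_subset: "facet F \<Longrightarrow> F \<subseteq> {..<length vs}"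
  by (simp add: facet_def face_subset)

lemma facet_insert_nonface: "facet F \<Longrightarrow> j \<notin> F \<Longrightarrow> F \<subseteq> F' \<Longrightarrow> j \<in> F' \<Longrightarrow> \<not> face F'"
proof
  assume F: "facet F" "j \<notin> F" "F \<subseteq> F'" "j \<in> F'" and "face F'"
  then have "face (insert j F)" using face_mono by blast
  then show False
    using face_card_le[of "insert j F"] F by (simp add: facet_def face_finite)
qed

text \<open>\<open>switch B D\<close> replaces the vertices of \<open>B\<close> in the classes \<open>D\<close> by the apexes; \<open>switchable B\<close> is the set
  of the classes in which this changes \<open>B\<close>.\<close>

definition switch :: "nat set \<Rightarrow> nat set \<Rightarrow> nat set" where
  "switch B D = {j \<in> B. color j \<notin> D} \<union> apex ` D"

definition switchable :: "nat set \<Rightarrow> nat set" where "switchable B = {i \<in> {1..h}. apex i \<notin> B}"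

lemma switch_empty [simp]: "switch B {} = B"
  by (simp add: switch_def)

lemma switch_insert: "insert i D \<subseteq> {1..h} \<Longrightarrow> i \<notin> D \<Longrightarrow>
    switch B (insert i D) = insert (apex i) {j \<in> switch B D. color j \<noteq> i}"
  using color_apex by (auto simp: switch_def)

text \<open>The vertices are replaced one by one: dropping a vertex leaves a face, which the apex enlarges.\<close>

lemma switch_facet:
  assumes B: "facet B" and D: "D \<subseteq> {1..h}"
  shows "facet (switch B D)"
proof (rule facetI)
  have "finite D" using D finite_subset by blast
  then show "face (switch B D)" using D
  proof (induct D)
    case empty
    then show ?case using B by (simp add: facet_def)
  next
    case (insert i D)
    have "face (switch B D)" by (rule insert.hyps(3)) (use insert.prems in auto)
    then have "face {j \<in> switch B D. color j \<noteq> i}" by (rule face_mono) auto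
    then have "face (insert (apex i) {j \<in> switch B D. color j \<noteq> i})"
      using insert.prems by (intro face_insert_apex) auto
    then show ?case by (simp only: switch_insert[OF insert.prems insert.hyps(2)])
  qed
  show "{1..h} \<subseteq> color ` switch B D"
  proof
    fix i assume i: "i \<in> {1..h}"
    then obtain j where "j \<in> B" "color j = i" using facet_color[OF B] by (metis imageE)
    then show "i \<in> color ` switch B D"
      using color_apex[OF i] by (cases "i \<in> D") (auto simp: switch_def image_iff intro: bexI[of _ "apex i"] bexI[of _ j])
  qed
qed

text \<open>The index set of the basis in degree \<open>l\<close>: the pair \<open>(B, b)\<close> stands for the Laurent monomial \<open>x\<^sup>-\<^sup>b\<close> at the
  facet \<open>B\<close>. The support of \<open>b\<close> lies in \<open>B\<close> and contains all apexes in \<open>B\<close>. The set is empty for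
  \<open>l > 0\<close>.\<close>

definition basis_index :: "int \<Rightarrow> (nat set \<times> ('v \<Rightarrow>\<^sub>0 nat)) set" where
  "basis_index l = {(B, b). facet B \<and> keys b \<subseteq> set vs \<and> supp b \<subseteq> B \<and>
     (\<forall>i\<in>{1..h}. apex i \<in> B \<longrightarrow> apex i \<in> supp b) \<and> int (mon_degree b) = - l}"

lemma finite_basis_index: "finite (basis_index l)"
proof (rule finite_subset)
  show "basis_index l \<subseteq> Pow {..<length vs} \<times> {b. keys b \<subseteq> set vs \<and> mon_degree b = nat (- l)}"
    by (auto simp: basis_index_def facet_def dest: face_subset)
  show "finite (Pow {..<length vs} \<times> {b. keys b \<subseteq> set vs \<and> mon_degree b = nat (- l)})"
    by (simp add: finite_monomials)
qed

text \<open>\<open>basis_cochain l g\<close> is the linear combination of the basis elements of degree \<open>l\<close> with coefficients \<open>g\<close>.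
  At \<open>F\<close> its common denominator is \<open>x\<^sub>F\<^sup>-\<^sup>l\<close>, which suffices as the exponents in \<open>b\<close> are at most \<open>-l\<close>, and its
  numerator is \<open>basis_num l g F\<close>.\<close>

definition basis_num :: "int \<Rightarrow> (nat set \<times> ('v \<Rightarrow>\<^sub>0 nat) \<Rightarrow> 'k) \<Rightarrow> nat set \<Rightarrow> ('v, 'k) mpoly" where
  "basis_num l g F = (\<Sum>b\<in>{b. (F, b) \<in> basis_index l}. single (powexp F (nat (- l)) - b) (g (F, b)))"

definition basis_cochain :: "int \<Rightarrow> (nat set \<times> ('v \<Rightarrow>\<^sub>0 nat) \<Rightarrow> 'k) \<Rightarrow> nat set \<Rightarrow> (('v, 'k) mpoly set \<times> nat) set" where
  "basis_cochain l g = (\<lambda>F\<in>cech_faces fs h. lfrac F (basis_num l g F) (nat (- l)))"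

lemma finite_fiber: "finite {b. (F, b) \<in> basis_index l}"
  using finite_imageI[OF finite_basis_index, of snd l] by (rule rev_finite_subset) force

lemma basis_index_le:
  assumes "(F, b) \<in> basis_index l"
  shows "powexp F (nat (- l)) - b + b = powexp F (nat (- l))"
proof (rule poly_mapping_eqI)
  fix v
  have Fs: "F \<subseteq> {..<length vs}" and b: "keys b \<subseteq> set vs" "supp b \<subseteq> F" "mon_degree b = nat (- l)"
    using assms by (auto simp: basis_index_def facet_def dest: face_subset)
  have "lookup b v \<le> lookup (powexp F (nat (- l))) v"
  proof (cases "v \<in> keys b")
    case True
    then obtain j where j: "j < length vs" "v = vs ! j" using b(1) by (metis in_set_conv_nth subsetD)
    then have "j \<in> F" using True b(2) by (auto simp: supp_def in_keys_iff)
    then show ?thesis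
      using lookup_le_mon_degree[of b v] b(3) j by (simp add: lookup_powexp_nth[OF Fs])
  qed (simp add: in_keys_iff)
  then show "lookup (powexp F (nat (- l)) - b + b) v = lookup (powexp F (nat (- l))) v"
    by (simp add: lookup_add lookup_minus)
qed

lemma basis_num_closed: "F \<subseteq> {..<length vs} \<Longrightarrow> basis_num l g F \<in> carrier S"
proof (unfold basis_num_def, intro poly_ring_closed_sum poly_ring_closed_single)
  fix b assume F: "F \<subseteq> {..<length vs}"
  have "keys (powexp F (nat (- l)) - b) \<subseteq> keys (powexp F (nat (- l)))"
    by (auto simp: in_keys_iff lookup_minus)
  then show "keys (powexp F (nat (- l)) - b) \<subseteq> set vs" using keys_powexp[OF F] by blast
qed

lemma cech_face_subset: "F \<in> cech_faces fs p \<Longrightarrow> F \<subseteq> {..<length vs}"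
  using faces_subset by simp

lemma basis_cochain_closed: "basis_cochain l g \<in> carrier (CC h)"
  by (auto simp: basis_cochain_def CC_simps intro!: lfrac_closed basis_num_closed dest: cech_face_subset)

lemma basis_num_add: "basis_num l (\<lambda>t. g t + g' t) F = basis_num l g F + basis_num l g' F"
  by (simp add: basis_num_def single_add sum.distrib)

lemma basis_num_smult: "basis_num l (\<lambda>t. c * g t) F = pconst c * basis_num l g F"
  by (simp add: basis_num_def sum_distrib_left pconst_mult_single)

lemma basis_cochain_add: "basis_cochain l (\<lambda>t. g t + g' t) = basis_cochain l g \<oplus>\<^bsub>CC h\<^esub> basis_cochain l g'"
  by (auto simp: basis_cochain_def CC_simps lfrac_add basis_num_closed basis_num_add cech_face_subset fun_eq_iff)

lemma basis_cochain_smult: "basis_cochain l (\<lambda>t. c * g t) = pconst c \<odot>\<^bsub>CC h\<^esub> basis_cochain l g"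
  by (auto simp: basis_cochain_def CC_simps lfrac_smult basis_num_closed pconst_closed basis_num_smult cech_face_subset fun_eq_iff)

lemma coef_basis_num:
  assumes F: "facet F"
  shows "coef F b (lfrac F (basis_num l g F) (nat (- l))) = (if (F, b) \<in> basis_index l then g (F, b) else 0)"
proof -
  let ?n = "nat (- l)"
  have "coef F b (lfrac F (basis_num l g F) ?n) = lookup (basis_num l g F * single b 1) (powexp F ?n)"
    using F by (simp add: coef_lfrac facet_def basis_num_closed face_subset)
  also have "\<dots> = (\<Sum>b'\<in>{b'. (F, b') \<in> basis_index l}.
      lookup (single (powexp F ?n - b' + b) (g (F, b'))) (powexp F ?n))"
    by (simp add: basis_num_def sum_distrib_right mult_single lookup_sum)
  also have "\<dots> = (\<Sum>b'\<in>{b'. (F, b') \<in> basis_index l}. if b' = b then g (F, b') else 0)"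
  proof (rule sum.cong[OF refl])
    fix b' assume "b' \<in> {b'. (F, b') \<in> basis_index l}"
    then have "powexp F ?n - b' + b' = powexp F ?n" by (simp add: basis_index_le)
    then have "powexp F ?n - b' + b = powexp F ?n \<longleftrightarrow> b' = b" by (metis add_left_cancel)
    then show "lookup (single (powexp F ?n - b' + b) (g (F, b'))) (powexp F ?n) = (if b' = b then g (F, b') else 0)"
      by (simp add: lookup_single when_def)
  qed
  also have "\<dots> = (if (F, b) \<in> basis_index l then g (F, b) else 0)"
    using finite_fiber[of F l] by simp
  finally show ?thesis .
qed

text \<open>The functional dual to the basis element \<open>(B, b)\<close>. The number of inversions of \<open>B\<close> only normalizes
  the sign of the term \<open>D = {}\<close> to \<open>1\<close>.\<close>

definition dual :: "nat set \<Rightarrow> ('v \<Rightarrow>\<^sub>0 nat) \<Rightarrow> (nat set \<Rightarrow> (('v, 'k) mpoly set \<times> nat) set) \<Rightarrow> 'k" where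
  "dual B b c = (\<Sum>D\<in>Pow (switchable B).
     (-1) ^ (card D + inversions color (switch B D) + inversions color B) * coef (switch B D) b (c (switch B D)))"

lemma switchable_subset: "switchable B \<subseteq> {1..h}" by (auto simp: switchable_def)

lemma finite_switchable [simp]: "finite (switchable B)" by (simp add: switchable_def)

lemma dual_add:
  assumes B: "facet B" and c: "c \<in> carrier (CC h)" and d: "d \<in> carrier (CC h)"
  shows "dual B b (c \<oplus>\<^bsub>CC h\<^esub> d) = dual B b c + dual B b d"
proof -
  have "coef (switch B D) b ((c \<oplus>\<^bsub>CC h\<^esub> d) (switch B D)) = coef (switch B D) b (c (switch B D)) + coef (switch B D) b (d (switch B D))"
    if "D \<in> Pow (switchable B)" for D
  proof -
    have F: "facet (switch B D)" using that switchable_subset by (intro switch_facet[OF B]) blast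
    note Fc = facet_cech_face[OF F]
    show ?thesis
      using F Fc CC_D[OF c Fc] CC_D[OF d Fc] by (simp add: CC_simps coef_add facet_def)
  qed
  then show ?thesis
    by (simp add: dual_def distrib_left sum.distrib)
qed

text \<open>Only the term \<open>D = {}\<close> contributes: the other facets \<open>switch B D\<close> contain an apex outside of \<open>B\<close>,
  where \<open>b\<close> is zero, and no basis element is given by \<open>x\<^sup>-\<^sup>b\<close> at such a facet.\<close>

lemma dual_basis_cochain:
  assumes "(B, b) \<in> basis_index l"
  shows "dual B b (basis_cochain l g) = g (B, b)"
proof -
  have B: "facet B" and b: "supp b \<subseteq> B" using assms by (auto simp: basis_index_def)
  have coef_basis_cochain: "coef (switch B D) b (basis_cochain l g (switch B D)) = (if D = {} then g (B, b) else 0)"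
    if D: "D \<in> Pow (switchable B)" for D
  proof -
    have F: "facet (switch B D)" using D switchable_subset by (intro switch_facet[OF B]) blast
    have "(switch B D, b) \<notin> basis_index l" if "D \<noteq> {}"
    proof -
      obtain i where i: "i \<in> D" using \<open>D \<noteq> {}\<close> by blast
      then have "i \<in> {1..h}" "apex i \<notin> B" "apex i \<in> switch B D" using D by (auto simp: switchable_def switch_def)
      then show ?thesis using b by (auto simp: basis_index_def)
    qed
    then show ?thesis
      using facet_cech_face[OF F] assms by (auto simp: basis_cochain_def coef_basis_num[OF F])
  qed
  have "dual B b (basis_cochain l g) = (\<Sum>D\<in>Pow (switchable B). if D = {} then
      (-1) ^ (card D + inversions color (switch B D) + inversions color B) * g (B, b) else 0)"
    unfolding dual_def by (rule sum.cong[OF refl]) (simp add: coef_basis_cochain)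
  also have "\<dots> = g (B, b)"
    by (simp add: power_add left_minus_one_mult_self mult.assoc)
  finally show ?thesis .
qed

end

section \<open>The dual functionals vanish on coboundaries\<close>

context transversal_complex
begin

lemma coef_diff:
  assumes F: "face F" and Fq: "F \<in> cech_faces fs (Suc q)" and c: "c \<in> carrier (CC q)"
  shows "coef F b (dd q c F) = (\<Sum>j\<in>F. cech_sign_const F j * coef (F - {j}) b (c (F - {j})))"
proof -
  note Fs = face_subset[OF F]
  interpret L: module S "LF F" by (rule module_LF_vs[OF Fs])
  have "coef F b (cech_sign F j \<odot>\<^bsub>LF F\<^esub> cech_map F j (c (F - {j}))) = cech_sign_const F j * coef (F - {j}) b (c (F - {j}))"
    if j: "j \<in> F" for j
  proof -
    have X: "c (F - {j}) \<in> carrier (LF (F - {j}))" by (rule CC_D[OF c faces_remove[OF Fq j]])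
    then have "cech_map F j (c (F - {j})) \<in> carrier (LF F)"
      using cech_map_closed[of F j] Fs j by simp
    then show ?thesis
      by (simp add: cech_sign_eq coef_smult[OF F] coef_cech_map[OF F j X])
  qed
  then show ?thesis
    unfolding cech_diff_eq[OF c Fq]
    by (simp add: coef_finsum[OF F face_finite[OF F] diff_term_closed[OF c Fq]])
qed

text \<open>The vertex of the facet \<open>F\<close> in the class \<open>i\<close>.\<close>

definition vertex_of :: "nat set \<Rightarrow> nat \<Rightarrow> nat" where "vertex_of F i = inv_into F color i"

lemma vertex_of_eq: "facet F \<Longrightarrow> j \<in> F \<Longrightarrow> vertex_of F (color j) = j"
  unfolding vertex_of_def by (rule inv_into_f_f) (auto simp: facet_def inj_color)

lemma vertex_of_mem: "facet F \<Longrightarrow> i \<in> {1..h} \<Longrightarrow> vertex_of F i \<in> F" "facet F \<Longrightarrow> i \<in> {1..h} \<Longrightarrow> color (vertex_of F i) = i"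
  unfolding vertex_of_def using facet_color[of F] by (metis inv_into_into) (metis f_inv_into_f facet_color)

lemma sum_facet: "facet F \<Longrightarrow> (\<Sum>j\<in>F. f j) = (\<Sum>i\<in>{1..h}. f (vertex_of F i))"
proof -
  assume F: "facet F"
  then have "bij_betw color F {1..h}"
    using inj_color facet_color[OF F] by (simp add: bij_betw_def facet_def)
  then have "bij_betw (vertex_of F) {1..h} F"
    unfolding vertex_of_def[abs_def] by (rule bij_betw_inv_into)
  then show ?thesis by (rule sum.reindex_bij_betw[symmetric])
qed

text \<open>Removing the vertex of class \<open>i\<close> from \<open>switch B D\<close> and from \<open>switch B (insert i D)\<close> yields the same
  face, and the two terms have opposite signs.\<close>

lemma dual_diff_pair:
  fixes f :: "nat set \<Rightarrow> 'k" and k :: nat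
  assumes B: "facet B" and D: "D \<subseteq> {1..h}" and i: "i \<in> {1..h}" "i \<notin> D"
  defines "t \<equiv> \<lambda>D. (-1) ^ (card D + inversions color (switch B D) + k) *
    (cech_sign_const (switch B D) (vertex_of (switch B D) i) * f (switch B D - {vertex_of (switch B D) i}))"
  shows "t D + t (insert i D) = 0"
proof -
  let ?F = "switch B D" and ?F' = "switch B (insert i D)"
  have F: "facet ?F" by (rule switch_facet[OF B D])
  have F': "facet ?F'" using D i by (intro switch_facet[OF B]) blast
  define j where "j = vertex_of ?F i"
  define E where "E = ?F - {j}"
  have j: "j \<in> ?F" "color j = i" using vertex_of_mem[OF F i(1)] by (simp_all add: j_def)
  have E_eq: "{j \<in> ?F. color j \<noteq> i} = E"
    using j F by (auto simp: E_def j_def vertex_of_eq)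
  have F'_eq: "?F' = insert (apex i) E"
    using D i by (subst switch_insert) (auto simp: E_eq)
  have cE: "i \<notin> color ` E" by (auto simp: E_eq[symmetric])
  have finE: "finite E" using F face_finite by (auto simp: E_def facet_def)
  have ci: "color (apex i) = i" by (rule color_apex[OF i(1)])
  then have y: "apex i \<notin> E" using cE by (metis imageI)
  have vx': "vertex_of ?F' i = apex i" using vertex_of_eq[OF F', of "apex i"] ci by (simp add: F'_eq)
  have F_eq: "?F = insert j E" using j by (auto simp: E_def)
  have jE: "j \<notin> E" by (simp add: E_def)
  have s1: "(-1 :: 'k) ^ (inversions color ?F + card {k \<in> ?F. k < j}) =
      (-1) ^ (inversions color E + card {u \<in> E. color u < i})"
    unfolding F_eq using sign_insert[OF finE jE, of color] cE by (simp add: j)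
  have s2: "(-1 :: 'k) ^ (inversions color ?F' + card {k \<in> ?F'. k < apex i}) =
      (-1) ^ (inversions color E + card {u \<in> E. color u < i})"
    unfolding F'_eq using sign_insert[OF finE y, of color] cE by (simp add: ci)
  have cd: "card (insert i D) = Suc (card D)"
    using i D finite_subset[of D "{1..h}"] by simp
  have "?F' - {apex i} = E" using y by (simp add: F'_eq)
  then have "t (insert i D) = (-1) ^ (Suc (card D) + k) *
      ((-1) ^ (inversions color ?F' + card {k \<in> ?F'. k < apex i}) * f E)"
    by (simp add: t_def vx' cd cech_sign_const_def power_add)
  moreover have "t D = (-1) ^ (card D + k) * ((-1) ^ (inversions color ?F + card {k \<in> ?F. k < j}) * f E)"
    by (simp add: t_def j_def[symmetric] E_def[symmetric] cech_sign_const_def power_add)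
  ultimately show ?thesis
    unfolding s1 s2 by simp
qed

text \<open>The vertices of a facet are indexed by their classes, and the sum is rearranged by class. For a class that
  can be switched the terms cancel in pairs. Otherwise the vertex of the class is an apex in the support
  of \<open>b\<close>, and fractions over a face without this vertex have no term \<open>x\<^sup>-\<^sup>b\<close>.\<close>

lemma dual_diff:
  assumes B: "facet B" and h: "h = Suc q" and c: "c \<in> carrier (CC q)"
    and b: "\<And>i. i \<in> {1..h} \<Longrightarrow> apex i \<in> B \<Longrightarrow> apex i \<in> supp b"
  shows "dual B b (dd q c) = 0"
proof -
  define f where "f E = coef E b (c E)" for E
  define t where "t i D = (-1) ^ (card D + inversions color (switch B D) + inversions color B) *
    (cech_sign_const (switch B D) (vertex_of (switch B D) i) * f (switch B D - {vertex_of (switch B D) i}))" for i D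
  have swF: "facet (switch B D)" if "D \<in> Pow (switchable B)" for D
    using that switchable_subset by (intro switch_facet[OF B]) blast
  have "dual B b (dd q c) = (\<Sum>D\<in>Pow (switchable B). \<Sum>i\<in>{1..h}. t i D)"
    unfolding dual_def
  proof (rule sum.cong[OF refl])
    fix D assume D: "D \<in> Pow (switchable B)"
    note F = swF[OF D]
    have "face (switch B D)" using F by (simp add: facet_def)
    moreover have "switch B D \<in> cech_faces fs (Suc q)"
      using facet_cech_face[OF F] by (simp only: h)
    ultimately have "coef (switch B D) b (dd q c (switch B D)) = (\<Sum>i\<in>{1..h}. cech_sign_const (switch B D) (vertex_of (switch B D) i) *
        f (switch B D - {vertex_of (switch B D) i}))"
      by (simp only: coef_diff[OF _ _ c] sum_facet[OF F] f_def)
    then show "(-1) ^ (card D + inversions color (switch B D) + inversions color B) * coef (switch B D) b (dd q c (switch B D)) =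
        (\<Sum>i\<in>{1..h}. t i D)"
      by (simp only: t_def sum_distrib_left)
  qed
  also have "\<dots> = (\<Sum>i\<in>{1..h}. \<Sum>D\<in>Pow (switchable B). t i D)" by (rule sum.swap)
  also have "\<dots> = 0"
  proof (rule sum.neutral, rule ballI)
    fix i assume i: "i \<in> {1..h}"
    show "(\<Sum>D\<in>Pow (switchable B). t i D) = 0"
    proof (cases "i \<in> switchable B")
      case True
      have "(\<Sum>D\<in>Pow (switchable B). t i D) = (\<Sum>D\<in>Pow (switchable B - {i}). t i D + t i (insert i D))"
        by (rule sum_Pow_insert_pair[OF finite_switchable True])
      also have "\<dots> = 0"
        unfolding t_def using switchable_subset by (intro sum.neutral ballI dual_diff_pair[OF B _ i]) blast+
      finally show ?thesis .
    next
      case False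
      then have y: "apex i \<in> B" using i by (simp add: switchable_def)
      show ?thesis
      proof (rule sum.neutral, rule ballI)
        fix D assume D: "D \<in> Pow (switchable B)"
        note F = swF[OF D]
        have yF: "apex i \<in> switch B D" using y D False color_apex[OF i] by (auto simp: switch_def)
        have v: "vertex_of (switch B D) i = apex i" using vertex_of_eq[OF F yF] color_apex[OF i] by simp
        have E: "face (switch B D - {apex i})" using F face_mono by (auto simp: facet_def)
        have "switch B D - {apex i} \<in> cech_faces fs q"
          using facet_cech_face[OF F] by (intro faces_remove[OF _ yF]) (simp add: h)
        then have "f (switch B D - {apex i}) = 0"
          unfolding f_def using b[OF i y] by (intro coef_eq_zero E CC_D[OF c]) auto
        then show "t i D = 0" by (simp add: t_def v)
      qed
    qed
  qed
  finally show ?thesis .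
qed

abbreviation bnd where "bnd \<equiv> cech_coboundaries S A fs h"

lemma dual_coboundary:
  assumes "z \<in> bnd" and Bb: "(B, b) \<in> basis_index l"
  shows "dual B b z = 0"
proof -
  have B: "facet B" and b: "\<And>i. i \<in> {1..h} \<Longrightarrow> apex i \<in> B \<Longrightarrow> apex i \<in> supp b"
    using Bb by (auto simp: basis_index_def)
  show ?thesis
  proof (cases h)
    case 0
    then have z: "z = \<zero>\<^bsub>CC h\<^esub>" using assms by (simp add: cech_coboundaries_def)
    have "coef (switch B D) b (z (switch B D)) = 0" if "D \<in> Pow (switchable B)" for D
    proof -
      have F: "facet (switch B D)" using that switchable_subset by (intro switch_facet[OF B]) blast
      then show ?thesis using facet_cech_face[OF F] by (simp add: z CC_simps coef_zero facet_def)
    qed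
    then show ?thesis by (simp add: dual_def)
  next
    case (Suc q)
    then show ?thesis using assms(1) dual_diff[OF B Suc _ b] by (auto simp: cech_coboundaries_def)
  qed
qed

section \<open>The basis cochains span modulo coboundaries\<close>

text \<open>The cochains that are cohomologous to a combination of the basis cochains of degree \<open>l\<close>.\<close>

definition spanned :: "int \<Rightarrow> (nat set \<Rightarrow> (('v, 'k) mpoly set \<times> nat) set) set" where
  "spanned l = {c. \<exists>g. \<exists>n\<in>bnd. c = basis_cochain l g \<oplus>\<^bsub>CC h\<^esub> n}"

lemma bnd_carrier: "bnd \<subseteq> carrier (CC h)"
  by (rule additive_subgroup.a_subset[OF coboundaries_subgroup])

lemma spanned_carrier: "c \<in> spanned l \<Longrightarrow> c \<in> carrier (CC h)"
proof -
  interpret C: module S "CC h" by (rule module_CC)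
  show "c \<in> spanned l \<Longrightarrow> c \<in> carrier (CC h)"
    using bnd_carrier basis_cochain_closed by (auto simp: spanned_def)
qed

lemma spanned_add: assumes "c \<in> spanned l" "d \<in> spanned l" shows "c \<oplus>\<^bsub>CC h\<^esub> d \<in> spanned l"
proof -
  interpret C: module S "CC h" by (rule module_CC)
  interpret N: additive_subgroup bnd "CC h" by (rule coboundaries_subgroup)
  obtain g n g' n' where c: "c = basis_cochain l g \<oplus>\<^bsub>CC h\<^esub> n" "n \<in> bnd" and d: "d = basis_cochain l g' \<oplus>\<^bsub>CC h\<^esub> n'" "n' \<in> bnd"
    using assms by (auto simp: spanned_def)
  have nC: "n \<in> carrier (CC h)" "n' \<in> carrier (CC h)" using c d bnd_carrier by auto
  have "c \<oplus>\<^bsub>CC h\<^esub> d = basis_cochain l (\<lambda>t. g t + g' t) \<oplus>\<^bsub>CC h\<^esub> (n \<oplus>\<^bsub>CC h\<^esub> n')"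
    unfolding c d basis_cochain_add using nC basis_cochain_closed by (simp only: C.M.a_ac C.M.a_closed)
  then show ?thesis using c d unfolding spanned_def by blast
qed

lemma spanned_smult: assumes "c \<in> spanned l" shows "pconst a \<odot>\<^bsub>CC h\<^esub> c \<in> spanned l"
proof -
  interpret C: module S "CC h" by (rule module_CC)
  obtain g n where c: "c = basis_cochain l g \<oplus>\<^bsub>CC h\<^esub> n" "n \<in> bnd"
    using assms by (auto simp: spanned_def)
  have nC: "n \<in> carrier (CC h)" using c bnd_carrier by auto
  have "pconst a \<odot>\<^bsub>CC h\<^esub> c = basis_cochain l (\<lambda>t. a * g t) \<oplus>\<^bsub>CC h\<^esub> (pconst a \<odot>\<^bsub>CC h\<^esub> n)"
    unfolding c basis_cochain_smult using nC basis_cochain_closed by (simp add: C.smult_r_distr pconst_closed)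
  then show ?thesis using coboundaries_smult[OF pconst_closed c(2)] unfolding spanned_def by blast
qed

lemma pconst_zero: "pconst 0 = \<zero>\<^bsub>S\<^esub>"
  by (simp add: pconst_def poly_ring_simps)

lemma pconst_one: "pconst 1 = \<one>\<^bsub>S\<^esub>"
  by (simp add: pconst_def poly_ring_simps)

lemma basis_cochain_zero: "basis_cochain l (\<lambda>t. 0) = \<zero>\<^bsub>CC h\<^esub>"
proof -
  interpret C: module S "CC h" by (rule module_CC)
  show ?thesis using basis_cochain_smult[of l 0 "\<lambda>t. 0"] basis_cochain_closed by (simp add: pconst_zero C.smult_l_null)
qed

lemma bnd_spanned: "n \<in> bnd \<Longrightarrow> n \<in> spanned l"
proof -
  interpret C: module S "CC h" by (rule module_CC)
  assume n: "n \<in> bnd"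
  then have "n = basis_cochain l (\<lambda>t. 0) \<oplus>\<^bsub>CC h\<^esub> n" using bnd_carrier by (simp add: basis_cochain_zero subset_eq)
  then show ?thesis using n unfolding spanned_def by blast
qed

lemma basis_cochain_spanned: "basis_cochain l g \<in> spanned l"
proof -
  interpret C: module S "CC h" by (rule module_CC)
  interpret N: additive_subgroup bnd "CC h" by (rule coboundaries_subgroup)
  have "basis_cochain l g = basis_cochain l g \<oplus>\<^bsub>CC h\<^esub> \<zero>\<^bsub>CC h\<^esub>" using basis_cochain_closed by simp
  then show ?thesis using N.zero_closed unfolding spanned_def by blast
qed

lemma zero_spanned: "\<zero>\<^bsub>CC h\<^esub> \<in> spanned l"
  using basis_cochain_spanned[of l "\<lambda>t. 0"] by (simp add: basis_cochain_zero)

lemma unit_cochain_zero: "unit_cochain p F \<zero>\<^bsub>LF F\<^esub> = \<zero>\<^bsub>CC p\<^esub>"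
  unfolding unit_cochain_def CC_simps by (rule restrict_ext) simp

lemma LF_add_zero:
  assumes "F \<in> cech_faces fs p" "X \<in> carrier (LF F)"
  shows "\<zero>\<^bsub>LF F\<^esub> \<oplus>\<^bsub>LF F\<^esub> X = X" "X \<oplus>\<^bsub>LF F\<^esub> \<zero>\<^bsub>LF F\<^esub> = X"
proof -
  interpret L: module S "LF F" by (rule module_LF[OF faces_subset[OF assms(1)]])
  show "\<zero>\<^bsub>LF F\<^esub> \<oplus>\<^bsub>LF F\<^esub> X = X" "X \<oplus>\<^bsub>LF F\<^esub> \<zero>\<^bsub>LF F\<^esub> = X"
    using assms(2) by simp_all
qed

lemma unit_cochain_add:
  assumes "F \<in> cech_faces fs p" "X \<in> carrier (LF F)" "Y \<in> carrier (LF F)"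
  shows "unit_cochain p F (X \<oplus>\<^bsub>LF F\<^esub> Y) = unit_cochain p F X \<oplus>\<^bsub>CC p\<^esub> unit_cochain p F Y"
  using LF_add_zero LF_zero_closed by (auto simp: unit_cochain_def CC_simps fun_eq_iff)

lemma finite_cech_faces: "finite (cech_faces fs p)"
  by (rule finite_subset[of _ "Pow {..<length fs}"]) (auto simp: cech_faces_def)

lemma spanned_restrict:
  assumes c: "c \<in> carrier (CC h)" and "K \<subseteq> cech_faces fs h"
    and "\<And>F. F \<in> K \<Longrightarrow> unit_cochain h F (c F) \<in> spanned l"
  shows "(\<lambda>F\<in>cech_faces fs h. if F \<in> K then c F else \<zero>\<^bsub>LF F\<^esub>) \<in> spanned l"
proof -
  have "finite K" using assms(2) finite_cech_faces finite_subset by blast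
  then show ?thesis using assms(2,3)
  proof (induct K)
    case empty
    then show ?case using zero_spanned by (simp add: CC_simps restrict_def)
  next
    case (insert F K)
    let ?c = "\<lambda>K. (\<lambda>F\<in>cech_faces fs h. if F \<in> K then c F else \<zero>\<^bsub>LF F\<^esub>)"
    have "?c (insert F K) = unit_cochain h F (c F) \<oplus>\<^bsub>CC h\<^esub> ?c K"
      using insert.hyps(2) CC_D[OF c] LF_zero_closed LF_add_zero
      by (auto simp: unit_cochain_def CC_simps fun_eq_iff)
    moreover have "?c K \<in> spanned l" using insert by (intro insert.hyps(3)) auto
    moreover have "unit_cochain h F (c F) \<in> spanned l" using insert.prems by blast
    ultimately show ?case using spanned_add by simp
  qed
qed

text \<open>If a spanned cochain has spanned components at all other faces, then its component at \<open>F\<close> is spanned.\<close>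

lemma spanned_component:
  assumes d: "d \<in> spanned l" and F: "F \<in> cech_faces fs h"
    and other: "\<And>F'. F' \<in> cech_faces fs h \<Longrightarrow> F' \<noteq> F \<Longrightarrow> unit_cochain h F' (d F') \<in> spanned l"
  shows "unit_cochain h F (d F) \<in> spanned l"
proof -
  interpret C: module S "CC h" by (rule module_CC)
  note dC = spanned_carrier[OF d]
  let ?e = "\<lambda>F'\<in>cech_faces fs h. if F' \<in> cech_faces fs h - {F} then d F' else \<zero>\<^bsub>LF F'\<^esub>"
  let ?u = "unit_cochain h F (d F)"
  have e: "?e \<in> spanned l" by (rule spanned_restrict[OF dC]) (use other in auto)
  have eC: "?e \<in> carrier (CC h)" by (rule spanned_carrier[OF e])
  have uC: "?u \<in> carrier (CC h)" by (rule unit_cochain_closed[OF F CC_D[OF dC F]])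
  have "d = ?u \<oplus>\<^bsub>CC h\<^esub> ?e"
  proof (rule CC_eqI[OF dC])
    show "?u \<oplus>\<^bsub>CC h\<^esub> ?e \<in> carrier (CC h)" using uC eC by (rule C.M.a_closed)
    fix F' assume F': "F' \<in> cech_faces fs h"
    show "d F' = (?u \<oplus>\<^bsub>CC h\<^esub> ?e) F'"
      using F' CC_D[OF dC F'] LF_add_zero[OF F'] by (auto simp: CC_simps unit_cochain_def)
  qed
  then have "?u = d \<ominus>\<^bsub>CC h\<^esub> ?e"
    using uC eC C.M.add.inv_solve_right'[of ?u d ?e] dC by (simp add: a_minus_def a_inv_def)
  also have "\<ominus>\<^bsub>CC h\<^esub> ?e = pconst (- 1) \<odot>\<^bsub>CC h\<^esub> ?e"
  proof -
    have "pconst (- 1) = \<ominus>\<^bsub>S\<^esub> \<one>\<^bsub>S\<^esub>"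
      using poly_ring_uminus[of "1 :: ('v, 'k) mpoly" "set vs"] by (simp add: pconst_def poly_ring_simps single_uminus)
    then show ?thesis using C.smult_l_minus[OF pconst_closed[of 1] eC] C.smult_one[OF eC] by (simp only: pconst_one)
  qed
  then have "d \<ominus>\<^bsub>CC h\<^esub> ?e = d \<oplus>\<^bsub>CC h\<^esub> pconst (- 1) \<odot>\<^bsub>CC h\<^esub> ?e" by (simp only: a_minus_def)
  also have "\<dots> \<in> spanned l" by (intro spanned_add d spanned_smult e)
  finally show ?thesis .
qed

text \<open>Such a fraction is zero.\<close>

lemma unit_lfrac_nonface_spanned:
  assumes F: "F \<in> cech_faces fs h" and p: "p \<in> carrier S"
    and "\<And>u. u \<in> keys p \<Longrightarrow> \<not> face (supp u \<union> F)"
  shows "unit_cochain h F (lfrac F p n) \<in> spanned l"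
  using lfrac_eq_zero[OF cech_face_subset[OF F] p] assms(3) zero_spanned by (simp add: unit_cochain_zero)

text \<open>The fraction \<open>a x\<^sup>u / x\<^sub>F\<^sup>n\<close> is the image of a fraction over \<open>E = F - {j}\<close> if the exponent of \<open>x\<^sub>j\<close> in \<open>x\<^sup>u\<close>
  is at least \<open>n\<close>. Modulo the coboundary of the latter it is replaced by the corresponding fractions
  over the faces \<open>E \<union> {w}\<close>.\<close>

lemma spanned_by_replacement:
  assumes F: "facet F" and j: "j \<in> F" and u: "keys u \<subseteq> set vs" and le: "n \<le> lookup u (vs ! j)"
    and other: "\<And>w a. w < length vs \<Longrightarrow> w \<notin> F \<Longrightarrow> insert w (F - {j}) \<in> cech_faces fs h \<Longrightarrow>
      unit_cochain h (insert w (F - {j})) (lfrac (insert w (F - {j}))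
        (single (u - single (vs ! j) n + single (vs ! w) n) a) n) \<in> spanned l"
  shows "unit_cochain h F (lfrac F (single u a) n) \<in> spanned l"
proof -
  define u' where "u' = u - single (vs ! j) n"
  define E where "E = F - {j}"
  note Fc = facet_cech_face[OF F]
  note Fs = facet_subset[OF F]
  have u'_add: "u' + single (vs ! j) n = u"
    using le by (intro poly_mapping_eqI) (auto simp: u'_def lookup_add lookup_minus lookup_single when_def)
  then have u': "keys u' \<subseteq> set vs" using u keys_add_nat[of u' "single (vs ! j) n"] by auto
  have "finite F" using F by (simp add: facet_def face_finite)
  then have "card F \<noteq> 0" using j by auto
  then obtain q where q: "h = Suc q" using F by (metis facet_def not0_implies_Suc)
  have E: "E \<in> cech_faces fs q" unfolding E_def using Fc j by (intro faces_remove) (simp_all add: q)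
  note Es = cech_face_subset[OF E]
  define X where "X = lfrac E (single u' (cech_sign_const F j * a)) n"
  have X: "X \<in> carrier (LF E)"
    unfolding X_def by (intro lfrac_closed Es poly_ring_closed_single u')
  define d where "d = dd q (unit_cochain q E X)"
  have d: "d \<in> spanned l"
    using unit_cochain_closed[OF E X] by (intro bnd_spanned) (auto simp: d_def cech_coboundaries_def q)
  have dF': "d F' = lfrac F' (single (u' + single (vs ! w) n) (cech_sign_const F' w * (cech_sign_const F j * a))) n"
    if F': "F' \<in> cech_faces fs h" and w: "w \<in> F'" "F' - {w} = E" for F' w
  proof -
    note F's = cech_face_subset[OF F']
    have wl: "w < length vs" using F's w by auto
    have "d F' = cech_sign F' w \<odot>\<^bsub>LF F'\<^esub> cech_map F' w X"
      unfolding d_def using F' by (intro diff_unit_cochain(1)[OF E X _ w]) (simp add: q)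
    also have "cech_map F' w X = lfrac F' (single (u' + single (vs ! w) n) (cech_sign_const F j * a)) n"
      using cech_map_lfrac[OF F's w(1) poly_ring_closed_single[OF u'], of "cech_sign_const F j * a" n]
      by (simp add: X_def w(2) mult_single add.commute)
    also have "cech_sign F' w \<odot>\<^bsub>LF F'\<^esub> \<dots> =
        lfrac F' (single (u' + single (vs ! w) n) (cech_sign_const F' w * (cech_sign_const F j * a))) n"
      using u' wl by (simp add: cech_sign_eq lfrac_smult[OF F's] pconst_closed poly_ring_closed_single
          keys_add_nat pconst_mult_single)
    finally show ?thesis .
  qed
  have "unit_cochain h F (d F) \<in> spanned l"
  proof (rule spanned_component[OF d Fc])
    fix F' assume F': "F' \<in> cech_faces fs h" "F' \<noteq> F"
    show "unit_cochain h F' (d F') \<in> spanned l"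
    proof (cases "\<exists>w\<in>F'. F' - {w} = E")
      case True
      then obtain w where w: "w \<in> F'" "F' - {w} = E" by blast
      have F'_eq: "F' = insert w (F - {j})" using w by (auto simp: E_def)
      have wF: "w \<notin> F" using F'(2) w j by (auto simp: E_def)
      have wl: "w < length vs" using cech_face_subset[OF F'(1)] w by auto
      have "insert w (F - {j}) \<in> cech_faces fs h" using F'(1) F'_eq by simp
      then show ?thesis
        unfolding dF'[OF F'(1) w] u'_def unfolding F'_eq by (rule other[OF wl wF])
    next
      case False
      then have "d F' = \<zero>\<^bsub>LF F'\<^esub>"
        unfolding d_def using F' by (intro diff_unit_cochain(2)[OF E X]) (auto simp: q)
      then show ?thesis by (simp add: unit_cochain_zero zero_spanned)
    qed
  qed
  moreover have "d F = lfrac F (single u a) n"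
    using dF'[OF Fc j] by (simp add: E_def u'_add cech_sign_const_square)
  ultimately show ?thesis by simp
qed

text \<open>Induction on the number of apexes in \<open>F\<close> that have exponent zero in \<open>x\<^sup>u / x\<^sub>F\<^sup>n\<close>.\<close>

lemma monomial_spanned:
  assumes "F \<in> cech_faces fs h" "keys u \<subseteq> set vs" "int (mon_degree u) = l + int n * int h"
  shows "unit_cochain h F (lfrac F (single u a) n) \<in> spanned l"
  using assms
proof (induct "card {i \<in> {1..h}. apex i \<in> F \<and> lookup u (vs ! apex i) = n}" arbitrary: F u a rule: less_induct)
  case less
  note Fc = less.prems(1) and u = less.prems(2) and deg = less.prems(3)
  note Fs = cech_face_subset[OF Fc]
  have us: "single u a \<in> carrier S" for a by (rule poly_ring_closed_single[OF u])
  show ?case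
  proof (cases "face (supp u \<union> F)")
    case False
    then show ?thesis by (intro unit_lfrac_nonface_spanned Fc us) (simp split: if_splits)
  next
    case True
    then have fF: "face F" by (rule face_mono) blast
    then have F: "facet F" using Fc by (simp add: facet_def cech_faces_def)
    have suF: "supp u \<subseteq> F" using facet_insert_nonface[OF F, of _ "supp u \<union> F"] True by blast
    consider (a) j where "j \<in> F" "n < lookup u (vs ! j)"
      | (b) i where "i \<in> {1..h}" "apex i \<in> F" "lookup u (vs ! apex i) = n"
      | (c) "\<And>j. j \<in> F \<Longrightarrow> lookup u (vs ! j) \<le> n"
          "\<And>i. i \<in> {1..h} \<Longrightarrow> apex i \<in> F \<Longrightarrow> lookup u (vs ! apex i) < n"
      by (metis linorder_not_less nless_le)
    then show ?thesis
    proof cases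
      case a
      \<comment> \<open>The exponent of \<open>x\<^sub>j\<close> is positive. All replacements vanish, because \<open>j\<close> remains in the
        support and \<open>F \<union> {w}\<close> is not a face.\<close>
      have jl: "j < length vs" using a Fs by auto
      show ?thesis
      proof (rule spanned_by_replacement[OF F a(1) u])
        fix w a'
        assume w: "w < length vs" "w \<notin> F" and F': "insert w (F - {j}) \<in> cech_faces fs h"
        let ?u = "u - single (vs ! j) n + single (vs ! w) n"
        have "keys ?u \<subseteq> set vs"
          using u w by (auto simp: keys_add_nat in_keys_iff lookup_minus split: if_splits)
        moreover have "j \<in> supp ?u"
          using a(2) jl by (simp add: supp_def lookup_add lookup_minus)
        then have "\<not> face (supp ?u \<union> insert w (F - {j}))"
          using w by (intro facet_insert_nonface[OF F w(2)]) auto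
        ultimately show "unit_cochain h (insert w (F - {j}))
            (lfrac (insert w (F - {j})) (single ?u a') n) \<in> spanned l"
          by (intro unit_lfrac_nonface_spanned F' poly_ring_closed_single) (auto split: if_splits)
      qed (use a in simp)
    next
      case b
      \<comment> \<open>The apex of class \<open>i\<close> has exponent zero. A replacement that does not vanish puts another
        vertex of class \<open>i\<close> in its place, and the induction hypothesis applies.\<close>
      let ?j = "apex i"
      have jl: "?j < length vs" using b Fs by auto
      show ?thesis
      proof (rule spanned_by_replacement[OF F b(2) u])
        fix w a'
        assume w: "w < length vs" "w \<notin> F" and F': "insert w (F - {?j}) \<in> cech_faces fs h"
        let ?F = "insert w (F - {?j})"
        let ?u = "u - single (vs ! ?j) n + single (vs ! w) n"
        have wj: "w \<noteq> ?j" using w b by auto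
        have ku: "keys ?u \<subseteq> set vs"
          using u w by (auto simp: keys_add_nat in_keys_iff lookup_minus split: if_splits)
        show "unit_cochain h ?F (lfrac ?F (single ?u a') n) \<in> spanned l"
        proof (cases "face ?F")
          case False
          then show ?thesis
            using face_mono by (intro unit_lfrac_nonface_spanned F' poly_ring_closed_single ku) blast
        next
          case True
          have cw: "color w = i"
          proof (rule ccontr)
            assume ne: "color w \<noteq> i"
            obtain k where k: "k \<in> F" "color k = color w"
              using facet_color[OF F] color_range[OF w(1)] by (metis imageE)
            then have "k \<noteq> ?j" using ne color_apex[OF b(1)] by auto
            then have "k = w" using inj_onD[OF inj_color[OF True] k(2)] k by auto
            then show False using k w by auto
          qed
          have look: "lookup ?u (vs ! k) = lookup u (vs ! k)" if "k \<in> F" "k \<noteq> ?j" for k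
          proof -
            have "k < length vs" "k \<noteq> w" using that Fs w by auto
            then show ?thesis using that jl w(1) distinct_vs
              by (simp add: lookup_add lookup_minus lookup_single when_def nth_eq_iff_index_eq)
          qed
          have sub: "{i \<in> {1..h}. apex i \<in> ?F \<and> lookup ?u (vs ! apex i) = n}
              \<subset> {i \<in> {1..h}. apex i \<in> F \<and> lookup u (vs ! apex i) = n}" (is "?L \<subset> ?R")
          proof
            show "?L \<subseteq> ?R"
            proof
              fix i' assume i': "i' \<in> ?L"
              have "apex i' \<noteq> w"
              proof
                assume e: "apex i' = w"
                then have "i' = i" using color_apex[of i'] i' cw by auto
                then show False using e wj by simp
              qed
              then have "apex i' \<in> F" "apex i' \<noteq> ?j" using i' by auto
              then show "i' \<in> ?R" using i' look by simp
            qed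
            have "i \<in> ?R" "i \<notin> ?L" using b wj by auto
            then show "?L \<noteq> ?R" by blast
          qed
          have "u - single (vs ! ?j) n + single (vs ! ?j) n = u"
            using b(3) by (intro poly_mapping_eqI) (auto simp: lookup_add lookup_minus lookup_single when_def)
          then have "mon_degree ?u = mon_degree u"
            by (metis mon_degree_add mon_degree_single)
          then have dg: "int (mon_degree ?u) = l + int n * int h" using deg by simp
          show ?thesis
            by (rule less.hyps[OF psubset_card_mono[OF _ sub] F' ku dg]) simp
        qed
      qed (use b in simp)
    next
      case c
      \<comment> \<open>No exponent is positive and those of the apexes are negative: this is a basis element.\<close>
      define b where "b = powexp F n - u"
      have bu: "b + u = powexp F n"
      proof (rule poly_mapping_eqI)
        fix v
        have "lookup u v \<le> lookup (powexp F n) v"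
        proof (cases "v \<in> keys u")
          case True
          then obtain j where j: "j < length vs" "v = vs ! j" using u by (metis in_set_conv_nth subsetD)
          then have "j \<in> F" using True suF by (auto simp: supp_def in_keys_iff)
          then show ?thesis using c(1) j by (simp add: lookup_powexp_nth[OF Fs])
        qed (simp add: in_keys_iff)
        then show "lookup (b + u) v = lookup (powexp F n) v" by (simp add: b_def lookup_add lookup_minus)
      qed
      have bi: "(F, b) \<in> basis_index l"
        unfolding basis_index_def
      proof (safe)
        show "facet F" by (rule F)
        show "v \<in> set vs" if "v \<in> keys b" for v
          using that keys_add_nat[of b u] keys_powexp[OF Fs, of n] bu by auto
        show "k \<in> F" if "k \<in> supp b" for k
          using that supp_add[of b u] supp_powexp[OF Fs, of n] bu by (auto split: if_splits)
        show "apex i \<in> supp b" if "i \<in> {1..h}" "apex i \<in> F" for i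
          using c(2)[OF that] that Fs
          by (auto simp: supp_def b_def lookup_minus lookup_powexp_nth[OF Fs] subset_iff)
        have "mon_degree b + mon_degree u = n * h"
          using mon_degree_add[of b u] mon_degree_powexp[OF Fs, of n] F by (simp add: bu facet_def)
        then have "int (mon_degree b) + int (mon_degree u) = int n * int h"
          by (metis of_nat_add of_nat_mult)
        then show "int (mon_degree b) = - l" using deg by linarith
      qed
      let ?m = "nat (- l)"
      define g where "g = (\<lambda>t. if t = (F, b) then a else 0)"
      have numF: "basis_num l g F = single (powexp F ?m - b) a"
      proof -
        have "basis_num l g F = (\<Sum>b'\<in>{b. (F, b) \<in> basis_index l}. if b' = b then single (powexp F ?m - b) a else 0)"
          unfolding basis_num_def g_def by (rule sum.cong[OF refl]) simp
        then show ?thesis using bi finite_fiber by simp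
      qed
      have num0: "basis_num l g F' = 0" if "F' \<noteq> F" for F'
        unfolding basis_num_def g_def using that by simp
      have bm: "powexp F ?m - b + b = powexp F ?m" by (rule basis_index_le[OF bi])
      have "powexp F n + (powexp F ?m - b) = powexp F ?m + u"
        unfolding bu[symmetric] using bm by (metis add.assoc add.commute)
      then have "lfrac F (single (powexp F ?m - b) a) ?m = lfrac F (single u a) n"
        using lfrac_expand[OF Fs basis_num_closed[OF Fs, of l g], of n ?m] lfrac_expand[OF Fs us, of ?m a n]
        by (simp add: numF mult_single add.commute)
      then have "unit_cochain h F (lfrac F (single u a) n) = basis_cochain l g"
        unfolding basis_cochain_def unit_cochain_def
        by (intro restrict_ext) (auto simp: numF num0 lfrac_zero[OF cech_face_subset])
      then show ?thesis using basis_cochain_spanned by simp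
    qed
  qed
qed

lemma homogeneous_spanned:
  assumes F: "F \<in> cech_faces fs h" and p: "p \<in> poly_comp (set vs) (l + int n * int h)"
  shows "unit_cochain h F (lfrac F p n) \<in> spanned l"
proof -
  note Fs = cech_face_subset[OF F]
  let ?q = "\<lambda>K. \<Sum>u\<in>K. single u (lookup p u)"
  have ku: "keys u \<subseteq> set vs" "int (mon_degree u) = l + int n * int h" if "u \<in> keys p" for u
    using p that by (auto simp: poly_comp_def poly_ring_simps)
  have cl: "?q K \<in> carrier S" if "K \<subseteq> keys p" for K
    using that ku by (intro poly_ring_closed_sum poly_ring_closed_single) auto
  have "unit_cochain h F (lfrac F (?q K) n) \<in> spanned l" if "finite K" "K \<subseteq> keys p" for K
    using that
  proof (induct K)
    case empty
    then show ?case
      using lfrac_zero[OF Fs, of n] unit_cochain_zero[of h F] zero_spanned by simp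
  next
    case (insert u K)
    have "lfrac F (?q (insert u K)) n = lfrac F (single u (lookup p u)) n \<oplus>\<^bsub>LF F\<^esub> lfrac F (?q K) n"
      using insert cl ku by (simp add: lfrac_add[OF Fs] poly_ring_closed_single)
    moreover have "lfrac F (single u (lookup p u)) n \<in> carrier (LF F)" "lfrac F (?q K) n \<in> carrier (LF F)"
      using insert.prems cl ku by (auto intro!: lfrac_closed[OF Fs] poly_ring_closed_single)
    ultimately show ?case
      using insert ku by (simp add: unit_cochain_add[OF F] spanned_add monomial_spanned[OF F])
  qed
  from this[of "keys p"] show ?thesis
    using poly_mapping_sum_single[of p] by simp
qed

text \<open>The grading of the face ring.\<close>

abbreviation Ad :: "int \<Rightarrow> ('v, 'k) mpoly set set" where
  "Ad \<equiv> \<lambda>d. {cls q | q. q \<in> poly_comp (set vs) d}"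

lemma comp_spanned:
  assumes c: "c \<in> cech_comp S A Ad fs h l"
  shows "c \<in> spanned l"
proof -
  have cC: "c \<in> carrier (CC h)" using c by (simp add: cech_comp_def)
  have "unit_cochain h F (c F) \<in> spanned l" if F: "F \<in> cech_faces fs h" for F
  proof -
    have "c F \<in> loc_comp S A Ad (el F) (card F) l" using c F by (simp add: cech_comp_def)
    then obtain q n where q: "q \<in> poly_comp (set vs) (l + int n * int (card F))" "c F = lfrac F q n"
      by (auto simp: loc_comp_def lfrac_def)
    moreover have "card F = h" using F by (simp add: cech_faces_def)
    ultimately show ?thesis using homogeneous_spanned[OF F] by simp
  qed
  then have "(\<lambda>F\<in>cech_faces fs h. if F \<in> cech_faces fs h then c F else \<zero>\<^bsub>LF F\<^esub>) \<in> spanned l"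
    by (intro spanned_restrict cC) auto
  moreover have "(\<lambda>F\<in>cech_faces fs h. if F \<in> cech_faces fs h then c F else \<zero>\<^bsub>LF F\<^esub>) = c"
    using cC by (auto simp: CC_simps PiE_iff extensional_def fun_eq_iff)
  ultimately show ?thesis by simp
qed

lemma basis_num_homogeneous:
  assumes "F \<subseteq> {..<length vs}" "card F = h"
  shows "basis_num l g F \<in> poly_comp (set vs) (l + int (nat (- l)) * int h)"
proof -
  have "int (mon_degree u) = l + int (nat (- l)) * int h" if u: "u \<in> keys (basis_num l g F)" for u
  proof -
    have "u \<in> (\<Union>b\<in>{b. (F, b) \<in> basis_index l}. keys (single (powexp F (nat (- l)) - b) (g (F, b))))"
      using u keys_sum unfolding basis_num_def by fast
    then obtain b where b: "(F, b) \<in> basis_index l" "u = powexp F (nat (- l)) - b"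
      by (auto split: if_splits)
    have "mon_degree u + mon_degree b = nat (- l) * h"
      using mon_degree_add[of u b] basis_index_le[OF b(1)] mon_degree_powexp[OF assms(1)] assms(2)
      by (simp add: b(2))
    then have "int (mon_degree u) + int (mon_degree b) = int (nat (- l)) * int h"
      by (metis of_nat_add of_nat_mult)
    moreover have "int (mon_degree b) = - l" using b(1) by (simp add: basis_index_def)
    ultimately show ?thesis by linarith
  qed
  then show ?thesis using basis_num_closed[OF assms(1)] by (auto simp: poly_comp_def)
qed

lemma basis_cochain_comp: "basis_cochain l g \<in> cech_comp S A Ad fs h l"
proof -
  have "basis_cochain l g F \<in> loc_comp S A Ad (el F) (card F) l" if F: "F \<in> cech_faces fs h" for F
  proof -
    have cF: "card F = h" using F by (simp add: cech_faces_def)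
    have "basis_cochain l g F = loc_class S A (el F) (cls (basis_num l g F)) (nat (- l))"
      using F by (simp add: basis_cochain_def lfrac_def)
    moreover have "cls (basis_num l g F) \<in> Ad (l + int (nat (- l)) * int (card F))"
      unfolding cF using basis_num_homogeneous[OF cech_face_subset[OF F] cF] by blast
    ultimately show ?thesis unfolding loc_comp_def by blast
  qed
  then show ?thesis using basis_cochain_closed by (simp add: cech_comp_def)
qed

text \<open>There are no faces of cardinality greater than \<open>h\<close>, so the localizations in degree \<open>h + 1\<close> are zero.\<close>

lemma cocycles_top: "cech_cocycles S A fs h = carrier (CC h)"
proof -
  interpret C: module S "CC (Suc h)" by (rule module_CC)
  have "dd h c = \<zero>\<^bsub>CC (Suc h)\<^esub>" if c: "c \<in> carrier (CC h)" for c
  proof (rule CC_eqI[OF cech_diff_closed[OF c] C.M.zero_closed])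
    fix F assume F: "F \<in> cech_faces fs (Suc h)"
    note Fs = cech_face_subset[OF F]
    have nf: "\<not> face F" using face_card_le[of F] F by (auto simp: cech_faces_def)
    obtain p n where p: "p \<in> carrier S" "dd h c F = lfrac F p n"
      by (rule lfrac_cases[OF Fs CC_D[OF cech_diff_closed[OF c] F]])
    have "dd h c F = \<zero>\<^bsub>LF F\<^esub>"
      unfolding p(2) using nf face_mono by (intro lfrac_eq_zero[OF Fs p(1)]) blast
    then show "dd h c F = \<zero>\<^bsub>CC (Suc h)\<^esub> F" using F by (simp add: CC_simps)
  qed
  then show ?thesis by (auto simp: cech_cocycles_def)
qed

end

section \<open>The graded pieces of the top local cohomology\<close>

text \<open>A structure with a bijection from \<open>K\<^sup>n\<close> that respects the operations is a vector space of
  dimension \<open>n\<close>.\<close>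

lemma vectorspace_transport:
  fixes W :: "('k::field, 'm) module" and \<beta> :: "'k vec \<Rightarrow> 'm"
  assumes bij: "bij_betw \<beta> (carrier_vec n) (carrier W)"
    and add: "\<And>x y. x \<in> carrier_vec n \<Longrightarrow> y \<in> carrier_vec n \<Longrightarrow> \<beta> x \<oplus>\<^bsub>W\<^esub> \<beta> y = \<beta> (x + y)"
    and smult: "\<And>c x. x \<in> carrier_vec n \<Longrightarrow> c \<odot>\<^bsub>W\<^esub> \<beta> x = \<beta> (c \<cdot>\<^sub>v x)"
    and zero: "\<zero>\<^bsub>W\<^esub> = \<beta> (0\<^sub>v n)"
  shows "vectorspace class_ring W" "vectorspace.fin_dim class_ring W"
    "vectorspace.dim class_ring W = n"
proof -
  interpret V: vec_space "TYPE('k)" n .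
  have K: "field (class_ring :: 'k ring)" by (rule vectorspace.axioms(2)[OF V.vectorspace_axioms])
  have carrier: "carrier W = \<beta> ` carrier_vec n" and inj: "inj_on \<beta> (carrier_vec n)"
    using bij by (auto simp: bij_betw_def)
  have W: "module class_ring W"
  proof (rule moduleI)
    show "cring (class_ring :: 'k ring)" by (rule fieldE(1)[OF K])
    show "abelian_group W"
    proof (rule abelian_groupI)
      fix x assume "x \<in> carrier W"
      then obtain u where u: "u \<in> carrier_vec n" "x = \<beta> u" by (auto simp: carrier)
      show "\<exists>y\<in>carrier W. y \<oplus>\<^bsub>W\<^esub> x = \<zero>\<^bsub>W\<^esub>"
        using u by (auto simp: carrier add zero intro!: bexI[of _ "- u"])
    qed (auto simp: carrier add zero assoc_add_vec intro!: arg_cong[OF comm_add_vec, where f=\<beta>])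
  qed (auto simp: carrier add smult add_smult_distrib_vec smult_add_distrib_vec smult_smult_assoc)
  show vs: "vectorspace class_ring W" by (rule vectorspace.intro[OF W K])
  have lin: "linear_map class_ring (module_vec TYPE('k) n) W \<beta>"
    by (intro linear_map.intro mod_hom.intro mod_hom_axioms.intro vs W
        V.vectorspace_axioms V.module_axioms)
      (auto simp: module_hom_def carrier add smult module_vec_simps)
  have im: "\<beta> ` carrier (module_vec TYPE('k) n) = carrier W"
    by (simp add: carrier module_vec_simps)
  show "vectorspace.fin_dim class_ring W"
    by (rule linear_map.surj_fin_dim[OF lin V.fin_dim im])
  show "vectorspace.dim class_ring W = n"
    using linear_map.dim_eq[OF lin V.fin_dim _ im] inj V.dim_is_n by (simp add: module_vec_simps)
qed

lemma coeff_space_simps: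
  "carrier (coeff_space M W) = W" "zero (coeff_space M W) = zero M" "add (coeff_space M W) = add M"
  "c \<odot>\<^bsub>coeff_space M W\<^esub> x = pconst c \<odot>\<^bsub>M\<^esub> x"
  by (simp_all add: coeff_space_def)

context transversal_complex
begin

lemma basis_cochain_cong: "(\<And>t. t \<in> basis_index l \<Longrightarrow> g t = g' t) \<Longrightarrow> basis_cochain l g = basis_cochain l g'"
  unfolding basis_cochain_def basis_num_def by (intro restrict_ext arg_cong2[of _ _ _ _ "lfrac _"] sum.cong refl) simp

text \<open>The classes of the basis cochains identify the part of degree \<open>l\<close> with the space of functions on
  \<open>basis_index l\<close>.\<close>

theorem vectorspace_local_cohomology_comp:
  fixes l :: int
  defines "H \<equiv> coeff_space (local_cohomology S A fs h) (local_cohomology_comp S A Ad fs h l)"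
  shows "vectorspace class_ring H" "vectorspace.fin_dim class_ring H"
    "vectorspace.dim class_ring H = card (basis_index l)"
proof -
  interpret C: module S "CC h" by (rule module_CC)
  interpret N: abelian_subgroup bnd "CC h"
    by (rule abelian_subgroupI3[OF coboundaries_subgroup C.M.abelian_group_axioms])
  define n where "n = card (basis_index l)"
  obtain e where e: "bij_betw e {0..<n} (basis_index l)"
    using ex_bij_betw_nat_finite[OF finite_basis_index] unfolding n_def by blast
  define ix where "ix = inv_into {0..<n} e"
  have ix: "ix t < n" "e (ix t) = t" if "t \<in> basis_index l" for t
    using bij_betw_inv_into[OF e] bij_betw_inv_into_right[OF e that] that
    by (auto simp: ix_def bij_betw_def)
  have ixe: "ix (e i) = i" "e i \<in> basis_index l" if "i < n" for i
    using bij_betw_inv_into_left[OF e, of i] e that by (auto simp: ix_def bij_betw_def)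
  define G :: "'k vec \<Rightarrow> nat set \<times> ('v \<Rightarrow>\<^sub>0 nat) \<Rightarrow> 'k" where "G v t = v $ ix t" for v t
  define \<beta> where "\<beta> v = bnd +>\<^bsub>CC h\<^esub> basis_cochain l (G v)" for v
  have Hadd: "\<beta> x \<oplus>\<^bsub>H\<^esub> \<beta> y = \<beta> (x + y)" if "x \<in> carrier_vec n" "y \<in> carrier_vec n" for x y
  proof -
    have "basis_cochain l (G x) \<oplus>\<^bsub>CC h\<^esub> basis_cochain l (G y) = basis_cochain l (G (x + y))"
      unfolding basis_cochain_add[symmetric] by (rule basis_cochain_cong) (use that ix in \<open>simp add: G_def\<close>)
    then show ?thesis
      by (simp add: H_def \<beta>_def coeff_space_simps local_cohomology_simps N.a_rcos_sum basis_cochain_closed)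
  qed
  have Hsmult: "c \<odot>\<^bsub>H\<^esub> \<beta> x = \<beta> (c \<cdot>\<^sub>v x)" if "x \<in> carrier_vec n" for c x
  proof -
    have "pconst c \<odot>\<^bsub>CC h\<^esub> basis_cochain l (G x) = basis_cochain l (G (c \<cdot>\<^sub>v x))"
      unfolding basis_cochain_smult[symmetric] by (rule basis_cochain_cong) (use that ix in \<open>simp add: G_def\<close>)
    moreover have "c \<odot>\<^bsub>H\<^esub> \<beta> x = bnd +>\<^bsub>CC h\<^esub> (pconst c \<odot>\<^bsub>CC h\<^esub> basis_cochain l (G x))"
      unfolding H_def \<beta>_def coeff_space_simps local_cohomology_simps
      by (rule C.coset_smult[OF coboundaries_subgroup coboundaries_smult]) (auto simp: pconst_closed basis_cochain_closed)
    ultimately show ?thesis by (simp add: \<beta>_def)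
  qed
  have Hzero: "\<zero>\<^bsub>H\<^esub> = \<beta> (0\<^sub>v n)"
  proof -
    have "basis_cochain l (G (0\<^sub>v n)) = basis_cochain l (\<lambda>t. 0)" by (rule basis_cochain_cong) (use ix in \<open>simp add: G_def\<close>)
    then show ?thesis
      by (simp add: H_def \<beta>_def coeff_space_simps local_cohomology_simps basis_cochain_zero C.M.a_coset_add_zero N.a_subset)
  qed
  have inj: "inj_on \<beta> (carrier_vec n)"
  proof (rule inj_onI)
    fix x y assume x: "x \<in> carrier_vec n" and y: "y \<in> carrier_vec n" and eq: "\<beta> x = \<beta> y"
    have "basis_cochain l (G x) \<ominus>\<^bsub>CC h\<^esub> basis_cochain l (G y) \<in> bnd" (is "?z \<in> _")
      using eq C.M.coset_eq_iff[OF coboundaries_subgroup basis_cochain_closed basis_cochain_closed] by (simp add: \<beta>_def)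
    then have z: "?z \<in> bnd" and zC: "?z \<in> carrier (CC h)" using N.a_subset by auto
    have split: "basis_cochain l (G x) = ?z \<oplus>\<^bsub>CC h\<^esub> basis_cochain l (G y)"
      using basis_cochain_closed by (simp add: a_minus_def C.M.a_assoc C.M.l_neg)
    have eqG: "G x t = G y t" if t: "t \<in> basis_index l" for t
    proof -
      obtain B b where Bb: "t = (B, b)" by (cases t)
      have B: "facet B" using t Bb by (simp add: basis_index_def)
      have "dual B b (basis_cochain l (G x)) = dual B b ?z + dual B b (basis_cochain l (G y))"
        by (subst split) (rule dual_add[OF B zC basis_cochain_closed])
      then show ?thesis
        using dual_coboundary[OF z] dual_basis_cochain t unfolding Bb by simp
    qed
    have "x $ i = y $ i" if i: "i < n" for i
      using eqG[OF ixe(2)[OF i]] ixe(1)[OF i] by (simp add: G_def)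
    then show "x = y" using x y by (intro eq_vecI) auto
  qed
  have im: "\<beta> ` carrier_vec n = carrier H"
  proof (intro subset_antisym subsetI)
    fix X assume "X \<in> \<beta> ` carrier_vec n"
    then show "X \<in> carrier H"
      using basis_cochain_comp basis_cochain_closed
      by (auto simp: H_def \<beta>_def coeff_space_simps local_cohomology_comp_def cocycles_top)
  next
    fix X assume "X \<in> carrier H"
    then obtain z where z: "z \<in> cech_comp S A Ad fs h l" "X = bnd +>\<^bsub>CC h\<^esub> z"
      by (auto simp: H_def coeff_space_simps local_cohomology_comp_def)
    obtain g w where gw: "z = basis_cochain l g \<oplus>\<^bsub>CC h\<^esub> w" "w \<in> bnd"
      using comp_spanned[OF z(1)] by (auto simp: spanned_def)
    have wC: "w \<in> carrier (CC h)" using gw N.a_subset by auto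
    have zC: "z \<in> carrier (CC h)" using wC basis_cochain_closed by (simp add: gw)
    have "z \<ominus>\<^bsub>CC h\<^esub> basis_cochain l g = w"
      unfolding gw(1) using wC basis_cochain_closed
      by (simp add: a_minus_def C.M.a_comm[of "basis_cochain l g"] C.M.a_assoc C.M.r_neg)
    then have "X = bnd +>\<^bsub>CC h\<^esub> basis_cochain l g"
      using C.M.coset_eq_iff[OF coboundaries_subgroup zC basis_cochain_closed] gw(2) z(2) by simp
    also have "basis_cochain l g = basis_cochain l (G (vec n (\<lambda>i. g (e i))))"
      by (rule basis_cochain_cong) (simp add: G_def ix)
    finally show "X \<in> \<beta> ` carrier_vec n" by (auto simp: \<beta>_def)
  qed
  have bij: "bij_betw \<beta> (carrier_vec n) (carrier H)" using inj im by (simp add: bij_betw_def)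
  show "vectorspace class_ring H" "vectorspace.fin_dim class_ring H"
    "vectorspace.dim class_ring H = card (basis_index l)"
    using vectorspace_transport[OF bij Hadd Hsmult Hzero] by (simp_all add: n_def)
qed

end

section \<open>The Hilbert series\<close>

text \<open>The geometric series \<open>X + X\<^sup>2 + \<dots>\<close>, where \<open>X\<close> stands for \<open>t\<^sup>-\<^sup>1\<close>.\<close>

definition geom :: "rat fps" where "geom = Abs_fps (\<lambda>n. if n = 0 then 0 else 1)"

lemma geom_conv: "fls_X / (1 - fls_X) = fps_to_fls geom"
proof -
  have "geom * (1 - fps_X) = fps_X"
    by (rule fps_ext) (simp add: geom_def right_diff_distrib fps_X_nth)
  then have "fps_to_fls (geom * (1 - fps_X)) = fps_to_fls fps_X" by (simp only:)
  then have "fps_to_fls geom * (1 - fls_X) = fls_X"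
    by (simp add: fls_times_fps_to_fls)
  moreover have "(1 :: rat fls) - fls_X \<noteq> 0"
  proof
    assume "(1 :: rat fls) - fls_X = 0"
    then have "fls_nth ((1 :: rat fls) - fls_X) 0 = 0" by simp
    then show False by simp
  qed
  ultimately show ?thesis by (simp add: divide_eq_eq)
qed

text \<open>The exponent of each variable in the support contributes one geometric series.\<close>

lemma card_monomials_with_keys:
  assumes "finite U"
  shows "of_nat (card {b :: 'v \<Rightarrow>\<^sub>0 nat. keys b = U \<and> mon_degree b = n}) = fps_nth (geom ^ card U) n"
  using assms
proof (induct U arbitrary: n)
  case empty
  have "{b :: 'v \<Rightarrow>\<^sub>0 nat. keys b = {} \<and> mon_degree b = n} = (if n = 0 then {0} else {})"
    by (auto simp: mon_degree_def)
  then show ?case by simp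
next
  case (insert v U)
  let ?M = "\<lambda>U n. {b :: 'v \<Rightarrow>\<^sub>0 nat. keys b = U \<and> mon_degree b = n}"
  let ?f = "\<lambda>k b. b + single v k"
  have eq: "?M (insert v U) n = (\<Union>k\<in>{1..n}. ?f k ` ?M U (n - k))"
  proof (intro subset_antisym subsetI)
    fix b assume b: "b \<in> ?M (insert v U) n"
    define k where "k = lookup b v"
    define b' where "b' = b - single v k"
    have bb: "b = b' + single v k"
      by (rule poly_mapping_eqI) (simp add: b'_def k_def lookup_add lookup_minus lookup_single when_def)
    have "k \<noteq> 0" using b by (auto simp: k_def in_keys_iff)
    moreover have "lookup b' v = 0" by (simp add: b'_def k_def lookup_minus)
    then have "v \<notin> keys b'" by (simp add: in_keys_iff)
    then have "keys b' = U"
      using b insert.hyps(2) keys_add_nat[of b' "single v k"] \<open>k \<noteq> 0\<close> unfolding bb[symmetric] by auto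
    moreover have "mon_degree b' + k = n"
      using b mon_degree_add[of b' "single v k"] unfolding bb[symmetric] by (simp add: mon_degree_single)
    ultimately show "b \<in> (\<Union>k\<in>{1..n}. ?f k ` ?M U (n - k))"
      using bb by (intro UN_I[of k] image_eqI[of _ _ b']) auto
  next
    fix b assume "b \<in> (\<Union>k\<in>{1..n}. ?f k ` ?M U (n - k))"
    then show "b \<in> ?M (insert v U) n"
      by (auto simp: keys_add_nat mon_degree_add mon_degree_single split: if_splits)
  qed
  have disj: "?f k ` ?M U (n - k) \<inter> ?f k' ` ?M U (n - k') = {}" if "k \<noteq> k'" for k k'
  proof -
    have look: "lookup b v = k" if b: "b \<in> ?f k ` ?M U (n - k)" for b k
    proof -
      obtain b' where b': "b' \<in> ?M U (n - k)" "b = b' + single v k" using b by blast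
      then have "v \<notin> keys b'" using insert.hyps(2) by blast
      then show ?thesis by (simp add: b'(2) lookup_add in_keys_iff)
    qed
    show ?thesis
    proof (rule equals0I)
      fix b assume b: "b \<in> ?f k ` ?M U (n - k) \<inter> ?f k' ` ?M U (n - k')"
      have "k = k'" using look[OF IntD1[OF b]] look[OF IntD2[OF b]] by (rule trans[OF sym])
      then show False using \<open>k \<noteq> k'\<close> by simp
    qed
  qed
  have fin: "finite (?M U j)" for j
    by (rule finite_subset[OF _ finite_monomials[OF insert.hyps(1), of j]]) auto
  have "card (?M (insert v U) n) = (\<Sum>k\<in>{1..n}. card (?f k ` ?M U (n - k)))"
    unfolding eq by (rule card_UN_disjoint) (use fin disj in auto)
  also have "\<dots> = (\<Sum>k\<in>{1..n}. card (?M U (n - k)))"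
    by (intro sum.cong refl card_image) (auto simp: inj_on_def)
  finally have "of_nat (card (?M (insert v U) n)) = (\<Sum>k\<in>{1..n}. fps_nth (geom ^ card U) (n - k))"
    using insert.hyps(3) by simp
  also have "\<dots> = (\<Sum>k\<in>{0..n}. fps_nth geom k * fps_nth (geom ^ card U) (n - k))"
    by (rule sum.mono_neutral_cong_left) (auto simp: geom_def)
  also have "\<dots> = fps_nth (geom ^ card (insert v U)) n"
    using insert.hyps(1,2) by (simp add: fps_mult_nth)
  finally show ?case .
qed

lemma sum_Pow_card:
  assumes "finite M" "card M \<le> N"
  shows "(\<Sum>Z\<in>Pow M. f (card Z)) = (\<Sum>i\<le>N. of_nat (card M choose i) * (f i :: rat))"
proof -
  have "(\<Sum>Z\<in>Pow M. f (card Z)) = (\<Sum>i\<le>N. \<Sum>Z\<in>{Z \<in> Pow M. card Z = i}. f (card Z))"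
    using assms by (intro sum.group[symmetric]) (auto dest: card_mono)
  also have "\<dots> = (\<Sum>i\<le>N. of_nat (card M choose i) * f i)"
  proof (rule sum.cong[OF refl])
    fix i
    have "{Z \<in> Pow M. card Z = i} = {Z. Z \<subseteq> M \<and> card Z = i}" by auto
    then show "(\<Sum>Z\<in>{Z \<in> Pow M. card Z = i}. f (card Z)) = of_nat (card M choose i) * f i"
      using n_subsets[OF assms(1), of i] by simp
  qed
  finally show ?thesis .
qed

context transversal_complex
begin

lemma keys_eq_supp: "keys b \<subseteq> set vs \<Longrightarrow> keys b = (!) vs ` supp b"
  by (auto simp: supp_def in_keys_iff in_set_conv_nth image_iff) (metis in_keys_iff in_set_conv_nth neq0_conv subsetD)

lemma nth_image_inj: "X \<subseteq> {..<length vs} \<Longrightarrow> X' \<subseteq> {..<length vs} \<Longrightarrow> (!) vs ` X = (!) vs ` X' \<Longrightarrow> X = X'"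
  by (rule inj_on_image_eq_iff[THEN iffD1, of "(!) vs" "{..<length vs}"])
    (auto simp: inj_on_nth distinct_vs)

text \<open>The possible supports of \<open>b\<close> are the sets \<open>B - Z\<close>, where \<open>Z\<close> consists of vertices of \<open>B\<close> that are not
  apexes.\<close>

lemma card_basis_index_fiber:
  assumes B: "facet B" and N: "h \<le> N"
  shows "of_nat (card {b. (B, b) \<in> basis_index (- int n)}) =
    (\<Sum>i\<le>N. of_nat (card (B - apex ` {1..h}) choose i) * fps_nth (geom ^ (h - i)) n)"
proof -
  let ?M = "B - apex ` {1..h}"
  let ?T = "\<lambda>X. {b :: 'v \<Rightarrow>\<^sub>0 nat. keys b = (!) vs ` X \<and> mon_degree b = n}"
  note Bs = facet_subset[OF B]
  have finB: "finite B" and cardB: "card B = h" using B face_finite by (auto simp: facet_def)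
  have supp_T: "supp b = X" if "b \<in> ?T X" "X \<subseteq> B" for b X
  proof (rule nth_image_inj)
    show "X \<subseteq> {..<length vs}" using that Bs by blast
    show "supp b \<subseteq> {..<length vs}" by (auto simp: supp_def)
    have "keys b \<subseteq> set vs" using that Bs by auto
    then show "(!) vs ` supp b = (!) vs ` X" using keys_eq_supp[of b] that by simp
  qed
  have eq: "{b. (B, b) \<in> basis_index (- int n)} = (\<Union>Z\<in>Pow ?M. ?T (B - Z))"
  proof (intro subset_antisym subsetI)
    fix b assume "b \<in> {b. (B, b) \<in> basis_index (- int n)}"
    then have b: "keys b \<subseteq> set vs" "supp b \<subseteq> B" "\<forall>i\<in>{1..h}. apex i \<in> B \<longrightarrow> apex i \<in> supp b" "mon_degree b = n"
      by (auto simp: basis_index_def)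
    have "B - (B - supp b) = supp b" using b by blast
    moreover have "B - supp b \<in> Pow ?M" using b by auto
    ultimately show "b \<in> (\<Union>Z\<in>Pow ?M. ?T (B - Z))"
      using keys_eq_supp[OF b(1)] b(4) by (intro UN_I[of "B - supp b"]) auto
  next
    fix b assume "b \<in> (\<Union>Z\<in>Pow ?M. ?T (B - Z))"
    then obtain Z where Z: "Z \<subseteq> ?M" "b \<in> ?T (B - Z)" by blast
    then have "supp b = B - Z" by (intro supp_T) auto
    moreover have "keys b \<subseteq> set vs" using Z Bs by auto
    ultimately show "b \<in> {b. (B, b) \<in> basis_index (- int n)}"
      using Z B by (auto simp: basis_index_def)
  qed
  have "card (\<Union>Z\<in>Pow ?M. ?T (B - Z)) = (\<Sum>Z\<in>Pow ?M. card (?T (B - Z)))"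
  proof (rule card_UN_disjoint)
    show "finite (Pow ?M)" using finB by simp
    show "\<forall>Z\<in>Pow ?M. finite (?T (B - Z))"
    proof
      fix Z
      show "finite (?T (B - Z))"
        by (rule finite_subset[OF _ finite_monomials[of "(!) vs ` B" n]]) (use finB in auto)
    qed
    show "\<forall>Z\<in>Pow ?M. \<forall>Z'\<in>Pow ?M. Z \<noteq> Z' \<longrightarrow> ?T (B - Z) \<inter> ?T (B - Z') = {}"
    proof (intro ballI impI, rule ccontr)
      fix Z Z' assume Z: "Z \<in> Pow ?M" "Z' \<in> Pow ?M" "Z \<noteq> Z'" and "?T (B - Z) \<inter> ?T (B - Z') \<noteq> {}"
      then obtain b where "b \<in> ?T (B - Z)" "b \<in> ?T (B - Z')" by blast
      then have "B - Z = B - Z'" using supp_T by (metis Diff_subset)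
      then show False using Z by auto
    qed
  qed
  then have "of_nat (card {b. (B, b) \<in> basis_index (- int n)}) = (\<Sum>Z\<in>Pow ?M. of_nat (card (?T (B - Z))) :: rat)"
    unfolding eq by simp
  also have "\<dots> = (\<Sum>Z\<in>Pow ?M. fps_nth (geom ^ (h - card Z)) n)"
  proof (rule sum.cong[OF refl])
    fix Z assume Z: "Z \<in> Pow ?M"
    have "inj_on ((!) vs) (B - Z)" using Bs distinct_vs by (auto intro!: inj_on_nth)
    then have "card ((!) vs ` (B - Z)) = card (B - Z)" by (rule card_image)
    also have "\<dots> = h - card Z" using Z finB cardB by (subst card_Diff_subset) (auto intro: finite_subset)
    finally show "of_nat (card (?T (B - Z))) = fps_nth (geom ^ (h - card Z)) n"
      using finB by (subst card_monomials_with_keys) auto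
  qed
  also have "\<dots> = (\<Sum>i\<le>N. of_nat (card ?M choose i) * fps_nth (geom ^ (h - i)) n)"
    using finB cardB N card_mono[OF finB, of ?M] by (intro sum_Pow_card) auto
  finally show ?thesis .
qed

lemma finite_facets: "finite {B. facet B}"
  by (rule finite_subset[of _ "Pow {..<length vs}"]) (auto dest: facet_subset)

text \<open>The number of basis elements is the coefficient of \<open>t\<^sup>l\<close>. The bound \<open>N\<close> of the summation is only required
  to be at least \<open>h\<close>, because the binomial coefficients vanish for \<open>i > h\<close>.\<close>

theorem card_basis_index:
  assumes "h \<le> N"
  shows "fls_nth (\<Sum>i\<le>N. \<Sum>B | facet B. of_nat (card (B - apex ` {1..h}) choose i) *
      (fls_X / (1 - fls_X)) powi (int h - int i)) (- l) = (of_nat (card (basis_index l)) :: rat)"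
proof -
  have coeff: "fls_nth (of_nat (card (B - apex ` {1..h}) choose i) * (fls_X / (1 - fls_X)) powi (int h - int i)) (- l)
      = (if l \<le> 0 then of_nat (card (B - apex ` {1..h}) choose i) * fps_nth (geom ^ (h - i)) (nat (- l)) else 0)"
    if B: "facet B" for B i
  proof (cases "i \<le> h")
    case True
    then have "int h - int i = int (h - i)" by simp
    then have "(fls_X / (1 - fls_X)) powi (int h - int i) = fps_to_fls (geom ^ (h - i))"
      by (simp only: geom_conv power_int_of_nat fps_to_fls_power)
    then show ?thesis by simp
  next
    case False
    have "card (B - apex ` {1..h}) \<le> card B"
      using B face_finite by (intro card_mono) (auto simp: facet_def)
    then have "card (B - apex ` {1..h}) choose i = 0"
      using B False by (simp add: facet_def binomial_eq_0)
    then show ?thesis by simp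
  qed
  have lhs: "fls_nth (\<Sum>i\<le>N. \<Sum>B | facet B. of_nat (card (B - apex ` {1..h}) choose i) *
      (fls_X / (1 - fls_X)) powi (int h - int i)) (- l) =
      (\<Sum>B | facet B. \<Sum>i\<le>N. (if l \<le> 0 then of_nat (card (B - apex ` {1..h}) choose i) *
        fps_nth (geom ^ (h - i)) (nat (- l)) else (0 :: rat)))"
    unfolding fls_nth_sum by (subst sum.swap, intro sum.cong refl, rule coeff) simp
  show ?thesis
  proof (cases "l \<le> 0")
    case False
    then have "basis_index l = {}" by (auto simp: basis_index_def)
    then show ?thesis unfolding lhs using False by simp
  next
    case True
    have "basis_index l = (SIGMA B:{B. facet B}. {b. (B, b) \<in> basis_index l})"
      by (auto simp: basis_index_def)
    then have "card (basis_index l) = (\<Sum>B | facet B. card {b. (B, b) \<in> basis_index l})"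
      using card_SigmaI[OF finite_facets, of "\<lambda>B. {b. (B, b) \<in> basis_index l}"] finite_fiber by simp
    moreover have "l = - int (nat (- l))" using True by simp
    ultimately show ?thesis
      unfolding lhs using True card_basis_index_fiber[OF _ assms, of _ "nat (- l)"] by simp
  qed
qed

end

section \<open>Clique corona graphs\<close>

text \<open>The edge ideal is spanned by the monomials whose support contains an edge.\<close>

lemma edge_ideal_iff:
  fixes \<Gamma> :: "'v ugraph" and p :: "('v, 'k::field) mpoly"
  assumes edges: "\<And>e. e \<in> uedges \<Gamma> \<Longrightarrow> \<exists>u\<in>uverts \<Gamma>. \<exists>v\<in>uverts \<Gamma>. u \<noteq> v \<and> e = {u, v}"
  shows "p \<in> edge_ideal \<Gamma> \<longleftrightarrow>
    p \<in> carrier (poly_ring_over (uverts \<Gamma>)) \<and> (\<forall>u\<in>keys p. \<exists>e\<in>uedges \<Gamma>. e \<subseteq> keys u)"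
proof -
  let ?S = "poly_ring_over (uverts \<Gamma>) :: ('v, 'k) mpoly ring"
  let ?G = "{pvar u * pvar v | u v. {u, v} \<in> uedges \<Gamma>} :: ('v, 'k) mpoly set"
  let ?J = "{p \<in> carrier ?S. \<forall>u\<in>keys p. \<exists>e\<in>uedges \<Gamma>. e \<subseteq> keys u}"
  interpret S: cring ?S by (rule cring_poly_ring)
  have ends: "u \<noteq> v" "u \<in> uverts \<Gamma>" "v \<in> uverts \<Gamma>" if "{u, v} \<in> uedges \<Gamma>" for u v
    using edges[OF that] by (auto simp: doubleton_eq_iff)
  have pp: "pvar u * pvar v = (single (single u 1 + single v 1) 1 :: ('v, 'k) mpoly)" for u v
    by (simp add: pvar_def mult_single)
  have G: "?G \<subseteq> ?J"
  proof
    fix g assume "g \<in> ?G"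
    then obtain u v where uv: "{u, v} \<in> uedges \<Gamma>" "g = single (single u 1 + single v 1) 1"
      by (auto simp: pp)
    then show "g \<in> ?J" using ends[OF uv(1)]
      by (auto simp: poly_ring_simps keys_add_nat intro!: bexI[OF _ uv(1)])
  qed
  have mult: "x * a \<in> ?J" if x: "x \<in> carrier ?S" and a: "a \<in> ?J" for x a
  proof -
    have "\<exists>e\<in>uedges \<Gamma>. e \<subseteq> keys u" if u: "u \<in> keys (x * a)" for u
    proof -
      obtain b c where "u = b + c" "c \<in> keys a" using u keys_mult[of x a] by blast
      moreover then obtain e where "e \<in> uedges \<Gamma>" "e \<subseteq> keys c" using a by blast
      ultimately show ?thesis by (intro bexI[of _ e]) (auto simp: keys_add_nat)
    qed
    then show ?thesis using x a by (auto intro: poly_ring_closed)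
  qed
  have J: "ideal ?J ?S"
  proof (rule idealI)
    show "ring ?S" by (rule S.ring_axioms)
    show "subgroup ?J (add_monoid ?S)"
    proof (rule group.subgroupI[OF S.a_group])
      have "0 \<in> ?J" by (simp add: poly_ring_simps)
      then show "?J \<noteq> {}" by blast
      show "x \<otimes>\<^bsub>add_monoid ?S\<^esub> y \<in> ?J" if "x \<in> ?J" "y \<in> ?J" for x y
        using that keys_add[of x y] by (auto simp: poly_ring_simps(2-) intro: poly_ring_closed)
      show "inv\<^bsub>add_monoid ?S\<^esub> x \<in> ?J" if x: "x \<in> ?J" for x
      proof -
        have "inv\<^bsub>add_monoid ?S\<^esub> x = - x"
          using poly_ring_uminus[of x "uverts \<Gamma>"] x by (simp add: a_inv_def)
        moreover have "keys (- x) = keys x" by (auto simp: in_keys_iff)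
        ultimately show ?thesis using x by (auto intro: poly_ring_closed)
      qed
    qed auto
    show "x \<otimes>\<^bsub>?S\<^esub> a \<in> ?J" "a \<otimes>\<^bsub>?S\<^esub> x \<in> ?J" if "a \<in> ?J" "x \<in> carrier ?S" for a x
      using mult[OF that(2,1)] by (simp_all add: poly_ring_simps(2) mult.commute)
  qed
  have Gc: "?G \<subseteq> carrier ?S" using G by blast
  have EI: "ideal (edge_ideal \<Gamma>) ?S" unfolding edge_ideal_def by (rule S.genideal_ideal[OF Gc])
  then interpret E: ideal "edge_ideal \<Gamma>" ?S .
  have "edge_ideal \<Gamma> \<subseteq> ?J" unfolding edge_ideal_def by (rule S.genideal_minimal[OF J G])
  moreover have "p \<in> edge_ideal \<Gamma>" if p: "p \<in> ?J" for p
  proof -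
    have mono: "single u c \<in> edge_ideal \<Gamma>" if u: "u \<in> keys p" for u and c :: 'k
    proof -
      obtain e where e: "e \<in> uedges \<Gamma>" "e \<subseteq> keys u" using p u by blast
      then obtain a b where ab: "a \<noteq> b" "e = {a, b}" using edges by blast
      let ?w = "u - single a 1 - single b 1"
      have "?w + (single a 1 + single b 1) = u"
        using ab e(2) by (intro poly_mapping_eqI)
          (auto simp: lookup_add lookup_minus lookup_single when_def in_keys_iff)
      then have "single u c = single ?w c * (pvar a * pvar b)"
        by (simp add: pp mult_single)
      moreover have "pvar a * pvar b \<in> (edge_ideal \<Gamma> :: ('v, 'k) mpoly set)"
        using S.genideal_self[OF Gc] e(1) unfolding ab(2) edge_ideal_def by blast
      moreover have "keys ?w \<subseteq> keys u" by (auto simp: in_keys_iff lookup_minus)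
      then have "single ?w c \<in> carrier ?S"
        using p u by (intro poly_ring_closed_single) (auto simp: poly_ring_simps)
      ultimately show ?thesis using E.I_l_closed by (simp add: poly_ring_simps(2))
    qed
    have "(\<Sum>u\<in>K. single u (lookup p u)) \<in> edge_ideal \<Gamma>" if "finite K" "K \<subseteq> keys p" for K
      using that
    proof (induct K)
      case empty
      then show ?case using E.zero_closed by (simp add: poly_ring_simps)
    next
      case (insert u K)
      then have "single u (lookup p u) \<in> edge_ideal \<Gamma>" "(\<Sum>u\<in>K. single u (lookup p u)) \<in> edge_ideal \<Gamma>"
        using mono by auto
      then show ?case using insert.hyps E.a_closed by (simp add: poly_ring_simps(5))
    qed
    from this[of "keys p"] show ?thesis using poly_mapping_sum_single[of p] by simp
  qed
  ultimately show ?thesis by blast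
qed

text \<open>The clique of a vertex of the corona graph, given by the vertex of the base graph that it contains.\<close>

primrec base :: "('a, 'b) corona_vertex \<Rightarrow> 'a" where
  "base (Xv i) = i" | "base (Yv i w) = i"

lemma corona_complete_edge_iff:
  "e \<in> uedges (corona G (\<lambda>i. complete_graph (W i))) \<longleftrightarrow>
    (\<exists>i j. {i, j} \<in> uedges G \<and> e = {Xv i, Xv j}) \<or>
    (\<exists>i\<in>uverts G. \<exists>u\<in>W i. \<exists>v\<in>W i. u \<noteq> v \<and> e = {Yv i u, Yv i v}) \<or>
    (\<exists>i\<in>uverts G. \<exists>w\<in>W i. e = {Xv i, Yv i w})"
  unfolding corona_def complete_graph_def by (auto simp: doubleton_eq_iff) blast+

text \<open>Sets of vertices that contain no edge.\<close>

definition independent_set :: "'v ugraph \<Rightarrow> 'v set \<Rightarrow> bool" where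
  "independent_set \<Gamma> U \<longleftrightarrow> U \<subseteq> uverts \<Gamma> \<and> (\<forall>e\<in>uedges \<Gamma>. \<not> e \<subseteq> U)"

lemma independent_set_mono:
  assumes "independent_set \<Gamma> U" and "U' \<subseteq> U"
  shows "independent_set \<Gamma> U'"
  unfolding independent_set_def
proof (intro conjI ballI notI)
  show "U' \<subseteq> uverts \<Gamma>" using assms by (auto simp: independent_set_def)
  fix e assume "e \<in> uedges \<Gamma>" "e \<subseteq> U'"
  moreover have "e \<subseteq> U" using \<open>e \<subseteq> U'\<close> assms(2) by (rule subset_trans)
  ultimately show False using assms(1) by (simp add: independent_set_def)
qed

text \<open>The clique corona graph \<open>\<Gamma>\<close>, with an enumeration \<open>vs\<close> of its vertices.\<close>

locale clique_corona =
  fixes h :: nat and m :: "nat \<Rightarrow> nat" and G :: "nat ugraph"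
    and \<Gamma> :: "(nat, nat) corona_vertex ugraph" and vs :: "(nat, nat) corona_vertex list"
  assumes G: "finite_simple_graph G" and vG: "uverts G = {1..h}"
    and m: "\<And>i. i \<in> {1..h} \<Longrightarrow> 1 \<le> m i"
    and \<Gamma>: "\<Gamma> = corona G (\<lambda>i. complete_graph {1..m i})"
    and dvs: "distinct vs" and svs: "set vs = uverts \<Gamma>"
begin

lemma verts: "uverts \<Gamma> = Xv ` {1..h} \<union> {Yv i w | i w. i \<in> {1..h} \<and> w \<in> {1..m i}}"
  by (simp add: \<Gamma> corona_def complete_graph_def vG)

lemma edge_iff: "e \<in> uedges \<Gamma> \<longleftrightarrow>
    (\<exists>i j. {i, j} \<in> uedges G \<and> e = {Xv i, Xv j}) \<or>
    (\<exists>i\<in>{1..h}. \<exists>u\<in>{1..m i}. \<exists>v\<in>{1..m i}. u \<noteq> v \<and> e = {Yv i u, Yv i v}) \<or>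
    (\<exists>i\<in>{1..h}. \<exists>w\<in>{1..m i}. e = {Xv i, Yv i w})"
  unfolding \<Gamma> corona_complete_edge_iff vG ..

lemma edge_ends: "e \<in> uedges \<Gamma> \<Longrightarrow> \<exists>u\<in>uverts \<Gamma>. \<exists>v\<in>uverts \<Gamma>. u \<noteq> v \<and> e = {u, v}"
proof -
  assume "e \<in> uedges \<Gamma>"
  then consider (1) i j where "{i, j} \<in> uedges G" "e = {Xv i, Xv j}"
    | (2) i u v where "i \<in> {1..h}" "u \<in> {1..m i}" "v \<in> {1..m i}" "u \<noteq> v" "e = {Yv i u, Yv i v}"
    | (3) i w where "i \<in> {1..h}" "w \<in> {1..m i}" "e = {Xv i, Yv i w}"
    unfolding edge_iff by blast
  then show ?thesis
  proof cases
    case 1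
    then have "i \<in> {1..h}" "j \<in> {1..h}" "i \<noteq> j"
      using G vG by (auto simp: finite_simple_graph_def doubleton_eq_iff dest!: bspec)
    then show ?thesis unfolding 1 verts by (intro bexI[of _ "Xv i"] bexI[of _ "Xv j"]) auto
  next
    case 2
    then show ?thesis unfolding 2 verts by (intro bexI[of _ "Yv i u"] bexI[of _ "Yv i v"]) auto
  next
    case 3
    then show ?thesis unfolding 3 verts by (intro bexI[of _ "Xv i"] bexI[of _ "Yv i w"]) auto
  qed
qed

lemma base_range: "u \<in> uverts \<Gamma> \<Longrightarrow> base u \<in> {1..h}"
  by (auto simp: verts)

lemma edge_XY: "i \<in> {1..h} \<Longrightarrow> w \<in> {1..m i} \<Longrightarrow> {Xv i, Yv i w} \<in> uedges \<Gamma>"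
  unfolding edge_iff by blast

lemma edge_YY: "i \<in> {1..h} \<Longrightarrow> u \<in> {1..m i} \<Longrightarrow> v \<in> {1..m i} \<Longrightarrow> u \<noteq> v \<Longrightarrow>
    {Yv i u, Yv i v} \<in> uedges \<Gamma>"
  unfolding edge_iff by blast

lemma same_base_edge:
  assumes "u \<in> uverts \<Gamma>" "v \<in> uverts \<Gamma>" "base u = base v" "u \<noteq> v"
  shows "{u, v} \<in> uedges \<Gamma>"
proof (cases u)
  case u: (Xv i)
  then obtain w where "v = Yv i w" using assms by (cases v) auto
  then show ?thesis using u assms(1,2) edge_XY by (auto simp: verts)
next
  case u: (Yv i w)
  show ?thesis
  proof (cases v)
    case (Xv j)
    then have "{v, u} \<in> uedges \<Gamma>" using u assms(1-3) edge_XY by (auto simp: verts)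
    then show ?thesis by (simp add: insert_commute)
  next
    case (Yv j w')
    then show ?thesis using u assms edge_YY by (auto simp: verts)
  qed
qed

lemma apex_edge:
  assumes "i \<in> {1..h}" "e \<in> uedges \<Gamma>" "Yv i (m i) \<in> e" "v \<in> e" "v \<noteq> Yv i (m i)"
  shows "base v = i"
  using assms unfolding edge_iff by auto

lemma independent_set_insert:
  assumes U: "independent_set \<Gamma> U" and i: "i \<in> {1..h}" "i \<notin> base ` U"
  shows "independent_set \<Gamma> (insert (Yv i (m i)) U)"
  unfolding independent_set_def
proof (intro conjI ballI notI)
  show "insert (Yv i (m i)) U \<subseteq> uverts \<Gamma>"
    using U i(1) m[OF i(1)] by (auto simp: independent_set_def verts)
  fix e assume e: "e \<in> uedges \<Gamma>" "e \<subseteq> insert (Yv i (m i)) U"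
  obtain u v where uv: "u \<noteq> v" "e = {u, v}" using edge_ends[OF e(1)] by blast
  have "Yv i (m i) \<in> e" using e U unfolding independent_set_def by blast
  then obtain w where w: "w \<in> e" "w \<noteq> Yv i (m i)" using uv by blast
  then have "w \<in> U" using e by blast
  then show False using apex_edge[OF i(1) e(1) \<open>Yv i (m i) \<in> e\<close> w] i(2) by blast
qed

text \<open>The independence complex of \<open>\<Gamma>\<close> and the apexes \<open>y\<^sub>i\<^sub>,\<^sub>m\<^sub>i\<close>, in terms of positions in \<open>vs\<close>.\<close>

definition face :: "nat set \<Rightarrow> bool" where
  "face F \<longleftrightarrow> F \<subseteq> {..<length vs} \<and> independent_set \<Gamma> ((!) vs ` F)"

definition apex :: "nat \<Rightarrow> nat" where
  "apex i = inv_into {..<length vs} ((!) vs) (Yv i (m i))"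

lemma nth_bij: "bij_betw ((!) vs) {..<length vs} (uverts \<Gamma>)"
  using bij_betw_nth[OF dvs, of "{..<length vs}" "set vs"] svs by simp

lemma apex: assumes "i \<in> {1..h}" shows "apex i < length vs" "vs ! apex i = Yv i (m i)"
proof -
  have mem: "Yv i (m i) \<in> (!) vs ` {..<length vs}"
    using assms m[OF assms] nth_bij by (auto simp: bij_betw_def verts)
  show "apex i < length vs" unfolding apex_def using inv_into_into[OF mem] by blast
  show "vs ! apex i = Yv i (m i)" unfolding apex_def by (rule f_inv_into_f[OF mem])
qed

lemma independent_base_inj: "independent_set \<Gamma> U \<Longrightarrow> inj_on base U"
proof (rule inj_onI, rule ccontr)
  fix u v assume U: "independent_set \<Gamma> U" and uv: "u \<in> U" "v \<in> U" "base u = base v" "u \<noteq> v"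
  then have "u \<in> uverts \<Gamma>" "v \<in> uverts \<Gamma>" by (auto simp: independent_set_def)
  then have "{u, v} \<in> uedges \<Gamma>" using uv(3,4) by (rule same_base_edge)
  then show False using U uv(1,2) by (auto simp: independent_set_def)
qed

lemma transversal_complex_corona:
  "transversal_complex vs face (edge_ideal \<Gamma> :: ((nat, nat) corona_vertex, 'k::field) mpoly set)
     h (\<lambda>j. base (vs ! j)) apex"
proof
  show "distinct vs" by (rule dvs)
  show "F \<subseteq> {..<length vs}" if "face F" for F using that by (simp add: face_def)
  show "face F'" if "face F" "F' \<subseteq> F" for F F'
  proof -
    have "(!) vs ` F' \<subseteq> (!) vs ` F" using that(2) by (rule image_mono)
    then have "independent_set \<Gamma> ((!) vs ` F')"
      using that(1) unfolding face_def by (metis independent_set_mono)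
    moreover have "F' \<subseteq> {..<length vs}" using that by (auto simp: face_def)
    ultimately show ?thesis by (simp add: face_def)
  qed
  have keys_eq: "(!) vs ` {j. j < length vs \<and> lookup u (vs ! j) \<noteq> 0} = keys u"
    if "keys u \<subseteq> uverts \<Gamma>" for u :: "(nat, nat) corona_vertex \<Rightarrow>\<^sub>0 nat"
  proof
    show "(!) vs ` {j. j < length vs \<and> lookup u (vs ! j) \<noteq> 0} \<subseteq> keys u"
      by (auto simp: in_keys_iff)
    show "keys u \<subseteq> (!) vs ` {j. j < length vs \<and> lookup u (vs ! j) \<noteq> 0}"
    proof
      fix v assume v: "v \<in> keys u"
      have "v \<in> set vs" unfolding svs using v that by (rule rev_subsetD)
      then obtain j where "j < length vs" "vs ! j = v"
        unfolding in_set_conv_nth by blast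
      then show "v \<in> (!) vs ` {j. j < length vs \<and> lookup u (vs ! j) \<noteq> 0}"
        using v by (intro image_eqI[of _ _ j]) (auto simp: in_keys_iff)
    qed
  qed
  have face_iff: "face {j. j < length vs \<and> lookup u (vs ! j) \<noteq> 0} \<longleftrightarrow> (\<forall>e\<in>uedges \<Gamma>. \<not> e \<subseteq> keys u)"
    if "keys u \<subseteq> uverts \<Gamma>" for u :: "(nat, nat) corona_vertex \<Rightarrow>\<^sub>0 nat"
  proof -
    have "{j. j < length vs \<and> lookup u (vs ! j) \<noteq> 0} \<subseteq> {..<length vs}" by blast
    then show ?thesis using that by (simp only: face_def independent_set_def keys_eq[OF that] simp_thms)
  qed
  have "(p \<in> edge_ideal \<Gamma>) = (p \<in> carrier (poly_ring_over (set vs)) \<and>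
      (\<forall>u\<in>keys p. \<not> face {j. j < length vs \<and> lookup u (vs ! j) \<noteq> 0}))"
    for p :: "((nat, nat) corona_vertex, 'k) mpoly"
    unfolding svs
  proof (subst edge_ideal_iff, erule edge_ends, rule conj_cong[OF refl], rule ball_cong[OF refl])
    fix u assume "p \<in> carrier (poly_ring_over (uverts \<Gamma>))" "u \<in> keys p"
    then have "keys u \<subseteq> uverts \<Gamma>" by (simp add: poly_ring_simps)
    then show "(\<exists>e\<in>uedges \<Gamma>. e \<subseteq> keys u) = (\<not> face {j. j < length vs \<and> lookup u (vs ! j) \<noteq> 0})"
      by (simp only: face_iff) blast
  qed
  then show "(edge_ideal \<Gamma> :: ((nat, nat) corona_vertex, 'k) mpoly set) = {p \<in> carrier (poly_ring_over (set vs)).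
      \<forall>u\<in>keys p. \<not> face {j. j < length vs \<and> lookup u (vs ! j) \<noteq> 0}}"
    by blast
  show "base (vs ! j) \<in> {1..h}" if "j < length vs" for j
    using that svs nth_mem by (intro base_range) blast
  show "apex i < length vs" if "i \<in> {1..h}" for i by (rule apex[OF that])
  show "base (vs ! apex i) = i" if "i \<in> {1..h}" for i using apex[OF that] by simp
  show "inj_on (\<lambda>j. base (vs ! j)) F" if "face F" for F
  proof -
    have "inj_on ((!) vs) F" using that nth_bij by (auto simp: face_def bij_betw_def intro: inj_on_subset)
    moreover have "inj_on base ((!) vs ` F)" using that by (intro independent_base_inj) (simp add: face_def)
    ultimately show ?thesis using comp_inj_on[of "(!) vs" F base] by (simp add: comp_def)
  qed
  show "face (insert (apex i) F)" if "face F" "i \<in> {1..h}" "i \<notin> (\<lambda>j. base (vs ! j)) ` F" for F i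
  proof -
    have "i \<notin> base ` (!) vs ` F" using that(3) by (simp add: image_image)
    then show ?thesis
      using that independent_set_insert[of "(!) vs ` F" i] apex[OF that(2)] by (simp add: face_def)
  qed
qed

lemma finite_verts: "finite (uverts \<Gamma>)"
  using svs by (metis List.finite_set)

lemma independent_card_le:
  assumes "independent_set \<Gamma> U"
  shows "card U \<le> h"
proof -
  have "base ` U \<subseteq> {1..h}" using assms base_range by (auto simp: independent_set_def)
  then have "card (base ` U) \<le> card {1..h}" by (intro card_mono) auto
  then show ?thesis by (simp add: card_image[OF independent_base_inj[OF assms]])
qed

lemma vertex_cover_iff:
  "C \<subseteq> uverts \<Gamma> \<Longrightarrow> vertex_cover \<Gamma> C \<longleftrightarrow> independent_set \<Gamma> (uverts \<Gamma> - C)"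
proof -
  assume C: "C \<subseteq> uverts \<Gamma>"
  have "e \<inter> C \<noteq> {} \<longleftrightarrow> \<not> e \<subseteq> uverts \<Gamma> - C" if "e \<in> uedges \<Gamma>" for e
    using edge_ends[OF that] by blast
  then show ?thesis using C unfolding vertex_cover_def independent_set_def by blast
qed

text \<open>A minimal vertex cover leaves out one vertex of each clique: if it contained a whole clique, then its
  apex could be removed.\<close>

lemma min_vertex_cover_iff:
  "C \<in> min_vertex_covers \<Gamma> \<longleftrightarrow>
    C \<subseteq> uverts \<Gamma> \<and> independent_set \<Gamma> (uverts \<Gamma> - C) \<and> card (uverts \<Gamma> - C) = h"
proof (intro iffI conjI)
  assume C: "C \<in> min_vertex_covers \<Gamma>"
  then show Cs: "C \<subseteq> uverts \<Gamma>" by (simp add: min_vertex_covers_def vertex_cover_def)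
  let ?U = "uverts \<Gamma> - C"
  show U: "independent_set \<Gamma> ?U"
    using C vertex_cover_iff[OF Cs] by (simp add: min_vertex_covers_def)
  show "card ?U = h"
  proof (rule ccontr)
    assume "card ?U \<noteq> h"
    then have "base ` ?U \<noteq> {1..h}" using card_image[OF independent_base_inj[OF U]] by auto
    moreover have "base ` ?U \<subseteq> {1..h}" using base_range by auto
    ultimately have "\<not> {1..h} \<subseteq> base ` ?U" by simp
    then obtain i where i: "i \<in> {1..h}" "i \<notin> base ` ?U" unfolding subset_iff by blast
    let ?y = "Yv i (m i)"
    have y: "?y \<in> uverts \<Gamma>" using i(1) m[OF i(1)] by (auto simp: verts)
    then have yC: "?y \<in> C" using i(2) by (metis DiffI base.simps(2) imageI)
    have "uverts \<Gamma> - (C - {?y}) = insert ?y ?U" using y by blast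
    then have "vertex_cover \<Gamma> (C - {?y})"
      using independent_set_insert[OF U i] Cs by (subst vertex_cover_iff) auto
    moreover have "C - {?y} \<subset> C" using yC by blast
    ultimately show False using C by (auto simp: min_vertex_covers_def)
  qed
next
  assume C: "C \<subseteq> uverts \<Gamma> \<and> independent_set \<Gamma> (uverts \<Gamma> - C) \<and> card (uverts \<Gamma> - C) = h"
  have "\<not> vertex_cover \<Gamma> D" if D: "D \<subset> C" for D
  proof
    assume "vertex_cover \<Gamma> D"
    then have "card (uverts \<Gamma> - D) \<le> h"
      using C D by (intro independent_card_le) (auto simp: vertex_cover_iff)
    moreover have "card (uverts \<Gamma> - C) < card (uverts \<Gamma> - D)"
      using C D finite_verts by (intro psubset_card_mono) auto
    ultimately show False using C by simp
  qed
  then show "C \<in> min_vertex_covers \<Gamma>"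
    using C by (auto simp: min_vertex_covers_def vertex_cover_iff)
qed

lemma hilbert_series_local_cohomology:
  "is_hilbert_series_tinv
    (edge_ring_local_cohomology TYPE('k::field) \<Gamma> vs h)
    (\<Sum>i\<le>card (uverts \<Gamma>). \<Sum>C\<in>min_vertex_covers \<Gamma>.
       of_nat (card (uverts \<Gamma> - (C \<union> {Yv j (m j) | j. j \<in> {1..h}})) choose i)
       * (fls_X / (1 - fls_X)) powi (int h - int i))"
proof -
  interpret T: transversal_complex vs face "edge_ideal \<Gamma> :: ((nat, nat) corona_vertex, 'k) mpoly set"
    h "\<lambda>j. base (vs ! j)" apex
    by (rule transversal_complex_corona)
  let ?V = "uverts \<Gamma>"
  have inj: "inj_on ((!) vs) {..<length vs}" and im: "(!) vs ` {..<length vs} = ?V"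
    using nth_bij by (auto simp: bij_betw_def)
  have card_im: "card ((!) vs ` B) = card B" if "B \<subseteq> {..<length vs}" for B
    by (rule card_image[OF inj_on_subset[OF inj that]])
  have bij: "bij_betw (\<lambda>B. ?V - (!) vs ` B) {B. T.facet B} (min_vertex_covers \<Gamma>)"
  proof (rule bij_betw_imageI)
    have sub: "(!) vs ` B \<subseteq> ?V" if "T.facet B" for B
      using T.facet_subset[OF that] im by blast
    show "inj_on (\<lambda>B. ?V - (!) vs ` B) {B. T.facet B}"
    proof (rule inj_onI)
      fix B B' assume B: "B \<in> {B. T.facet B}" "B' \<in> {B. T.facet B}" "?V - (!) vs ` B = ?V - (!) vs ` B'"
      then have "(!) vs ` B = (!) vs ` B'" using sub by blast
      then show "B = B'" using B T.facet_subset by (intro T.nth_image_inj) auto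
    qed
    show "(\<lambda>B. ?V - (!) vs ` B) ` {B. T.facet B} = min_vertex_covers \<Gamma>"
    proof (intro subset_antisym subsetI)
      fix C assume "C \<in> (\<lambda>B. ?V - (!) vs ` B) ` {B. T.facet B}"
      then obtain B where B: "T.facet B" "C = ?V - (!) vs ` B" by blast
      have "?V - C = (!) vs ` B" using sub[OF B(1)] B(2) by blast
      then show "C \<in> min_vertex_covers \<Gamma>"
        using B card_im[OF T.facet_subset[OF B(1)]]
        by (simp add: min_vertex_cover_iff T.facet_def face_def)
    next
      fix C assume "C \<in> min_vertex_covers \<Gamma>"
      then have C: "C \<subseteq> ?V" "independent_set \<Gamma> (?V - C)" "card (?V - C) = h"
        by (simp_all add: min_vertex_cover_iff)
      define B where "B = {j. j < length vs \<and> vs ! j \<in> ?V - C}"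
      have Bs: "B \<subseteq> {..<length vs}" by (auto simp: B_def)
      have vB: "(!) vs ` B = ?V - C" using im by (auto simp: B_def)
      have "card B = h" using card_im[OF Bs] C(3) vB by simp
      moreover have "face B" using C(2) Bs vB by (simp add: face_def)
      ultimately have "T.facet B" unfolding T.facet_def by blast
      moreover have "C = ?V - (!) vs ` B" using C(1) vB by blast
      ultimately show "C \<in> (\<lambda>B. ?V - (!) vs ` B) ` {B. T.facet B}" by blast
    qed
  qed
  have apex_im: "{Yv j (m j) | j. j \<in> {1..h}} = (!) vs ` apex ` {1..h}"
    using apex(2) by (auto simp: image_image)
  have cd: "card (?V - ((?V - (!) vs ` B) \<union> {Yv j (m j) | j. j \<in> {1..h}})) = card (B - apex ` {1..h})"
    if B: "T.facet B" for B
  proof -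
    note Bs = T.facet_subset[OF B]
    have As: "apex ` {1..h} \<subseteq> {..<length vs}" using apex(1) by auto
    have "?V - ((?V - (!) vs ` B) \<union> {Yv j (m j) | j. j \<in> {1..h}}) = (!) vs ` B - (!) vs ` apex ` {1..h}"
      unfolding apex_im using Bs im by blast
    also have "\<dots> = (!) vs ` (B - apex ` {1..h})"
      using inj_on_image_set_diff[OF inj, of B "apex ` {1..h}"] Bs As by auto
    finally show ?thesis using card_im[OF subset_trans[OF Diff_subset Bs]] by simp
  qed
  have "{1..h} = base ` {Yv j (m j) | j. j \<in> {1..h}}" by force
  then have "card {1..h} \<le> card {Yv j (m j) | j. j \<in> {1..h}}"
    by (metis (no_types, lifting) apex_im card_image_le finite_atLeastAtMost finite_imageI)
  also have "\<dots> \<le> card ?V"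
    using m by (intro card_mono finite_verts) (auto simp: verts)
  finally have hV: "h \<le> card ?V" by simp
  have series: "(\<Sum>i\<le>card ?V. \<Sum>C\<in>min_vertex_covers \<Gamma>.
       of_nat (card (?V - (C \<union> {Yv j (m j) | j. j \<in> {1..h}})) choose i)
       * (fls_X / (1 - fls_X)) powi (int h - int i)) =
     (\<Sum>i\<le>card ?V. \<Sum>B | T.facet B. of_nat (card (B - apex ` {1..h}) choose i) *
      (fls_X / (1 - fls_X) :: rat fls) powi (int h - int i))"
    by (rule sum.cong[OF refl], rule sum.reindex_bij_betw[OF bij, symmetric, THEN trans],
        rule sum.cong[OF refl]) (simp only: mem_Collect_eq cd)
  show ?thesis
    unfolding is_hilbert_series_tinv_def series
    using T.vectorspace_local_cohomology_comp T.card_basis_index[OF hV]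
    by (simp add: edge_ring_local_cohomology_def Let_def svs[symmetric])
qed

end

theorem corollary4p11:
  fixes h :: nat
    and m :: "nat \<Rightarrow> nat"
    and G :: "nat ugraph"
    and \<Gamma> :: "(nat, nat) corona_vertex ugraph"
    and vs :: "(nat, nat) corona_vertex list"
  assumes "finite_simple_graph G" and "uverts G = {1..h}"
    and "\<And>i. i \<in> {1..h} \<Longrightarrow> 1 \<le> m i"
    and "\<Gamma> = corona G (\<lambda>i. complete_graph {1..m i})"
    and "distinct vs" and "set vs = uverts \<Gamma>"
  shows "is_hilbert_series_tinv
    (edge_ring_local_cohomology TYPE('k::field) \<Gamma> vs h)
    (\<Sum>i\<le>card (uverts \<Gamma>). \<Sum>C\<in>min_vertex_covers \<Gamma>.
       of_nat (card (uverts \<Gamma> - (C \<union> {Yv j (m j) | j. j \<in> {1..h}})) choose i)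
       * (fls_X / (1 - fls_X)) powi (int h - int i))"
  using assms by (intro clique_corona.hilbert_series_local_cohomology clique_corona.intro)

end
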